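(* Let $\mathcal C$ and $\mathcal D$ be Reedy categories and let $G\colon \mathcal C \to \mathcal D$ be a Reedy functor. Then the induced functor of diagram categories $G^{*}\colon \mathcal M^{\mathcal D} \to \mathcal M^{\mathcal C}$ is a left Quillen functor (for the Reedy model category structures) for every model category $\mathcal M$ if and only if $G$ is a cofibering Reedy functor.
   Context: Model categories have all small limits and colimits. A Reedy category is a small category $\mathcal C$ together with two subcategories $\overrightarrow{\mathcal C}$ (the direct subcategory) and $\overleftarrow{\mathcal C}$ (the inverse subcategory), both containing all objects of $\mathcal C$, such that every object can be assigned a nonnegative integer (its degree) so that: every non-identity map of $\overrightarrow{\mathcal C}$ raises degree; every non-identity map of $\overleftarrow{\mathcal C}$ lowers degree; every map $g$ of $\mathcal C$ has a unique factorization $g = \overrightarrow g\,\overleftarrow g$ with $\overrightarrow g$ in $\overrightarrow{\mathcal C}$ and $\overleftarrow g$ in $\overleftarrow{\mathcal C}$. A Reedy functor $G\colon \mathcal C\to\mathcal D$ between Reedy categories is a functor taking $\overrightarrow{\mathcal C}$ into $\overrightarrow{\mathcal D}$ and $\overleftarrow{\mathcal C}$ into $\overleftarrow{\mathcal D}$ (it need not respect degrees, and may take non-identity maps to identity maps). Category of direct $\mathcal C$-factorizations. Let $\alpha\in\mathrm{Ob}(\mathcal C)$, $\beta\in\mathrm{Ob}(\mathcal D)$ and let $\sigma\colon \beta\to G\alpha$ be a map in $\overrightarrow{\mathcal D}$. The category $\mathrm{Fact}_{\overrightarrow{\mathcal C}}(\alpha,\sigma)$ has as objects the pairs $\bigl((\nu\colon\gamma\to\alpha),(\mu\colon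 \beta\to G\gamma)\bigr)$ with $\nu$ a non-identity map in $\overrightarrow{\mathcal C}$, $\mu$ a map in $\overrightarrow{\mathcal D}$, and $G\nu\circ\mu=\sigma$; a map from $\bigl((\nu\colon\gamma\to\alpha),\mu\bigr)$ to $\bigl((\nu'\colon\gamma'\to\alpha),\mu'\bigr)$ is a map $\tau\colon\gamma\to\gamma'$ in $\overrightarrow{\mathcal C}$ with $\nu'\tau=\nu$ and $G\tau\circ\mu=\mu'$. $G$ is a cofibering Reedy functor if for every $\alpha\in\mathrm{Ob}(\mathcal C)$, every $\beta\in\mathrm{Ob}(\mathcal D)$ and every map $\sigma\colon \beta\to G\alpha$ in $\overrightarrow{\mathcal D}$, the nerve of $\mathrm{Fact}_{\overrightarrow{\mathcal C}}(\alpha,\sigma)$ is either empty or connected. Diagrams. $\mathcal M^{\mathcal C}$ is the category of functors $\mathcal C\to\mathcal M$ and natural transformations. $G^{*}$ is precomposition with $G$. For a $\mathcal C$-diagram $X$ and $\alpha\in\mathrm{Ob}(\mathcal C)$, the latching category at $\alpha$ is the full subcategory of the overcategory $(\overrightarrow{\mathcal C}\downarrow\alpha)$ on all objects except $1_\alpha$, and the latching object $\mathrm L_\alpha X$ is the colimit of $X$ over it; the matching category at $\alpha$ is the full subcategory of the undercategory $(\alpha\downarrow\overleftarrow{\mathcal C})$ on all objects except $1_\alpha$, and the matching object $\mathrm M_\alpha X$ is the limit of $X$ over it. The Reedy model category structure on $\mathcal M^{\mathcal C}$: a map $X\to Y$ is a weak equivalence if every $X_\alpha\to Y_\alpha$ is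 a weak equivalence; a cofibration if every relative latching map $X_\alpha\amalg_{\mathrm L_\alpha X}\mathrm L_\alpha Y\to Y_\alpha$ is a cofibration; a fibration if every relative matching map $X_\alpha\to Y_\alpha\times_{\mathrm M_\alpha Y}\mathrm M_\alpha X$ is a fibration. A left Quillen functor between model categories is a functor that has a right adjoint and preserves cofibrations and trivial cofibrations. *)

theory Defs
  imports "HOL-Library.FuncSet" "HOL-Library.Infinite_Typeclass"
begin

section \<open>Categories, functors, natural transformations\<close>

record ('o, 'a) category =
  Ob :: "'o set"
  Ar :: "'a set"
  Dom :: "'a \<Rightarrow> 'o"
  Cod :: "'a \<Rightarrow> 'o"
  Idt :: "'o \<Rightarrow> 'a"
  Comp :: "'a \<Rightarrow> 'a \<Rightarrow> 'a"

text \<open>\<open>Comp C g f\<close> is \<open>g\<close> after \<open>f\<close>.\<close>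

definition Hom :: "('o, 'a, 'z) category_scheme \<Rightarrow> 'o \<Rightarrow> 'o \<Rightarrow> 'a set" where
  "Hom C a b = {f \<in> Ar C. Dom C f = a \<and> Cod C f = b}"

definition is_category :: "('o, 'a, 'z) category_scheme \<Rightarrow> bool" where
  "is_category C \<longleftrightarrow>
     (\<forall>f\<in>Ar C. Dom C f \<in> Ob C \<and> Cod C f \<in> Ob C) \<and>
     (\<forall>a\<in>Ob C. Idt C a \<in> Hom C a a) \<and>
     (\<forall>f\<in>Ar C. \<forall>g\<in>Ar C. Dom C g = Cod C f \<longrightarrow> Comp C g f \<in> Hom C (Dom C f) (Cod C g)) \<and>
     (\<forall>f\<in>Ar C. Comp C f (Idt C (Dom C f)) = f \<and> Comp C (Idt C (Cod C f)) f = f) \<and>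
     (\<forall>f\<in>Ar C. \<forall>g\<in>Ar C. \<forall>h\<in>Ar C. Dom C g = Cod C f \<longrightarrow> Dom C h = Cod C g \<longrightarrow>
        Comp C h (Comp C g f) = Comp C (Comp C h g) f)"

record ('o, 'a, 'p, 'b) func =
  fob :: "'o \<Rightarrow> 'p"
  far :: "'a \<Rightarrow> 'b"

text \<open>The two components are required to be \<open>undefined\<close> outside the source category, so that
  equality of HOL terms is equality of functors (and likewise for natural transformations).\<close>

definition is_functor ::
  "('o, 'a, 'y) category_scheme \<Rightarrow> ('p, 'b, 'z) category_scheme \<Rightarrow> ('o, 'a, 'p, 'b) func \<Rightarrow> bool" where
  "is_functor C D F \<longleftrightarrow>
     fob F \<in> Ob C \<rightarrow>\<^sub>E Ob D \<and>
     far F \<in> Ar C \<rightarrow>\<^sub>E Ar D \<and>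
     (\<forall>f\<in>Ar C. far F f \<in> Hom D (fob F (Dom C f)) (fob F (Cod C f))) \<and>
     (\<forall>a\<in>Ob C. far F (Idt C a) = Idt D (fob F a)) \<and>
     (\<forall>f\<in>Ar C. \<forall>g\<in>Ar C. Dom C g = Cod C f \<longrightarrow>
        far F (Comp C g f) = Comp D (far F g) (far F f))"

text \<open>The composite of \<open>F\<close> after \<open>U\<close>, where \<open>A\<close> is the source category of \<open>U\<close>.\<close>

definition func_comp ::
  "('o, 'a, 'z) category_scheme \<Rightarrow> ('p, 'b, 'q, 'c) func \<Rightarrow> ('o, 'a, 'p, 'b) func
     \<Rightarrow> ('o, 'a, 'q, 'c) func" where
  "func_comp A F U =
     \<lparr>fob = (\<lambda>a\<in>Ob A. fob F (fob U a)), far = (\<lambda>f\<in>Ar A. far F (far U f))\<rparr>"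

record ('o, 'a, 'p, 'b) nattrans =
  nsrc :: "('o, 'a, 'p, 'b) func"
  ntgt :: "('o, 'a, 'p, 'b) func"
  ncomp :: "'o \<Rightarrow> 'b"

definition is_nattrans ::
  "('o, 'a, 'y) category_scheme \<Rightarrow> ('p, 'b, 'z) category_scheme
     \<Rightarrow> ('o, 'a, 'p, 'b) nattrans \<Rightarrow> bool" where
  "is_nattrans C D t \<longleftrightarrow>
     is_functor C D (nsrc t) \<and> is_functor C D (ntgt t) \<and>
     ncomp t \<in> extensional (Ob C) \<and>
     (\<forall>a\<in>Ob C. ncomp t a \<in> Hom D (fob (nsrc t) a) (fob (ntgt t) a)) \<and>
     (\<forall>f\<in>Ar C. Comp D (ncomp t (Cod C f)) (far (nsrc t) f)
               = Comp D (far (ntgt t) f) (ncomp t (Dom C f)))"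

definition functor_category ::
  "('o, 'a, 'y) category_scheme \<Rightarrow> ('p, 'b, 'z) category_scheme
     \<Rightarrow> (('o, 'a, 'p, 'b) func, ('o, 'a, 'p, 'b) nattrans) category" where
  "functor_category C D =
     \<lparr>Ob = {F. is_functor C D F},
      Ar = {t. is_nattrans C D t},
      Dom = nsrc,
      Cod = ntgt,
      Idt = (\<lambda>F. \<lparr>nsrc = F, ntgt = F, ncomp = (\<lambda>a\<in>Ob C. Idt D (fob F a))\<rparr>),
      Comp = (\<lambda>t s. \<lparr>nsrc = nsrc s, ntgt = ntgt t,
                     ncomp = (\<lambda>a\<in>Ob C. Comp D (ncomp t a) (ncomp s a))\<rparr>)\<rparr>"

text \<open>The functor \<open>G\<^sup>*\<close> from \<open>D\<close>-diagrams to \<open>C\<close>-diagrams in \<open>M\<close>.\<close>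

definition precomposition ::
  "('o, 'a, 'x) category_scheme \<Rightarrow> ('p, 'b, 'y) category_scheme \<Rightarrow> ('q, 'c, 'z) category_scheme
     \<Rightarrow> ('o, 'a, 'p, 'b) func
     \<Rightarrow> (('p, 'b, 'q, 'c) func, ('p, 'b, 'q, 'c) nattrans,
         ('o, 'a, 'q, 'c) func, ('o, 'a, 'q, 'c) nattrans) func" where
  "precomposition C D M G =
     \<lparr>fob = (\<lambda>X\<in>Ob (functor_category D M). func_comp C X G),
      far = (\<lambda>t\<in>Ar (functor_category D M).
               \<lparr>nsrc = func_comp C (nsrc t) G, ntgt = func_comp C (ntgt t) G,
                ncomp = (\<lambda>a\<in>Ob C. ncomp t (fob G a))\<rparr>)\<rparr>"

text \<open>\<open>F : A \<rightarrow> B\<close> is left adjoint to \<open>R : B \<rightarrow> A\<close>.\<close>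

definition is_adjunction ::
  "('o, 'a, 'y) category_scheme \<Rightarrow> ('p, 'b, 'z) category_scheme
     \<Rightarrow> ('o, 'a, 'p, 'b) func \<Rightarrow> ('p, 'b, 'o, 'a) func \<Rightarrow> bool" where
  "is_adjunction A B F R \<longleftrightarrow>
     is_functor A B F \<and> is_functor B A R \<and>
     (\<exists>\<Phi>. (\<forall>a\<in>Ob A. \<forall>b\<in>Ob B. bij_betw (\<Phi> a b) (Hom B (fob F a) b) (Hom A a (fob R b))) \<and>
          (\<forall>f\<in>Ar A. \<forall>g\<in>Ar B. \<forall>h\<in>Hom B (fob F (Cod A f)) (Dom B g).
             \<Phi> (Dom A f) (Cod B g) (Comp B g (Comp B h (far F f)))
             = Comp A (far R g) (Comp A (\<Phi> (Cod A f) (Dom B g) h) f)))"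

section \<open>Limits and colimits\<close>

definition is_cocone ::
  "('o, 'a, 'y) category_scheme \<Rightarrow> ('p, 'b, 'z) category_scheme \<Rightarrow> ('o, 'a, 'p, 'b) func
     \<Rightarrow> 'p \<Rightarrow> ('o \<Rightarrow> 'b) \<Rightarrow> bool" where
  "is_cocone J M X c l \<longleftrightarrow>
     c \<in> Ob M \<and> (\<forall>j\<in>Ob J. l j \<in> Hom M (fob X j) c) \<and>
     (\<forall>f\<in>Ar J. Comp M (l (Cod J f)) (far X f) = l (Dom J f))"

definition is_colimit ::
  "('o, 'a, 'y) category_scheme \<Rightarrow> ('p, 'b, 'z) category_scheme \<Rightarrow> ('o, 'a, 'p, 'b) func
     \<Rightarrow> 'p \<Rightarrow> ('o \<Rightarrow> 'b) \<Rightarrow> bool" where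
  "is_colimit J M X c l \<longleftrightarrow>
     is_cocone J M X c l \<and>
     (\<forall>d m. is_cocone J M X d m \<longrightarrow>
        (\<exists>!u. u \<in> Hom M c d \<and> (\<forall>j\<in>Ob J. Comp M u (l j) = m j)))"

definition is_cone ::
  "('o, 'a, 'y) category_scheme \<Rightarrow> ('p, 'b, 'z) category_scheme \<Rightarrow> ('o, 'a, 'p, 'b) func
     \<Rightarrow> 'p \<Rightarrow> ('o \<Rightarrow> 'b) \<Rightarrow> bool" where
  "is_cone J M X c l \<longleftrightarrow>
     c \<in> Ob M \<and> (\<forall>j\<in>Ob J. l j \<in> Hom M c (fob X j)) \<and>
     (\<forall>f\<in>Ar J. Comp M (far X f) (l (Dom J f)) = l (Cod J f))"

definition is_limit ::
  "('o, 'a, 'y) category_scheme \<Rightarrow> ('p, 'b, 'z) category_scheme \<Rightarrow> ('o, 'a, 'p, 'b) func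
     \<Rightarrow> 'p \<Rightarrow> ('o \<Rightarrow> 'b) \<Rightarrow> bool" where
  "is_limit J M X c l \<longleftrightarrow>
     is_cone J M X c l \<and>
     (\<forall>d m. is_cone J M X d m \<longrightarrow>
        (\<exists>!u. u \<in> Hom M d c \<and> (\<forall>j\<in>Ob J. Comp M (l j) u = m j)))"

text \<open>Pushout \<open>(i : b \<rightarrow> p, j : c \<rightarrow> p)\<close> of \<open>f : a \<rightarrow> b\<close> and \<open>g : a \<rightarrow> c\<close>, and dually.\<close>

definition is_pushout ::
  "('o, 'a, 'z) category_scheme \<Rightarrow> 'a \<Rightarrow> 'a \<Rightarrow> 'a \<Rightarrow> 'a \<Rightarrow> bool" where
  "is_pushout M f g i j \<longleftrightarrow>
     f \<in> Ar M \<and> g \<in> Ar M \<and> Dom M f = Dom M g \<and>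
     i \<in> Hom M (Cod M f) (Cod M i) \<and> j \<in> Hom M (Cod M g) (Cod M i) \<and>
     Comp M i f = Comp M j g \<and>
     (\<forall>d. \<forall>r\<in>Hom M (Cod M f) d. \<forall>s\<in>Hom M (Cod M g) d. Comp M r f = Comp M s g \<longrightarrow>
        (\<exists>!u. u \<in> Hom M (Cod M i) d \<and> Comp M u i = r \<and> Comp M u j = s))"

definition is_pullback ::
  "('o, 'a, 'z) category_scheme \<Rightarrow> 'a \<Rightarrow> 'a \<Rightarrow> 'a \<Rightarrow> 'a \<Rightarrow> bool" where
  "is_pullback M f g i j \<longleftrightarrow>
     f \<in> Ar M \<and> g \<in> Ar M \<and> Cod M f = Cod M g \<and>
     i \<in> Hom M (Dom M i) (Dom M f) \<and> j \<in> Hom M (Dom M i) (Dom M g) \<and>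
     Comp M f i = Comp M g j \<and>
     (\<forall>d. \<forall>r\<in>Hom M d (Dom M f). \<forall>s\<in>Hom M d (Dom M g). Comp M f r = Comp M g s \<longrightarrow>
        (\<exists>!u. u \<in> Hom M d (Dom M i) \<and> Comp M i u = r \<and> Comp M j u = s))"

text \<open>The type \<open>'s\<close> plays the role of the universe of small sets: a small category is one whose
  objects and whose maps are elements of \<open>'s\<close>.  No closure properties of \<open>'s\<close> beyond being
  infinite are needed for this to be a workable notion (for infinite \<open>'s\<close> the sets of cardinality
  at most that of \<open>'s\<close> are closed under products of two sets and under unions indexed by
  \<open>'s\<close>).\<close>

definition has_small_limits :: "'s itself \<Rightarrow> ('p, 'b, 'z) category_scheme \<Rightarrow> bool" where
  "has_small_limits TYPE('s) M \<longleftrightarrow>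
     (\<forall>(J :: ('s, 's) category) X. is_category J \<longrightarrow> is_functor J M X \<longrightarrow>
        (\<exists>c l. is_limit J M X c l))"

definition has_small_colimits :: "'s itself \<Rightarrow> ('p, 'b, 'z) category_scheme \<Rightarrow> bool" where
  "has_small_colimits TYPE('s) M \<longleftrightarrow>
     (\<forall>(J :: ('s, 's) category) X. is_category J \<longrightarrow> is_functor J M X \<longrightarrow>
        (\<exists>c l. is_colimit J M X c l))"

section \<open>Model categories and left Quillen functors\<close>

record ('o, 'a) model_structure = "('o, 'a) category" +
  weq :: "'a set"
  cof :: "'a set"
  fib :: "'a set"

definition is_retract :: "('o, 'a, 'z) category_scheme \<Rightarrow> 'a \<Rightarrow> 'a \<Rightarrow> bool" where
  "is_retract M f g \<longleftrightarrow>
     (\<exists>i\<in>Hom M (Dom M f) (Dom M g). \<exists>r\<in>Hom M (Dom M g) (Dom M f).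
      \<exists>j\<in>Hom M (Cod M f) (Cod M g). \<exists>s\<in>Hom M (Cod M g) (Cod M f).
        Comp M r i = Idt M (Dom M f) \<and> Comp M s j = Idt M (Cod M f) \<and>
        Comp M g i = Comp M j f \<and> Comp M f r = Comp M s g)"

definition has_lifting :: "('o, 'a, 'z) category_scheme \<Rightarrow> 'a \<Rightarrow> 'a \<Rightarrow> bool" where
  "has_lifting M i p \<longleftrightarrow>
     (\<forall>f\<in>Hom M (Dom M i) (Dom M p). \<forall>g\<in>Hom M (Cod M i) (Cod M p).
        Comp M p f = Comp M g i \<longrightarrow>
        (\<exists>h\<in>Hom M (Cod M i) (Dom M p). Comp M h i = f \<and> Comp M p h = g))"

definition model_category :: "'s itself \<Rightarrow> ('o, 'a, 'z) model_structure_scheme \<Rightarrow> bool" where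
  "model_category TYPE('s) M \<longleftrightarrow>
     is_category M \<and>
     weq M \<subseteq> Ar M \<and> cof M \<subseteq> Ar M \<and> fib M \<subseteq> Ar M \<and>
     has_small_limits TYPE('s) M \<and> has_small_colimits TYPE('s) M \<and>
     (\<forall>f\<in>Ar M. \<forall>g\<in>Ar M. Dom M g = Cod M f \<longrightarrow>
        (f \<in> weq M \<and> g \<in> weq M \<longrightarrow> Comp M g f \<in> weq M) \<and>
        (f \<in> weq M \<and> Comp M g f \<in> weq M \<longrightarrow> g \<in> weq M) \<and>
        (g \<in> weq M \<and> Comp M g f \<in> weq M \<longrightarrow> f \<in> weq M)) \<and>
     (\<forall>f\<in>Ar M. \<forall>g\<in>Ar M. is_retract M f g \<longrightarrow>
        (g \<in> weq M \<longrightarrow> f \<in> weq M) \<and> (g \<in> cof M \<longrightarrow> f \<in> cof M) \<and> (g \<in> fib M \<longrightarrow> f \<in> fib M)) \<and>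
     (\<forall>i\<in>cof M. \<forall>p\<in>fib M. i \<in> weq M \<or> p \<in> weq M \<longrightarrow> has_lifting M i p) \<and>
     (\<forall>f\<in>Ar M.
        (\<exists>i\<in>cof M. \<exists>p\<in>fib M \<inter> weq M. Dom M p = Cod M i \<and> Comp M p i = f) \<and>
        (\<exists>i\<in>cof M \<inter> weq M. \<exists>p\<in>fib M. Dom M p = Cod M i \<and> Comp M p i = f))"

definition left_quillen ::
  "('o, 'a, 'y) model_structure_scheme \<Rightarrow> ('p, 'b, 'z) model_structure_scheme
     \<Rightarrow> ('o, 'a, 'p, 'b) func \<Rightarrow> bool" where
  "left_quillen A B F \<longleftrightarrow>
     is_functor A B F \<and>
     (\<exists>R. is_adjunction A B F R) \<and>
     (\<forall>f\<in>cof A. far F f \<in> cof B) \<and>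
     (\<forall>f\<in>cof A \<inter> weq A. far F f \<in> cof B \<inter> weq B)"

section \<open>Reedy categories and Reedy functors\<close>

record ('o, 'a) reedy = "('o, 'a) category" +
  direct :: "'a set"
  inverse :: "'a set"

definition wide_subcategory :: "('o, 'a, 'z) category_scheme \<Rightarrow> 'a set \<Rightarrow> bool" where
  "wide_subcategory C S \<longleftrightarrow>
     S \<subseteq> Ar C \<and> (\<forall>a\<in>Ob C. Idt C a \<in> S) \<and>
     (\<forall>f\<in>S. \<forall>g\<in>S. Dom C g = Cod C f \<longrightarrow> Comp C g f \<in> S)"

definition reedy_category :: "('o, 'a, 'z) reedy_scheme \<Rightarrow> bool" where
  "reedy_category C \<longleftrightarrow>
     is_category C \<and>
     wide_subcategory C (direct C) \<and> wide_subcategory C (inverse C) \<and>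
     (\<exists>deg :: 'o \<Rightarrow> nat.
        (\<forall>f\<in>direct C. f \<noteq> Idt C (Dom C f) \<longrightarrow> deg (Dom C f) < deg (Cod C f)) \<and>
        (\<forall>f\<in>inverse C. f \<noteq> Idt C (Dom C f) \<longrightarrow> deg (Cod C f) < deg (Dom C f))) \<and>
     (\<forall>g\<in>Ar C. \<exists>!(d, i). d \<in> direct C \<and> i \<in> inverse C \<and> Dom C d = Cod C i \<and> Comp C d i = g)"

definition reedy_functor ::
  "('o, 'a, 'y) reedy_scheme \<Rightarrow> ('p, 'b, 'z) reedy_scheme \<Rightarrow> ('o, 'a, 'p, 'b) func \<Rightarrow> bool" where
  "reedy_functor C D G \<longleftrightarrow>
     is_functor C D G \<and> far G ` direct C \<subseteq> direct D \<and> far G ` inverse C \<subseteq> inverse D"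

section \<open>Nerves and cofibering Reedy functors\<close>

text \<open>A simplicial set: \<open>act X m n \<theta>\<close> is the operator from \<open>n\<close>-simplices to \<open>m\<close>-simplices given by
  a monotone map \<open>\<theta> : [m] \<rightarrow> [n]\<close>.\<close>

record 'x simplicial_set =
  simplices :: "nat \<Rightarrow> 'x set"
  act :: "nat \<Rightarrow> nat \<Rightarrow> (nat \<Rightarrow> nat) \<Rightarrow> 'x \<Rightarrow> 'x"

definition sset_empty :: "'x simplicial_set \<Rightarrow> bool" where
  "sset_empty X \<longleftrightarrow> (\<forall>n. simplices X n = {})"

text \<open>Connectedness: exactly one path component, where the path components are the classes of
  vertices under the equivalence relation generated by the 1-simplices.\<close>

definition sset_edges :: "'x simplicial_set \<Rightarrow> ('x \<times> 'x) set" where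
  "sset_edges X = {(act X 0 1 (\<lambda>_. 0) e, act X 0 1 (\<lambda>_. 1) e) | e. e \<in> simplices X 1}"

definition sset_connected :: "'x simplicial_set \<Rightarrow> bool" where
  "sset_connected X \<longleftrightarrow>
     simplices X 0 \<noteq> {} \<and>
     (\<forall>x\<in>simplices X 0. \<forall>y\<in>simplices X 0. (x, y) \<in> (sset_edges X \<union> (sset_edges X)\<inverse>)\<^sup>*)"

text \<open>The ordinal \<open>[n] = {0 < \<dots> < n}\<close> as a category, the pair \<open>(i, j)\<close> being the map \<open>i \<rightarrow> j\<close>.\<close>

definition ordinal_category :: "nat \<Rightarrow> (nat, nat \<times> nat) category" where
  "ordinal_category n =
     \<lparr>Ob = {..n}, Ar = {(i, j). i \<le> j \<and> j \<le> n}, Dom = fst, Cod = snd,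
      Idt = (\<lambda>i. (i, i)), Comp = (\<lambda>g f. (fst f, snd g))\<rparr>"

definition nerve ::
  "('o, 'a, 'z) category_scheme \<Rightarrow> (nat, nat \<times> nat, 'o, 'a) func simplicial_set" where
  "nerve C =
     \<lparr>simplices = (\<lambda>n. {x. is_functor (ordinal_category n) C x}),
      act = (\<lambda>m n \<theta> x. func_comp (ordinal_category m) x \<lparr>fob = \<theta>, far = map_prod \<theta> \<theta>\<rparr>)\<rparr>"

text \<open>The category of direct \<open>C\<close>-factorizations of \<open>\<sigma> : \<beta> \<rightarrow> G \<alpha>\<close>; here \<open>\<beta> = Dom D \<sigma>\<close>.  Maps carry
  their source and target: \<open>(x, \<tau>, x')\<close> is the map \<open>x \<rightarrow> x'\<close> given by \<open>\<tau>\<close>.\<close>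

definition direct_factorizations ::
  "('o, 'a, 'y) reedy_scheme \<Rightarrow> ('p, 'b, 'z) reedy_scheme \<Rightarrow> ('o, 'a, 'p, 'b) func
     \<Rightarrow> 'o \<Rightarrow> 'b \<Rightarrow> ('a \<times> 'b, ('a \<times> 'b) \<times> 'a \<times> ('a \<times> 'b)) category" where
  "direct_factorizations C D G \<alpha> \<sigma> =
     (let Obs = {(\<nu>, \<mu>). \<nu> \<in> direct C \<and> Cod C \<nu> = \<alpha> \<and> \<nu> \<noteq> Idt C \<alpha> \<and>
                         \<mu> \<in> direct D \<and> \<mu> \<in> Hom D (Dom D \<sigma>) (fob G (Dom C \<nu>)) \<and>
                         Comp D (far G \<nu>) \<mu> = \<sigma>}
      in \<lparr>Ob = Obs,
          Ar = {((\<nu>, \<mu>), \<tau>, (\<nu>', \<mu>')). (\<nu>, \<mu>) \<in> Obs \<and> (\<nu>', \<mu>') \<in> Obs \<and>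
                  \<tau> \<in> direct C \<and> \<tau> \<in> Hom C (Dom C \<nu>) (Dom C \<nu>') \<and>
                  Comp C \<nu>' \<tau> = \<nu> \<and> Comp D (far G \<tau>) \<mu> = \<mu>'},
          Dom = (\<lambda>(x, \<tau>, x'). x),
          Cod = (\<lambda>(x, \<tau>, x'). x'),
          Idt = (\<lambda>(\<nu>, \<mu>). ((\<nu>, \<mu>), Idt C (Dom C \<nu>), (\<nu>, \<mu>))),
          Comp = (\<lambda>(y, \<tau>', z) (x, \<tau>, y'). (x, Comp C \<tau>' \<tau>, z))\<rparr>)"

definition cofibering ::
  "('o, 'a, 'y) reedy_scheme \<Rightarrow> ('p, 'b, 'z) reedy_scheme \<Rightarrow> ('o, 'a, 'p, 'b) func \<Rightarrow> bool" where
  "cofibering C D G \<longleftrightarrow>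
     (\<forall>\<alpha>\<in>Ob C. \<forall>\<beta>\<in>Ob D. \<forall>\<sigma>\<in>direct D. \<sigma> \<in> Hom D \<beta> (fob G \<alpha>) \<longrightarrow>
        sset_empty (nerve (direct_factorizations C D G \<alpha> \<sigma>)) \<or>
        sset_connected (nerve (direct_factorizations C D G \<alpha> \<sigma>)))"

section \<open>The Reedy model structure\<close>

definition direct_subcat :: "('o, 'a, 'z) reedy_scheme \<Rightarrow> ('o, 'a) category" where
  "direct_subcat C =
     \<lparr>Ob = Ob C, Ar = direct C, Dom = Dom C, Cod = Cod C, Idt = Idt C, Comp = Comp C\<rparr>"

definition inverse_subcat :: "('o, 'a, 'z) reedy_scheme \<Rightarrow> ('o, 'a) category" where
  "inverse_subcat C =
     \<lparr>Ob = Ob C, Ar = inverse C, Dom = Dom C, Cod = Cod C, Idt = Idt C, Comp = Comp C\<rparr>"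

definition full_subcategory :: "('o, 'a, 'z) category_scheme \<Rightarrow> 'o set \<Rightarrow> ('o, 'a) category" where
  "full_subcategory C S =
     \<lparr>Ob = Ob C \<inter> S, Ar = {f \<in> Ar C. Dom C f \<in> S \<and> Cod C f \<in> S},
      Dom = Dom C, Cod = Cod C, Idt = Idt C, Comp = Comp C\<rparr>"

text \<open>In over- and undercategories \<open>(\<nu>, \<tau>, \<nu>')\<close> is the map \<open>\<nu> \<rightarrow> \<nu>'\<close> given by \<open>\<tau>\<close>.\<close>

definition overcategory ::
  "('o, 'a, 'z) category_scheme \<Rightarrow> 'o \<Rightarrow> ('a, 'a \<times> 'a \<times> 'a) category" where
  "overcategory C \<alpha> =
     \<lparr>Ob = {\<nu> \<in> Ar C. Cod C \<nu> = \<alpha>},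
      Ar = {(\<nu>, \<tau>, \<nu>'). \<nu> \<in> Ar C \<and> Cod C \<nu> = \<alpha> \<and> \<nu>' \<in> Ar C \<and> Cod C \<nu>' = \<alpha> \<and>
              \<tau> \<in> Hom C (Dom C \<nu>) (Dom C \<nu>') \<and> Comp C \<nu>' \<tau> = \<nu>},
      Dom = (\<lambda>(\<nu>, \<tau>, \<nu>'). \<nu>),
      Cod = (\<lambda>(\<nu>, \<tau>, \<nu>'). \<nu>'),
      Idt = (\<lambda>\<nu>. (\<nu>, Idt C (Dom C \<nu>), \<nu>)),
      Comp = (\<lambda>(\<nu>', \<tau>', \<nu>'') (\<nu>, \<tau>, _). (\<nu>, Comp C \<tau>' \<tau>, \<nu>''))\<rparr>"

definition undercategory ::
  "('o, 'a, 'z) category_scheme \<Rightarrow> 'o \<Rightarrow> ('a, 'a \<times> 'a \<times> 'a) category" where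
  "undercategory C \<alpha> =
     \<lparr>Ob = {\<nu> \<in> Ar C. Dom C \<nu> = \<alpha>},
      Ar = {(\<nu>, \<tau>, \<nu>'). \<nu> \<in> Ar C \<and> Dom C \<nu> = \<alpha> \<and> \<nu>' \<in> Ar C \<and> Dom C \<nu>' = \<alpha> \<and>
              \<tau> \<in> Hom C (Cod C \<nu>) (Cod C \<nu>') \<and> Comp C \<tau> \<nu> = \<nu>'},
      Dom = (\<lambda>(\<nu>, \<tau>, \<nu>'). \<nu>),
      Cod = (\<lambda>(\<nu>, \<tau>, \<nu>'). \<nu>'),
      Idt = (\<lambda>\<nu>. (\<nu>, Idt C (Cod C \<nu>), \<nu>)),
      Comp = (\<lambda>(\<nu>', \<tau>', \<nu>'') (\<nu>, \<tau>, _). (\<nu>, Comp C \<tau>' \<tau>, \<nu>''))\<rparr>"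

definition latching_category ::
  "('o, 'a, 'z) reedy_scheme \<Rightarrow> 'o \<Rightarrow> ('a, 'a \<times> 'a \<times> 'a) category" where
  "latching_category C \<alpha> = full_subcategory (overcategory (direct_subcat C) \<alpha>) (- {Idt C \<alpha>})"

definition matching_category ::
  "('o, 'a, 'z) reedy_scheme \<Rightarrow> 'o \<Rightarrow> ('a, 'a \<times> 'a \<times> 'a) category" where
  "matching_category C \<alpha> = full_subcategory (undercategory (inverse_subcat C) \<alpha>) (- {Idt C \<alpha>})"

definition latching_diagram ::
  "('o, 'a, 'z) reedy_scheme \<Rightarrow> ('o, 'a, 'p, 'b) func \<Rightarrow> 'o
     \<Rightarrow> ('a, 'a \<times> 'a \<times> 'a, 'p, 'b) func" where
  "latching_diagram C X \<alpha> =
     func_comp (latching_category C \<alpha>) X \<lparr>fob = Dom C, far = (\<lambda>(\<nu>, \<tau>, \<nu>'). \<tau>)\<rparr>"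

definition matching_diagram ::
  "('o, 'a, 'z) reedy_scheme \<Rightarrow> ('o, 'a, 'p, 'b) func \<Rightarrow> 'o
     \<Rightarrow> ('a, 'a \<times> 'a \<times> 'a, 'p, 'b) func" where
  "matching_diagram C X \<alpha> =
     func_comp (matching_category C \<alpha>) X \<lparr>fob = Cod C, far = (\<lambda>(\<nu>, \<tau>, \<nu>'). \<tau>)\<rparr>"

text \<open>Latching and matching objects, and hence relative latching and matching maps, are determined
  only up to isomorphism, so they are treated as relations: \<open>L\<close> with legs \<open>l\<close> is a latching object
  of \<open>X\<close> at \<open>\<alpha>\<close> and \<open>a\<close> is the latching map \<open>L \<rightarrow> X\<^sub>\<alpha>\<close>; dually for matching.\<close>

definition is_latching ::
  "('o, 'a, 'y) reedy_scheme \<Rightarrow> ('p, 'b, 'z) category_scheme \<Rightarrow> ('o, 'a, 'p, 'b) func \<Rightarrow> 'o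
     \<Rightarrow> 'p \<Rightarrow> ('a \<Rightarrow> 'b) \<Rightarrow> 'b \<Rightarrow> bool" where
  "is_latching C M X \<alpha> L l a \<longleftrightarrow>
     is_colimit (latching_category C \<alpha>) M (latching_diagram C X \<alpha>) L l \<and>
     a \<in> Hom M L (fob X \<alpha>) \<and>
     (\<forall>\<nu>\<in>Ob (latching_category C \<alpha>). Comp M a (l \<nu>) = far X \<nu>)"

definition is_matching ::
  "('o, 'a, 'y) reedy_scheme \<Rightarrow> ('p, 'b, 'z) category_scheme \<Rightarrow> ('o, 'a, 'p, 'b) func \<Rightarrow> 'o
     \<Rightarrow> 'p \<Rightarrow> ('a \<Rightarrow> 'b) \<Rightarrow> 'b \<Rightarrow> bool" where
  "is_matching C M X \<alpha> L l a \<longleftrightarrow>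
     is_limit (matching_category C \<alpha>) M (matching_diagram C X \<alpha>) L l \<and>
     a \<in> Hom M (fob X \<alpha>) L \<and>
     (\<forall>\<nu>\<in>Ob (matching_category C \<alpha>). Comp M (l \<nu>) a = far X \<nu>)"

text \<open>With \<open>t : X \<rightarrow> Y\<close>, \<open>u\<close> is the induced map from \<open>L\<^sub>\<alpha> X\<close> to \<open>L\<^sub>\<alpha> Y\<close>, the maps \<open>i\<close> and \<open>j\<close> are those from
  \<open>X\<^sub>\<alpha>\<close> and \<open>L\<^sub>\<alpha> Y\<close> into the pushout, and \<open>g\<close> is the induced map from the pushout to \<open>Y\<^sub>\<alpha>\<close>.\<close>

definition is_relative_latching_map ::
  "('o, 'a, 'y) reedy_scheme \<Rightarrow> ('p, 'b, 'z) category_scheme \<Rightarrow> ('o, 'a, 'p, 'b) nattrans \<Rightarrow> 'o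
     \<Rightarrow> 'b \<Rightarrow> bool" where
  "is_relative_latching_map C M t \<alpha> g \<longleftrightarrow>
     (\<exists>LX lX aX LY lY aY u i j.
        is_latching C M (nsrc t) \<alpha> LX lX aX \<and>
        is_latching C M (ntgt t) \<alpha> LY lY aY \<and>
        u \<in> Hom M LX LY \<and>
        (\<forall>\<nu>\<in>Ob (latching_category C \<alpha>).
           Comp M u (lX \<nu>) = Comp M (lY \<nu>) (ncomp t (Dom C \<nu>))) \<and>
        is_pushout M aX u i j \<and>
        g \<in> Hom M (Cod M i) (fob (ntgt t) \<alpha>) \<and>
        Comp M g i = ncomp t \<alpha> \<and> Comp M g j = aY)"

definition is_relative_matching_map ::
  "('o, 'a, 'y) reedy_scheme \<Rightarrow> ('p, 'b, 'z) category_scheme \<Rightarrow> ('o, 'a, 'p, 'b) nattrans \<Rightarrow> 'o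
     \<Rightarrow> 'b \<Rightarrow> bool" where
  "is_relative_matching_map C M t \<alpha> g \<longleftrightarrow>
     (\<exists>LX lX aX LY lY aY u i j.
        is_matching C M (nsrc t) \<alpha> LX lX aX \<and>
        is_matching C M (ntgt t) \<alpha> LY lY aY \<and>
        u \<in> Hom M LX LY \<and>
        (\<forall>\<nu>\<in>Ob (matching_category C \<alpha>).
           Comp M (lY \<nu>) u = Comp M (ncomp t (Cod C \<nu>)) (lX \<nu>)) \<and>
        is_pullback M aY u i j \<and>
        g \<in> Hom M (fob (nsrc t) \<alpha>) (Dom M i) \<and>
        Comp M i g = ncomp t \<alpha> \<and> Comp M j g = aX)"

definition reedy_model ::
  "('o, 'a, 'y) reedy_scheme \<Rightarrow> ('p, 'b, 'z) model_structure_scheme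
     \<Rightarrow> (('o, 'a, 'p, 'b) func, ('o, 'a, 'p, 'b) nattrans) model_structure" where
  "reedy_model C M =
     (let MC = functor_category C M
      in \<lparr>Ob = Ob MC, Ar = Ar MC, Dom = Dom MC, Cod = Cod MC, Idt = Idt MC, Comp = Comp MC,
          weq = {t \<in> Ar MC. \<forall>\<alpha>\<in>Ob C. ncomp t \<alpha> \<in> weq M},
          cof = {t \<in> Ar MC. \<forall>\<alpha>\<in>Ob C. \<forall>g. is_relative_latching_map C M t \<alpha> g \<longrightarrow> g \<in> cof M},
          fib = {t \<in> Ar MC. \<forall>\<alpha>\<in>Ob C. \<forall>g. is_relative_matching_map C M t \<alpha> g \<longrightarrow> g \<in> fib M}\<rparr>)"

section \<open>A universe for model categories\<close>

text \<open>HOL cannot quantify over types inside a formula, so a hypothesis about every model category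
  has to fix a type in which the objects and maps live.  The types below are large enough to
  contain the category of all subsets of \<open>'s set\<close> and all functions between them, which has all
  limits and colimits indexed by categories on \<open>'s\<close>; a map is a triple of source, target and
  function.\<close>

type_synonym 's large_ob = "'s set set"
type_synonym 's large_ar = "'s set set \<times> 's set set \<times> ('s set \<Rightarrow> 's set)"

end

theory Submission
  imports Defs
begin

text \<open>
  A left Quillen functor has a right adjoint and preserves cofibrations and trivial cofibrations. For
  \<open>G\<^sup>*\<close> the right adjoint always exists: it is the right Kan extension, computed by limits over the
  categories of maps \<open>\<beta> \<rightarrow> G \<alpha>\<close> (\<open>right_Kan_extension\<close>, \<open>precomposition_has_right_adjoint\<close>). Weak
  equivalences of diagrams are objectwise, so \<open>G\<^sup>*\<close> preserves them. The theorem is therefore about one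
  question: when does \<open>G\<^sup>*\<close> preserve Reedy cofibrations?

  Cofibrations are the maps with the left lifting property against trivial fibrations. A lifting problem
  for the relative latching map of \<open>t : X \<rightarrow> Y\<close> at \<open>\<alpha>\<close> against \<open>p : A \<rightarrow> B\<close> amounts, by the universal
  properties of latching objects and pushouts, to compatible data: a map \<open>X\<^sub>\<alpha> \<rightarrow> A\<close>, a cocone with vertex
  \<open>A\<close> on the latching diagram of \<open>Y\<close>, and a map \<open>Y\<^sub>\<alpha> \<rightarrow> B\<close>; a lift is a map \<open>Y\<^sub>\<alpha> \<rightarrow> A\<close> that extends these
  data (\<open>reedy_cofibration_iff\<close>). Both directions of the theorem work with such latching problems, so
  that no colimit has to be computed.

  Let \<open>G\<close> be cofibering and \<open>t\<close> a Reedy cofibration of \<open>D\<close>-diagrams. To solve a latching problem for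
  \<open>G\<^sup>* t\<close> at \<open>\<alpha>\<close>, with cocone \<open>k\<close>, one constructs maps \<open>h\<^sub>\<sigma> : Y\<^sub>\<beta> \<rightarrow> A\<close> for all direct maps
  \<open>\<sigma> : \<beta> \<rightarrow> G \<alpha>\<close> at once, by recursion on the degree of \<open>\<beta>\<close>. If \<open>\<sigma>\<close> has a direct factorization
  \<open>\<sigma> = G \<nu> \<circ> \<mu>\<close>, then \<open>h\<^sub>\<sigma>\<close> has to be \<open>k\<^sub>\<nu> \<circ> Y \<mu>\<close>, which is independent of the factorization because the
  category of factorizations is connected. If there is none, the values already found form a latching
  problem for \<open>t\<close> at \<open>\<beta>\<close>, and \<open>h\<^sub>\<sigma>\<close> is a solution of it. The map \<open>h\<close> at the identity of \<open>G \<alpha>\<close> solves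
  the given problem (\<open>cofibering_preserves_cofibrations\<close>).

  Conversely, one model category suffices to detect cofibering functors: sets, with all maps as weak
  equivalences, injections as cofibrations and surjections as fibrations. A represented functor
  \<open>D(\<beta>, -)\<close> is Reedy cofibrant in it, because maps factor uniquely into an inverse and a direct map
  (\<open>represented_functor_cofibrant\<close>). The part of the latching object of \<open>D(\<beta>, G -)\<close> at \<open>\<alpha>\<close> that lies
  over a direct map \<open>\<sigma> : \<beta> \<rightarrow> G \<alpha>\<close> is the set of components of the category of factorizations of \<open>\<sigma>\<close>.
  If \<open>G\<^sup>*\<close> preserves cofibrations, the latching map is injective, so there is at most one component; in
  the form used here, the indicator function of one component extends to a function on \<open>D(\<beta>, G \<alpha>)\<close>,
  whose value at \<open>\<sigma>\<close> cannot tell two components apart (\<open>cofibering_if_left_quillen_set_model\<close>).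
\<close>

section \<open>Categories, functors and natural transformations\<close>

lemma comp_in_Hom:
  "is_category M \<Longrightarrow> f \<in> Hom M a b \<Longrightarrow> g \<in> Hom M b c \<Longrightarrow> Comp M g f \<in> Hom M a c"
  by (auto simp: is_category_def Hom_def)

lemma comp_assoc:
  "is_category M \<Longrightarrow> f \<in> Hom M a b \<Longrightarrow> g \<in> Hom M b c \<Longrightarrow> h \<in> Hom M c d
    \<Longrightarrow> Comp M (Comp M h g) f = Comp M h (Comp M g f)"
  by (simp add: is_category_def Hom_def)

lemma Idt_in_Hom: "is_category M \<Longrightarrow> a \<in> Ob M \<Longrightarrow> Idt M a \<in> Hom M a a"
  by (simp add: is_category_def)

lemma comp_Idt_right: "is_category M \<Longrightarrow> f \<in> Hom M a b \<Longrightarrow> Comp M f (Idt M a) = f"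
  by (auto simp: is_category_def Hom_def)

lemma comp_Idt_left: "is_category M \<Longrightarrow> f \<in> Hom M a b \<Longrightarrow> Comp M (Idt M b) f = f"
  by (auto simp: is_category_def Hom_def)

lemma Hom_Ob: "is_category M \<Longrightarrow> f \<in> Hom M a b \<Longrightarrow> a \<in> Ob M \<and> b \<in> Ob M"
  by (auto simp: is_category_def Hom_def)

lemma Ar_in_Hom: "f \<in> Ar M \<Longrightarrow> f \<in> Hom M (Dom M f) (Cod M f)"
  by (simp add: Hom_def)

lemma HomD: "f \<in> Hom M a b \<Longrightarrow> f \<in> Ar M \<and> Dom M f = a \<and> Cod M f = b"
  by (simp add: Hom_def)

lemma Dom_Cod_Ob: "is_category C \<Longrightarrow> f \<in> Ar C \<Longrightarrow> Dom C f \<in> Ob C \<and> Cod C f \<in> Ob C"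
  by (simp add: is_category_def)

lemma Idt_simps:
  "is_category C \<Longrightarrow> a \<in> Ob C \<Longrightarrow> Idt C a \<in> Ar C"
  "is_category C \<Longrightarrow> a \<in> Ob C \<Longrightarrow> Dom C (Idt C a) = a"
  "is_category C \<Longrightarrow> a \<in> Ob C \<Longrightarrow> Cod C (Idt C a) = a"
  by (simp_all add: is_category_def Hom_def)

lemma Comp_simps:
  "is_category C \<Longrightarrow> f \<in> Ar C \<Longrightarrow> g \<in> Ar C \<Longrightarrow> Dom C g = Cod C f \<Longrightarrow> Comp C g f \<in> Ar C"
  "is_category C \<Longrightarrow> f \<in> Ar C \<Longrightarrow> g \<in> Ar C \<Longrightarrow> Dom C g = Cod C f \<Longrightarrow> Dom C (Comp C g f) = Dom C f"
  "is_category C \<Longrightarrow> f \<in> Ar C \<Longrightarrow> g \<in> Ar C \<Longrightarrow> Dom C g = Cod C f \<Longrightarrow> Cod C (Comp C g f) = Cod C g"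
  by (simp_all add: is_category_def Hom_def)

lemma functor_Ob: "is_functor C D F \<Longrightarrow> a \<in> Ob C \<Longrightarrow> fob F a \<in> Ob D"
  by (auto simp: is_functor_def)

lemma functor_Hom:
  "is_functor C D F \<Longrightarrow> f \<in> Hom C a b \<Longrightarrow> far F f \<in> Hom D (fob F a) (fob F b)"
  by (auto simp: is_functor_def Hom_def)

lemma functor_Idt: "is_functor C D F \<Longrightarrow> a \<in> Ob C \<Longrightarrow> far F (Idt C a) = Idt D (fob F a)"
  by (auto simp: is_functor_def)

lemma functor_Comp:
  "is_functor C D F \<Longrightarrow> f \<in> Hom C a b \<Longrightarrow> g \<in> Hom C b c
    \<Longrightarrow> far F (Comp C g f) = Comp D (far F g) (far F f)"
  by (auto simp: is_functor_def Hom_def)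

lemma functor_eqI:
  assumes "is_functor C D F" "is_functor C D F'"
    "\<And>a. a \<in> Ob C \<Longrightarrow> fob F a = fob F' a" "\<And>f. f \<in> Ar C \<Longrightarrow> far F f = far F' f"
  shows "F = F'"
proof -
  have "fob F = fob F'"
    by (rule PiE_ext[of _ "Ob C" "\<lambda>_. Ob D"]) (use assms in \<open>auto simp: is_functor_def\<close>)
  moreover have "far F = far F'"
    by (rule PiE_ext[of _ "Ar C" "\<lambda>_. Ar D"]) (use assms in \<open>auto simp: is_functor_def\<close>)
  ultimately show ?thesis by (cases F, cases F') simp
qed

lemma func_comp_simps [simp]:
  "a \<in> Ob A \<Longrightarrow> fob (func_comp A F U) a = fob F (fob U a)"
  "f \<in> Ar A \<Longrightarrow> far (func_comp A F U) f = far F (far U f)"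
  by (simp_all add: func_comp_def)

text \<open>Restricting a functor along a family of object and arrow maps that respects the category
  structure again gives a functor, even if these maps are not cut down to their source.\<close>

lemma func_comp_is_functor:
  assumes "is_category A" "is_functor C D F"
    "\<And>a. a \<in> Ob A \<Longrightarrow> fob U a \<in> Ob C"
    "\<And>f. f \<in> Ar A \<Longrightarrow> far U f \<in> Hom C (fob U (Dom A f)) (fob U (Cod A f))"
    "\<And>a. a \<in> Ob A \<Longrightarrow> far U (Idt A a) = Idt C (fob U a)"
    "\<And>f g. f \<in> Ar A \<Longrightarrow> g \<in> Ar A \<Longrightarrow> Dom A g = Cod A f
       \<Longrightarrow> far U (Comp A g f) = Comp C (far U g) (far U f)"
  shows "is_functor A D (func_comp A F U)"
proof -
  have *: "far F (far U f) \<in> Hom D (fob F (fob U (Dom A f))) (fob F (fob U (Cod A f)))"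
    if "f \<in> Ar A" for f
    using functor_Hom[OF assms(2) assms(4)[OF that]] .
  have 1: "Dom A f \<in> Ob A" "Cod A f \<in> Ob A" if "f \<in> Ar A" for f
    using assms(1) that by (auto simp: is_category_def)
  have 2: "Idt A a \<in> Ar A" if "a \<in> Ob A" for a
    using assms(1) that by (auto simp: is_category_def Hom_def)
  have 3: "Comp A g f \<in> Ar A" if "f \<in> Ar A" "g \<in> Ar A" "Dom A g = Cod A f" for f g
    using assms(1) that by (auto simp: is_category_def Hom_def)
  have 4: "far F (Comp C (far U g) (far U f)) = Comp D (far F (far U g)) (far F (far U f))"
    if "f \<in> Ar A" "g \<in> Ar A" "Dom A g = Cod A f" for f g
    using functor_Comp[OF assms(2) assms(4)[OF that(1)]] assms(4)[OF that(2)] that(3) by simp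
  have 5: "far F (far U f) \<in> Ar D" if "f \<in> Ar A" for f
    using * that by (auto simp: Hom_def)
  show ?thesis
    unfolding is_functor_def
    using assms * 1 2 3 4 5 functor_Ob[OF assms(2)] functor_Idt[OF assms(2)]
    by (simp add: func_comp_def)
qed

lemma functor_comp_functor:
  "is_category A \<Longrightarrow> is_functor A C U \<Longrightarrow> is_functor C D F \<Longrightarrow> is_functor A D (func_comp A F U)"
  by (rule func_comp_is_functor) (auto simp: is_functor_def)

lemma nattrans_Hom:
  "is_nattrans C M t \<Longrightarrow> a \<in> Ob C \<Longrightarrow> ncomp t a \<in> Hom M (fob (nsrc t) a) (fob (ntgt t) a)"
  by (simp add: is_nattrans_def)

lemma nattrans_natural:
  "is_nattrans C M t \<Longrightarrow> f \<in> Hom C a b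
    \<Longrightarrow> Comp M (ncomp t b) (far (nsrc t) f) = Comp M (far (ntgt t) f) (ncomp t a)"
  by (auto simp: is_nattrans_def Hom_def)

lemma nattrans_functors:
  "is_nattrans C M t \<Longrightarrow> is_functor C M (nsrc t)" "is_nattrans C M t \<Longrightarrow> is_functor C M (ntgt t)"
  by (simp_all add: is_nattrans_def)

lemma functor_category_simps [simp]:
  "Ob (functor_category C D) = {F. is_functor C D F}"
  "Ar (functor_category C D) = {t. is_nattrans C D t}"
  "Dom (functor_category C D) = nsrc"
  "Cod (functor_category C D) = ntgt"
  "Idt (functor_category C D) F = \<lparr>nsrc = F, ntgt = F, ncomp = (\<lambda>a\<in>Ob C. Idt D (fob F a))\<rparr>"
  "Comp (functor_category C D) t s =
     \<lparr>nsrc = nsrc s, ntgt = ntgt t, ncomp = (\<lambda>a\<in>Ob C. Comp D (ncomp t a) (ncomp s a))\<rparr>"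
  by (simp_all add: functor_category_def)

lemma nattrans_eqI:
  assumes "is_nattrans C M s" "is_nattrans C M t" "nsrc s = nsrc t" "ntgt s = ntgt t"
    "\<And>a. a \<in> Ob C \<Longrightarrow> ncomp s a = ncomp t a"
  shows "s = t"
proof -
  have "ncomp s = ncomp t"
    using assms unfolding is_nattrans_def by (auto intro: extensionalityI)
  with assms show ?thesis by (cases s, cases t) simp
qed

lemma nattrans_eq_iff:
  "is_nattrans C M s \<Longrightarrow> is_nattrans C M t \<Longrightarrow> nsrc s = nsrc t \<Longrightarrow> ntgt s = ntgt t
    \<Longrightarrow> s = t \<longleftrightarrow> (\<forall>a\<in>Ob C. ncomp s a = ncomp t a)"
  by (auto intro: nattrans_eqI)

lemma functor_category_is_category:
  assumes C: "is_category C" and M: "is_category M"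
  shows "is_category (functor_category C M)" (is "is_category ?F")
proof -
  have I: "is_nattrans C M \<lparr>nsrc = F, ntgt = F, ncomp = (\<lambda>a\<in>Ob C. Idt M (fob F a))\<rparr>"
    if F: "is_functor C M F" for F
  proof -
    have "Dom C f \<in> Ob C" "Cod C f \<in> Ob C" if "f \<in> Ar C" for f
      using C that by (auto simp: is_category_def)
    then show ?thesis
      using F Idt_in_Hom[OF M functor_Ob[OF F]] comp_Idt_left[OF M functor_Hom[OF F Ar_in_Hom]]
        comp_Idt_right[OF M functor_Hom[OF F Ar_in_Hom]]
      by (simp add: is_nattrans_def)
  qed
  have K: "is_nattrans C M \<lparr>nsrc = nsrc s, ntgt = ntgt t,
                            ncomp = (\<lambda>a\<in>Ob C. Comp M (ncomp t a) (ncomp s a))\<rparr>"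
    if s: "is_nattrans C M s" and t: "is_nattrans C M t" and st: "nsrc t = ntgt s" for s t
  proof -
    have "Comp M (Comp M (ncomp t (Cod C f)) (ncomp s (Cod C f))) (far (nsrc s) f)
        = Comp M (far (ntgt t) f) (Comp M (ncomp t (Dom C f)) (ncomp s (Dom C f)))"
      if f: "f \<in> Ar C" for f
    proof -
      have o: "Dom C f \<in> Ob C" "Cod C f \<in> Ob C"
        using C f by (auto simp: is_category_def)
      note hs = functor_Hom[OF nattrans_functors(1)[OF s] Ar_in_Hom[OF f]]
        functor_Hom[OF nattrans_functors(2)[OF s] Ar_in_Hom[OF f]]
        functor_Hom[OF nattrans_functors(2)[OF t] Ar_in_Hom[OF f]]
        nattrans_Hom[OF s o(1)] nattrans_Hom[OF s o(2)]
        nattrans_Hom[OF t o(1), unfolded st] nattrans_Hom[OF t o(2), unfolded st]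
      have "Comp M (Comp M (ncomp t (Cod C f)) (ncomp s (Cod C f))) (far (nsrc s) f)
          = Comp M (ncomp t (Cod C f)) (Comp M (far (ntgt s) f) (ncomp s (Dom C f)))"
        using comp_assoc[OF M hs(1) hs(5) hs(7)] nattrans_natural[OF s Ar_in_Hom[OF f]] by simp
      also have "\<dots> = Comp M (Comp M (far (ntgt t) f) (ncomp t (Dom C f))) (ncomp s (Dom C f))"
        using comp_assoc[OF M hs(4) hs(2) hs(7)] nattrans_natural[OF t Ar_in_Hom[OF f]] st by simp
      also have "\<dots> = Comp M (far (ntgt t) f) (Comp M (ncomp t (Dom C f)) (ncomp s (Dom C f)))"
        using comp_assoc[OF M hs(4) hs(6) hs(3)] .
      finally show ?thesis .
    qed
    moreover have "Dom C f \<in> Ob C" "Cod C f \<in> Ob C" if "f \<in> Ar C" for f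
      using C that by (auto simp: is_category_def)
    ultimately show ?thesis
      using nattrans_functors(1)[OF s] nattrans_functors(2)[OF t]
        comp_in_Hom[OF M nattrans_Hom[OF s] nattrans_Hom[OF t, unfolded st]]
      by (simp add: is_nattrans_def)
  qed
  show ?thesis
    unfolding is_category_def
  proof (intro conjI ballI impI)
    fix f assume "f \<in> Ar ?F"
    then have f: "is_nattrans C M f" by simp
    show "Dom ?F f \<in> Ob ?F"
      "Cod ?F f \<in> Ob ?F"
      using nattrans_functors[OF f] by simp_all
    show "Comp ?F f (Idt ?F (Dom ?F f)) = f"
      using K[OF I[OF nattrans_functors(1)[OF f]] f]
      by (auto intro!: nattrans_eqI[OF _ f] simp: comp_Idt_right[OF M nattrans_Hom[OF f]] cong: restrict_cong)
    show "Comp ?F (Idt ?F (Cod ?F f)) f = f"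
      using K[OF f I[OF nattrans_functors(2)[OF f]]]
      by (auto intro!: nattrans_eqI[OF _ f] simp: comp_Idt_left[OF M nattrans_Hom[OF f]] cong: restrict_cong)
  next
    fix f g h assume "f \<in> Ar ?F" "g \<in> Ar ?F"
      "h \<in> Ar ?F"
      "Dom ?F g = Cod ?F f"
      "Dom ?F h = Cod ?F g"
    then have *: "is_nattrans C M f" "is_nattrans C M g" "is_nattrans C M h"
      and fg: "nsrc g = ntgt f" and gh: "nsrc h = ntgt g"
      by simp_all
    then show "Comp ?F h (Comp ?F g f) =
       Comp ?F (Comp ?F h g) f"
      using comp_assoc[OF M nattrans_Hom[OF *(1)] nattrans_Hom[OF *(2), unfolded fg]
          nattrans_Hom[OF *(3), unfolded gh]]
      by (auto intro!: restrict_ext)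
  qed (use I K in \<open>auto simp: Hom_def\<close>)
qed

section \<open>Limits and colimits of small diagrams\<close>

lemma cocone_Hom: "is_cocone J M X c l \<Longrightarrow> j \<in> Ob J \<Longrightarrow> l j \<in> Hom M (fob X j) c"
  by (simp add: is_cocone_def)

lemma cone_Hom: "is_cone J M X c l \<Longrightarrow> j \<in> Ob J \<Longrightarrow> l j \<in> Hom M c (fob X j)"
  by (simp add: is_cone_def)

lemma colimit_Hom: "is_colimit J M X c l \<Longrightarrow> j \<in> Ob J \<Longrightarrow> l j \<in> Hom M (fob X j) c"
  by (simp add: is_colimit_def is_cocone_def)

lemma colimit_induced:
  assumes "is_colimit J M X c l" "is_cocone J M X d m"
  obtains u where "u \<in> Hom M c d" "\<And>j. j \<in> Ob J \<Longrightarrow> Comp M u (l j) = m j"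
  using assms unfolding is_colimit_def by blast

lemma limit_induced:
  assumes "is_limit J M X c l" "is_cone J M X d m"
  obtains u where "u \<in> Hom M d c" "\<And>j. j \<in> Ob J \<Longrightarrow> Comp M (l j) u = m j"
  using assms unfolding is_limit_def by blast

lemma cocone_postcompose:
  assumes J: "is_category J" and M: "is_category M" and X: "is_functor J M X"
    and l: "is_cocone J M X c l" and u: "u \<in> Hom M c d"
  shows "is_cocone J M X d (\<lambda>j. Comp M u (l j))"
proof -
  have "Comp M (Comp M u (l (Cod J f))) (far X f) = Comp M u (l (Dom J f))" if f: "f \<in> Ar J" for f
  proof -
    have "Cod J f \<in> Ob J" using J f by (auto simp: is_category_def)
    from comp_assoc[OF M functor_Hom[OF X Ar_in_Hom[OF f]] cocone_Hom[OF l this] u]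
    show ?thesis using l f by (simp add: is_cocone_def)
  qed
  then show ?thesis
    using comp_in_Hom[OF M cocone_Hom[OF l] u] Hom_Ob[OF M u] by (simp add: is_cocone_def)
qed

lemma cone_precompose:
  assumes J: "is_category J" and M: "is_category M" and X: "is_functor J M X"
    and l: "is_cone J M X c l" and u: "u \<in> Hom M d c"
  shows "is_cone J M X d (\<lambda>j. Comp M (l j) u)"
proof -
  have "Comp M (far X f) (Comp M (l (Dom J f)) u) = Comp M (l (Cod J f)) u" if f: "f \<in> Ar J" for f
  proof -
    have "Dom J f \<in> Ob J" using J f by (auto simp: is_category_def)
    from comp_assoc[OF M u cone_Hom[OF l this] functor_Hom[OF X Ar_in_Hom[OF f]]]
    show ?thesis using l f by (simp add: is_cone_def)
  qed
  then show ?thesis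
    using comp_in_Hom[OF M u cone_Hom[OF l]] Hom_Ob[OF M u] by (simp add: is_cone_def)
qed

lemma colimit_map_eqI:
  assumes "is_category J" "is_category M" "is_functor J M X" "is_colimit J M X c l"
    "u \<in> Hom M c d" "v \<in> Hom M c d" "\<And>j. j \<in> Ob J \<Longrightarrow> Comp M u (l j) = Comp M v (l j)"
  shows "u = v"
proof -
  have "is_cocone J M X d (\<lambda>j. Comp M v (l j))"
    using assms by (intro cocone_postcompose) (auto simp: is_colimit_def)
  with assms(4) have "\<exists>!w. w \<in> Hom M c d \<and> (\<forall>j\<in>Ob J. Comp M w (l j) = Comp M v (l j))"
    unfolding is_colimit_def by blast
  with assms(5-7) show ?thesis by blast
qed

lemma limit_map_eqI:
  assumes "is_category J" "is_category M" "is_functor J M X" "is_limit J M X c l"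
    "u \<in> Hom M d c" "v \<in> Hom M d c" "\<And>j. j \<in> Ob J \<Longrightarrow> Comp M (l j) u = Comp M (l j) v"
  shows "u = v"
proof -
  have "is_cone J M X d (\<lambda>j. Comp M (l j) v)"
    using assms by (intro cone_precompose) (auto simp: is_limit_def)
  with assms(4) have "\<exists>!w. w \<in> Hom M d c \<and> (\<forall>j\<in>Ob J. Comp M (l j) w = Comp M (l j) v)"
    unfolding is_limit_def by blast
  with assms(5-7) show ?thesis by blast
qed

text \<open>The latching and comma categories of small categories have pairs and triples as objects or maps. They
  become small by relabelling, and a diagram has the same cones and cocones after relabelling.\<close>

definition relabel :: "('x \<Rightarrow> 's) \<Rightarrow> ('y \<Rightarrow> 's) \<Rightarrow> ('x, 'y) category \<Rightarrow> ('s, 's) category" where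
  "relabel e e' J =
     \<lparr>Ob = e ` Ob J, Ar = e' ` Ar J,
      Dom = (\<lambda>f. e (Dom J (inv e' f))), Cod = (\<lambda>f. e (Cod J (inv e' f))),
      Idt = (\<lambda>a. e' (Idt J (inv e a))), Comp = (\<lambda>g f. e' (Comp J (inv e' g) (inv e' f)))\<rparr>"

context
  fixes e :: "'x \<Rightarrow> 's" and e' :: "'y \<Rightarrow> 's" and J :: "('x, 'y) category"
    and M :: "('p, 'b, 'z) category_scheme" and X :: "('x, 'y, 'p, 'b) func"
  assumes e: "inj e" and e': "inj e'" and J: "is_category J" and X: "is_functor J M X"
begin

lemma relabel_simps:
  "Ob (relabel e e' J) = e ` Ob J" "Ar (relabel e e' J) = e' ` Ar J"
  "Dom (relabel e e' J) (e' f) = e (Dom J f)" "Cod (relabel e e' J) (e' f) = e (Cod J f)"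
  "Idt (relabel e e' J) (e a) = e' (Idt J a)"
  "Comp (relabel e e' J) (e' g) (e' f) = e' (Comp J g f)"
  using e e' by (simp_all add: relabel_def)

lemma relabel_is_category: "is_category (relabel e e' J)"
  using J e unfolding is_category_def Hom_def
  by (auto simp: relabel_simps inj_image_mem_iff inj_eq[OF e])

abbreviation "relabelled_diagram \<equiv> func_comp (relabel e e' J) X \<lparr>fob = inv e, far = inv e'\<rparr>"

lemma relabelled_diagram_simps:
  "a \<in> Ob J \<Longrightarrow> fob relabelled_diagram (e a) = fob X a"
  "f \<in> Ar J \<Longrightarrow> far relabelled_diagram (e' f) = far X f"
  using e e' by (simp_all add: relabel_simps)

lemma relabelled_is_functor: "is_functor (relabel e e' J) M relabelled_diagram"
  by (rule func_comp_is_functor[OF relabel_is_category X])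
    (use e e' J in \<open>auto simp: relabel_simps Hom_def inj_eq[OF e]\<close>)

lemma relabel_cocone_iff:
  "is_cocone (relabel e e' J) M relabelled_diagram c l \<longleftrightarrow> is_cocone J M X c (l \<circ> e)"
  using J by (simp add: is_cocone_def relabel_simps relabelled_diagram_simps del: func_comp_simps)

lemma relabel_cone_iff:
  "is_cone (relabel e e' J) M relabelled_diagram c l \<longleftrightarrow> is_cone J M X c (l \<circ> e)"
  using J by (simp add: is_cone_def relabel_simps relabelled_diagram_simps del: func_comp_simps)

lemma relabel_colimit:
  assumes "is_colimit (relabel e e' J) M relabelled_diagram c l"
  shows "is_colimit J M X c (l \<circ> e)"
proof -
  have "\<exists>!u. u \<in> Hom M c d \<and> (\<forall>j\<in>Ob J. Comp M u ((l \<circ> e) j) = m j)" if "is_cocone J M X d m" for d m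
  proof -
    have "m \<circ> inv e \<circ> e = m" using e by (auto simp: fun_eq_iff)
    with that have "is_cocone (relabel e e' J) M relabelled_diagram d (m \<circ> inv e)"
      by (simp only: relabel_cocone_iff)
    with assms have "\<exists>!u. u \<in> Hom M c d \<and> (\<forall>j\<in>Ob (relabel e e' J). Comp M u (l j) = (m \<circ> inv e) j)"
      unfolding is_colimit_def by blast
    then show ?thesis using e by (simp add: relabel_simps)
  qed
  then show ?thesis using assms unfolding is_colimit_def relabel_cocone_iff by blast
qed

lemma relabel_limit:
  assumes "is_limit (relabel e e' J) M relabelled_diagram c l"
  shows "is_limit J M X c (l \<circ> e)"
proof -
  have "\<exists>!u. u \<in> Hom M d c \<and> (\<forall>j\<in>Ob J. Comp M ((l \<circ> e) j) u = m j)" if "is_cone J M X d m" for d m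
  proof -
    have "m \<circ> inv e \<circ> e = m" using e by (auto simp: fun_eq_iff)
    with that have "is_cone (relabel e e' J) M relabelled_diagram d (m \<circ> inv e)"
      by (simp only: relabel_cone_iff)
    with assms have "\<exists>!u. u \<in> Hom M d c \<and> (\<forall>j\<in>Ob (relabel e e' J). Comp M (l j) u = (m \<circ> inv e) j)"
      unfolding is_limit_def by blast
    then show ?thesis using e by (simp add: relabel_simps)
  qed
  then show ?thesis using assms unfolding is_limit_def relabel_cone_iff by blast
qed

end

lemma small_colimit_exists:
  fixes J :: "('x, 'y) category"
  assumes "has_small_colimits TYPE('s) M" "is_category J" "is_functor J M X"
    and "inj (e :: 'x \<Rightarrow> 's)" "inj (e' :: 'y \<Rightarrow> 's)"
  shows "\<exists>c l. is_colimit J M X c l"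
  using relabel_colimit[OF assms(4,5,2,3)] relabelled_is_functor[OF assms(4,5,2,3)]
    relabel_is_category[OF assms(4,5,2,3)] assms(1)
  unfolding has_small_colimits_def by blast

lemma small_limit_exists:
  fixes J :: "('x, 'y) category"
  assumes "has_small_limits TYPE('s) M" "is_category J" "is_functor J M X"
    and "inj (e :: 'x \<Rightarrow> 's)" "inj (e' :: 'y \<Rightarrow> 's)"
  shows "\<exists>c l. is_limit J M X c l"
  using relabel_limit[OF assms(4,5,2,3)] relabelled_is_functor[OF assms(4,5,2,3)]
    relabel_is_category[OF assms(4,5,2,3)] assms(1)
  unfolding has_small_limits_def by blast

lemma inj_pair_exists: "\<exists>e :: 's \<times> 's \<Rightarrow> 's::infinite. inj e"
  using card_of_ordLeq[THEN iffD2,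
      OF ordIso_imp_ordLeq[OF card_of_Times_same_infinite[OF infinite_UNIV[where 'a = 's]]]]
  by auto

lemma inj_triple_exists: "\<exists>e :: 's \<times> 's \<times> 's \<Rightarrow> 's::infinite. inj e"
proof -
  obtain e :: "'s \<times> 's \<Rightarrow> 's" where e: "inj e" using inj_pair_exists by blast
  have "inj (\<lambda>(a, b, c). e (a, e (b, c)))"
    by (rule injI) (auto simp: inj_eq[OF e])
  then show ?thesis by blast
qed

lemma inj_nat_pair_exists: "\<exists>e :: nat \<times> nat \<Rightarrow> 's::infinite. inj e"
proof -
  obtain e :: "nat \<Rightarrow> 's" where e: "inj e"
    using infinite_countable_subset[OF infinite_UNIV] by blast
  obtain d :: "nat \<times> nat \<Rightarrow> nat" where "inj d" using inj_pair_exists by blast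
  from inj_compose[OF e this] show ?thesis by blast
qed

lemma pushout_exists:
  fixes M :: "('p, 'b, 'z) category_scheme"
  assumes M: "is_category M" and colim: "has_small_colimits TYPE('s::infinite) M"
    and f: "f \<in> Hom M a b" and g: "g \<in> Hom M a c"
  shows "\<exists>i j. is_pushout M f g i j"
proof -
  define S :: "(nat, nat \<times> nat) category" where
    "S = \<lparr>Ob = {0, 1, 2}, Ar = {(0, 0), (1, 1), (2, 2), (0, 1), (0, 2)}, Dom = fst, Cod = snd,
          Idt = (\<lambda>i. (i, i)), Comp = (\<lambda>g f. (fst f, snd g))\<rparr>"
  define V where "V = (\<lambda>i. if i = (0::nat) then a else if i = 1 then b else c)"
  define X :: "(nat, nat \<times> nat, 'p, 'b) func" where
    "X = \<lparr>fob = restrict V (Ob S),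
          far = (\<lambda>u\<in>Ar S. if u = (0, 1) then f else if u = (0, 2) then g else Idt M (V (fst u)))\<rparr>"
  have abc: "a \<in> Ob M" "b \<in> Ob M" "c \<in> Ob M" using Hom_Ob[OF M f] Hom_Ob[OF M g] by auto
  have S: "is_category S"
    by (auto simp: S_def is_category_def Hom_def)
  have X: "is_functor S M X"
    using abc Idt_in_Hom[OF M] f g HomD[OF f] HomD[OF g]
    unfolding is_functor_def
    by (auto simp: X_def S_def V_def comp_Idt_left[OF M f] comp_Idt_right[OF M f] Hom_def
        comp_Idt_left[OF M g] comp_Idt_right[OF M g] comp_Idt_left[OF M Idt_in_Hom[OF M]])
  obtain e :: "nat \<times> nat \<Rightarrow> 's" where e: "inj e" using inj_nat_pair_exists by blast
  then have "inj (\<lambda>n. e (n, n))" by (auto simp: inj_def)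
  from small_colimit_exists[OF colim S X this e] obtain q l where ql: "is_colimit S M X q l"
    by blast
  then have l: "l 0 \<in> Hom M a q" "l 1 \<in> Hom M b q" "l 2 \<in> Hom M c q"
    "Comp M (l 1) f = l 0" "Comp M (l 2) g = l 0"
    by (auto simp: is_colimit_def is_cocone_def X_def S_def V_def)
  have "\<exists>!u. u \<in> Hom M q d \<and> Comp M u (l 1) = r \<and> Comp M u (l 2) = s"
    if rs: "r \<in> Hom M b d" "s \<in> Hom M c d" "Comp M r f = Comp M s g" for d r s
  proof -
    let ?m = "\<lambda>i. if i = (0::nat) then Comp M r f else if i = 1 then r else s"
    have "is_cocone S M X d ?m"
      using rs comp_in_Hom[OF M f rs(1)] Hom_Ob[OF M rs(1)]
        comp_Idt_right[OF M rs(1)] comp_Idt_right[OF M rs(2)]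
        comp_Idt_right[OF M comp_in_Hom[OF M f rs(1)]]
      by (auto simp: is_cocone_def X_def S_def V_def)
    with ql have *: "\<exists>!u. u \<in> Hom M q d \<and> (\<forall>j\<in>Ob S. Comp M u (l j) = ?m j)"
      unfolding is_colimit_def by blast
    have "(u \<in> Hom M q d \<and> (\<forall>j\<in>Ob S. Comp M u (l j) = ?m j))
        \<longleftrightarrow> (u \<in> Hom M q d \<and> Comp M u (l 1) = r \<and> Comp M u (l 2) = s)" for u
      using comp_assoc[OF M f l(2), of u d] l(4) by (auto simp: S_def)
    with * show ?thesis by simp
  qed
  then have "is_pushout M f g (l 1) (l 2)"
    using HomD[OF f] HomD[OF g] l(2-5) HomD[OF l(2)] by (simp add: is_pushout_def)
  then show ?thesis by blast
qed

section \<open>Reedy cofibrations as solutions of latching problems\<close>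

lemma reedy_is_category: "reedy_category C \<Longrightarrow> is_category C"
  by (simp add: reedy_category_def)

lemma direct_Ar: "reedy_category C \<Longrightarrow> f \<in> direct C \<Longrightarrow> f \<in> Ar C"
  by (auto simp: reedy_category_def wide_subcategory_def)

lemma inverse_Ar: "reedy_category C \<Longrightarrow> f \<in> inverse C \<Longrightarrow> f \<in> Ar C"
  by (auto simp: reedy_category_def wide_subcategory_def)

lemma direct_Idt: "reedy_category C \<Longrightarrow> a \<in> Ob C \<Longrightarrow> Idt C a \<in> direct C"
  by (simp add: reedy_category_def wide_subcategory_def)

lemma inverse_Idt: "reedy_category C \<Longrightarrow> a \<in> Ob C \<Longrightarrow> Idt C a \<in> inverse C"
  by (simp add: reedy_category_def wide_subcategory_def)

lemma direct_Comp:
  "reedy_category C \<Longrightarrow> f \<in> direct C \<Longrightarrow> g \<in> direct C \<Longrightarrow> Dom C g = Cod C f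
    \<Longrightarrow> Comp C g f \<in> direct C"
  by (simp add: reedy_category_def wide_subcategory_def)

lemma direct_Hom: "reedy_category C \<Longrightarrow> f \<in> direct C \<Longrightarrow> f \<in> Hom C (Dom C f) (Cod C f)"
  by (simp add: Ar_in_Hom direct_Ar)

lemma reedy_degree:
  assumes "reedy_category C"
  obtains deg :: "'o \<Rightarrow> nat"
  where "\<And>f. f \<in> direct C \<Longrightarrow> f \<noteq> Idt C (Cod C f) \<Longrightarrow> deg (Dom C f) < deg (Cod C f)"
    and "\<And>f. f \<in> direct C \<Longrightarrow> deg (Dom C f) \<le> deg (Cod C f)"
proof -
  from assms obtain deg :: "'o \<Rightarrow> nat"
    where d: "\<And>f. f \<in> direct C \<Longrightarrow> f \<noteq> Idt C (Dom C f) \<Longrightarrow> deg (Dom C f) < deg (Cod C f)"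
    unfolding reedy_category_def by blast
  have i: "Dom C f = Cod C f" if "f \<in> direct C" "f = Idt C (Dom C f)" for f
    using Idt_simps(3)[OF reedy_is_category[OF assms]] direct_Ar[OF assms that(1)] that(2)
      Dom_Cod_Ob[OF reedy_is_category[OF assms]] by metis
  show thesis
    by (rule that[of deg]) (use d i in \<open>force intro: order_less_imp_le\<close>)+
qed

text \<open>The degree rises strictly along \<open>g\<close> and does not fall along \<open>f\<close>, so \<open>g f\<close> does not even have
  equal source and target. Hence the latching category is closed under precomposition with direct maps.\<close>

lemma direct_Comp_not_Idt:
  assumes C: "reedy_category C" and f: "f \<in> direct C" and g: "g \<in> direct C"
    and gf: "Dom C g = Cod C f" and g1: "g \<noteq> Idt C (Cod C g)"
  shows "Comp C g f \<noteq> Idt C (Cod C g)"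
proof
  note K = reedy_is_category[OF C]
  assume *: "Comp C g f = Idt C (Cod C g)"
  obtain deg :: "'a \<Rightarrow> nat"
    where d: "\<And>f. f \<in> direct C \<Longrightarrow> f \<noteq> Idt C (Cod C f) \<Longrightarrow> deg (Dom C f) < deg (Cod C f)"
      "\<And>f. f \<in> direct C \<Longrightarrow> deg (Dom C f) \<le> deg (Cod C f)"
    using reedy_degree[OF C] by metis
  have "Dom C f = Cod C g"
    using Comp_simps(2)[OF K direct_Ar[OF C f] direct_Ar[OF C g] gf] *
      Idt_simps(2)[OF K] Dom_Cod_Ob[OF K direct_Ar[OF C g]] by simp
  then show False using d(1)[OF g g1] d(2)[OF f] gf by simp
qed

lemma latching_category_simps:
  "Ob (latching_category C \<alpha>) = {\<nu> \<in> direct C. Cod C \<nu> = \<alpha> \<and> \<nu> \<noteq> Idt C \<alpha>}"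
  "Ar (latching_category C \<alpha>) =
     {(\<nu>, \<tau>, \<nu>'). \<nu> \<in> Ob (latching_category C \<alpha>) \<and> \<nu>' \<in> Ob (latching_category C \<alpha>) \<and>
        \<tau> \<in> direct C \<and> Dom C \<tau> = Dom C \<nu> \<and> Cod C \<tau> = Dom C \<nu>' \<and> Comp C \<nu>' \<tau> = \<nu>}"
  "Dom (latching_category C \<alpha>) (\<nu>, \<tau>, \<nu>') = \<nu>"
  "Cod (latching_category C \<alpha>) (\<nu>, \<tau>, \<nu>') = \<nu>'"
  "Idt (latching_category C \<alpha>) \<nu> = (\<nu>, Idt C (Dom C \<nu>), \<nu>)"
  "Comp (latching_category C \<alpha>) (\<nu>', \<tau>', \<nu>'') (\<nu>, \<tau>, \<rho>) = (\<nu>, Comp C \<tau>' \<tau>, \<nu>'')"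
  by (auto simp: latching_category_def full_subcategory_def overcategory_def direct_subcat_def Hom_def)

lemma latching_ObD:
  assumes "\<nu> \<in> Ob (latching_category C \<alpha>)"
  shows "\<nu> \<in> direct C" "Cod C \<nu> = \<alpha>" "\<nu> \<noteq> Idt C \<alpha>"
  using assms by (simp_all add: latching_category_simps)

lemma latching_Hom:
  "reedy_category C \<Longrightarrow> \<nu> \<in> Ob (latching_category C \<alpha>) \<Longrightarrow> \<nu> \<in> Hom C (Dom C \<nu>) \<alpha>"
  using direct_Hom by (fastforce simp: latching_category_simps)

lemma latching_Dom_Ob:
  "reedy_category C \<Longrightarrow> \<nu> \<in> Ob (latching_category C \<alpha>) \<Longrightarrow> Dom C \<nu> \<in> Ob C"
  using latching_Hom Hom_Ob reedy_is_category by metis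

lemma latching_is_category:
  assumes C: "reedy_category C"
  shows "is_category (latching_category C \<alpha>)" (is "is_category ?J")
proof -
  note K = reedy_is_category[OF C]
  have 1: "Comp C \<tau> (Idt C (Dom C \<tau>)) = \<tau>" "Comp C (Idt C (Cod C \<tau>)) \<tau> = \<tau>" if "\<tau> \<in> direct C" for \<tau>
    using comp_Idt_right[OF K direct_Hom[OF C that]] comp_Idt_left[OF K direct_Hom[OF C that]] .
  have 2: "Comp C (Comp C h g) f = Comp C h (Comp C g f)"
    if "f \<in> direct C" "g \<in> direct C" "h \<in> direct C" "Dom C g = Cod C f" "Dom C h = Cod C g" for f g h
    using comp_assoc[OF K, of f "Dom C f" "Cod C f" g "Cod C g" h "Cod C h"] that
    by (simp add: Hom_def direct_Ar[OF C])
  have 3: "Idt C (Dom C \<tau>) \<in> direct C" "Dom C (Idt C (Dom C \<tau>)) = Dom C \<tau>"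
    "Cod C (Idt C (Dom C \<tau>)) = Dom C \<tau>" if "\<tau> \<in> direct C" for \<tau>
    using that Dom_Cod_Ob[OF K] direct_Ar[OF C] direct_Idt[OF C] Idt_simps[OF K] by auto
  have 4: "Comp C g f \<in> direct C" "Dom C (Comp C g f) = Dom C f" "Cod C (Comp C g f) = Cod C g"
    if "f \<in> direct C" "g \<in> direct C" "Dom C g = Cod C f" for f g
    using that direct_Comp[OF C] direct_Ar[OF C] Comp_simps[OF K] by auto
  show ?thesis
    unfolding is_category_def
  proof (intro conjI ballI impI)
    fix f g assume *: "f \<in> Ar ?J" "g \<in> Ar ?J"
      "Dom ?J g = Cod ?J f"
    obtain \<nu> \<tau> \<nu>' \<nu>'' \<tau>' where f: "f = (\<nu>, \<tau>, \<nu>')" and g: "g = (\<nu>', \<tau>', \<nu>'')"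
      using *(3) by (cases f, cases g) (auto simp: latching_category_simps)
    then have \<tau>: "\<tau> \<in> direct C" "Dom C \<tau> = Dom C \<nu>" "Cod C \<tau> = Dom C \<nu>'" "Comp C \<nu>' \<tau> = \<nu>"
      and \<tau>': "\<tau>' \<in> direct C" "Dom C \<tau>' = Dom C \<nu>'" "Cod C \<tau>' = Dom C \<nu>''" "Comp C \<nu>'' \<tau>' = \<nu>'"
      and \<nu>: "\<nu> \<in> Ob ?J" "\<nu>'' \<in> Ob ?J"
      using * by (auto simp: latching_category_simps(2))
    have "\<nu>'' \<in> direct C" using \<nu>(2) by (simp add: latching_category_simps)
    with \<tau> \<tau>' have "Comp C \<nu>'' (Comp C \<tau>' \<tau>) = \<nu>"
      using 2[of \<tau> \<tau>' \<nu>''] by simp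
    with \<nu> \<tau> \<tau>' 4[of \<tau> \<tau>'] show "Comp ?J g f
        \<in> Hom ?J (Dom ?J f) (Cod ?J g)"
      by (simp add: latching_category_simps(2-) Hom_def f g)
  next
    fix f g h assume "f \<in> Ar ?J" "g \<in> Ar ?J"
      "h \<in> Ar ?J"
      "Dom ?J g = Cod ?J f"
      "Dom ?J h = Cod ?J g"
    then show "Comp ?J h (Comp ?J g f) =
        Comp ?J (Comp ?J h g) f"
      using 2 by (cases f, cases g, cases h) (simp add: latching_category_simps)
  next
    fix f assume "f \<in> Ar ?J"
    then show "Comp ?J f (Idt ?J (Dom ?J f)) = f"
      "Comp ?J (Idt ?J (Cod ?J f)) f = f"
      using 1 by (cases f; force simp: latching_category_simps)+
  next
    fix \<nu> assume "\<nu> \<in> Ob ?J"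
    then show "Idt ?J \<nu> \<in> Hom ?J \<nu> \<nu>"
      using 1 3 by (simp add: latching_category_simps Hom_def)
  qed (auto simp: latching_category_simps)
qed

lemma latching_diagram_fob:
  "\<nu> \<in> Ob (latching_category C \<alpha>) \<Longrightarrow> fob (latching_diagram C X \<alpha>) \<nu> = fob X (Dom C \<nu>)"
  by (simp add: latching_diagram_def)

lemma latching_diagram_far:
  "(\<nu>, \<tau>, \<nu>') \<in> Ar (latching_category C \<alpha>) \<Longrightarrow> far (latching_diagram C X \<alpha>) (\<nu>, \<tau>, \<nu>') = far X \<tau>"
  by (simp add: latching_diagram_def)

lemma latching_diagram_is_functor:
  assumes C: "reedy_category C" and X: "is_functor C M X"
  shows "is_functor (latching_category C \<alpha>) M (latching_diagram C X \<alpha>)"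
  unfolding latching_diagram_def
  using Dom_Cod_Ob[OF reedy_is_category[OF C]] direct_Ar[OF C]
  by (intro func_comp_is_functor[OF latching_is_category[OF C] X])
    (auto simp: latching_category_simps Hom_def)

text \<open>A map of the latching category with target \<open>\<nu>\<close> is the same as a direct map \<open>\<tau>\<close> into the source
  of \<open>\<nu>\<close>, its source being \<open>\<nu> \<tau>\<close>. This removes the triples from the cocone condition.\<close>

lemma latching_cocone_iff:
  assumes C: "reedy_category C"
  shows "is_cocone (latching_category C \<alpha>) M (latching_diagram C X \<alpha>) c l \<longleftrightarrow>
    c \<in> Ob M \<and> (\<forall>\<nu>\<in>Ob (latching_category C \<alpha>). l \<nu> \<in> Hom M (fob X (Dom C \<nu>)) c) \<and>
    (\<forall>\<nu>\<in>Ob (latching_category C \<alpha>). \<forall>\<tau>\<in>direct C. Cod C \<tau> = Dom C \<nu> \<longrightarrow>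
       Comp M (l \<nu>) (far X \<tau>) = l (Comp C \<nu> \<tau>))" (is "?L \<longleftrightarrow> ?R")
proof -
  note K = reedy_is_category[OF C]
  have 1: "(Comp C \<nu> \<tau>, \<tau>, \<nu>) \<in> Ar (latching_category C \<alpha>)"
    if "\<nu> \<in> Ob (latching_category C \<alpha>)" "\<tau> \<in> direct C" "Cod C \<tau> = Dom C \<nu>" for \<nu> \<tau>
    using that direct_Comp[OF C that(2)] direct_Comp_not_Idt[OF C that(2)]
      Comp_simps[OF K direct_Ar[OF C that(2)] direct_Ar[OF C]]
    by (auto simp: latching_category_simps)
  show ?thesis
  proof
    assume L: ?L
    show ?R
    proof (intro conjI ballI impI)
      fix \<nu> \<tau> assume *: "\<nu> \<in> Ob (latching_category C \<alpha>)" "\<tau> \<in> direct C" "Cod C \<tau> = Dom C \<nu>"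
      from L 1[OF *] show "Comp M (l \<nu>) (far X \<tau>) = l (Comp C \<nu> \<tau>)"
        by (force simp: is_cocone_def latching_diagram_far latching_category_simps(3,4))
    qed (use L in \<open>auto simp: is_cocone_def latching_diagram_fob\<close>)
  next
    assume R: ?R
    have "Comp M (l (Cod (latching_category C \<alpha>) f)) (far (latching_diagram C X \<alpha>) f)
          = l (Dom (latching_category C \<alpha>) f)" if f: "f \<in> Ar (latching_category C \<alpha>)" for f
    proof -
      obtain \<nu> \<tau> \<nu>' where [simp]: "f = (\<nu>, \<tau>, \<nu>')" by (cases f)
      have "\<nu>' \<in> Ob (latching_category C \<alpha>)" "\<tau> \<in> direct C" "Cod C \<tau> = Dom C \<nu>'" "Comp C \<nu>' \<tau> = \<nu>"
        using f by (auto simp: latching_category_simps(2))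
      with R f show ?thesis by (simp add: latching_diagram_far latching_category_simps(3,4))
    qed
    with R show ?L by (simp add: is_cocone_def latching_diagram_fob)
  qed
qed

lemma latching_coconeD:
  assumes "reedy_category C" "is_cocone (latching_category C \<alpha>) M (latching_diagram C X \<alpha>) c l"
    "\<nu> \<in> Ob (latching_category C \<alpha>)"
  shows "l \<nu> \<in> Hom M (fob X (Dom C \<nu>)) c"
    "\<tau> \<in> direct C \<Longrightarrow> Cod C \<tau> = Dom C \<nu> \<Longrightarrow> Comp M (l \<nu>) (far X \<tau>) = l (Comp C \<nu> \<tau>)"
  using assms(2,3) unfolding latching_cocone_iff[OF assms(1)] by blast+

lemma latching_map_cocone:
  assumes C: "reedy_category C" and M: "is_category M" and X: "is_functor C M X" and \<alpha>: "\<alpha> \<in> Ob C"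
  shows "is_cocone (latching_category C \<alpha>) M (latching_diagram C X \<alpha>) (fob X \<alpha>) (far X)"
  unfolding latching_cocone_iff[OF C]
  using functor_Ob[OF X \<alpha>] functor_Hom[OF X latching_Hom[OF C]]
    functor_Comp[OF X _ latching_Hom[OF C]] direct_Hom[OF C]
  by metis

lemma latching_exists:
  fixes C :: "('s::infinite, 's) reedy"
  assumes C: "reedy_category C" and M: "is_category M" and colim: "has_small_colimits TYPE('s) M"
    and X: "is_functor C M X" and \<alpha>: "\<alpha> \<in> Ob C"
  shows "\<exists>L l a. is_latching C M X \<alpha> L l a"
proof -
  obtain e :: "'s \<times> 's \<times> 's \<Rightarrow> 's" where e: "inj e" using inj_triple_exists by blast
  obtain L l where L: "is_colimit (latching_category C \<alpha>) M (latching_diagram C X \<alpha>) L l"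
    using small_colimit_exists[OF colim latching_is_category[OF C] latching_diagram_is_functor[OF C X]
        inj_on_id2 e] by blast
  obtain a where "a \<in> Hom M L (fob X \<alpha>)"
    "\<And>\<nu>. \<nu> \<in> Ob (latching_category C \<alpha>) \<Longrightarrow> Comp M a (l \<nu>) = far X \<nu>"
    using colimit_induced[OF L latching_map_cocone[OF C M X \<alpha>]] by metis
  with L have "is_latching C M X \<alpha> L l a" by (simp add: is_latching_def)
  then show ?thesis by blast
qed

lemma nattrans_latching_cocone:
  assumes C: "reedy_category C" and M: "is_category M" and t: "is_nattrans C M t"
    and l: "is_cocone (latching_category C \<alpha>) M (latching_diagram C (ntgt t) \<alpha>) c l"
  shows "is_cocone (latching_category C \<alpha>) M (latching_diagram C (nsrc t) \<alpha>) c
           (\<lambda>\<nu>. Comp M (l \<nu>) (ncomp t (Dom C \<nu>)))"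
proof -
  note K = reedy_is_category[OF C]
  note l' = l[unfolded latching_cocone_iff[OF C]]
  have *: "ncomp t (Dom C \<nu>) \<in> Hom M (fob (nsrc t) (Dom C \<nu>)) (fob (ntgt t) (Dom C \<nu>))"
    if "\<nu> \<in> Ob (latching_category C \<alpha>)" for \<nu>
    using nattrans_Hom[OF t latching_Dom_Ob[OF C that]] .
  have "Comp M (Comp M (l \<nu>) (ncomp t (Dom C \<nu>))) (far (nsrc t) \<tau>)
      = Comp M (l (Comp C \<nu> \<tau>)) (ncomp t (Dom C (Comp C \<nu> \<tau>)))"
    if \<nu>: "\<nu> \<in> Ob (latching_category C \<alpha>)" and \<tau>: "\<tau> \<in> direct C" "Cod C \<tau> = Dom C \<nu>" for \<nu> \<tau>
  proof -
    have \<tau>': "\<tau> \<in> Hom C (Dom C \<tau>) (Dom C \<nu>)" using direct_Hom[OF C \<tau>(1)] \<tau>(2) by simp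
    have d: "Dom C \<tau> \<in> Ob C" using Hom_Ob[OF K \<tau>'] by blast
    have l\<nu>: "l \<nu> \<in> Hom M (fob (ntgt t) (Dom C \<nu>)) c" using l' \<nu> by blast
    have "Comp M (Comp M (l \<nu>) (ncomp t (Dom C \<nu>))) (far (nsrc t) \<tau>)
        = Comp M (l \<nu>) (Comp M (far (ntgt t) \<tau>) (ncomp t (Dom C \<tau>)))"
      using comp_assoc[OF M functor_Hom[OF nattrans_functors(1)[OF t] \<tau>'] *[OF \<nu>] l\<nu>]
        nattrans_natural[OF t \<tau>'] by simp
    also have "\<dots> = Comp M (Comp M (l \<nu>) (far (ntgt t) \<tau>)) (ncomp t (Dom C \<tau>))"
      using comp_assoc[OF M nattrans_Hom[OF t d] functor_Hom[OF nattrans_functors(2)[OF t] \<tau>'] l\<nu>]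
      by simp
    also have "Comp M (l \<nu>) (far (ntgt t) \<tau>) = l (Comp C \<nu> \<tau>)"
      using l' \<nu> \<tau> by blast
    also have "Dom C \<tau> = Dom C (Comp C \<nu> \<tau>)"
      using Comp_simps(2)[OF K direct_Ar[OF C \<tau>(1)] direct_Ar[OF C latching_ObD(1)[OF \<nu>]]] \<tau>(2) by simp
    finally show ?thesis .
  qed
  then show ?thesis
    unfolding latching_cocone_iff[OF C] using l' comp_in_Hom[OF M *] by blast
qed

lemma relative_latching_map_exists:
  fixes C :: "('s::infinite, 's) reedy"
  assumes C: "reedy_category C" and M: "is_category M" and colim: "has_small_colimits TYPE('s) M"
    and t: "is_nattrans C M t" and \<alpha>: "\<alpha> \<in> Ob C"
  shows "\<exists>g. is_relative_latching_map C M t \<alpha> g"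
proof -
  note X = nattrans_functors(1)[OF t] and Y = nattrans_functors(2)[OF t]
  note Lc = latching_is_category[OF C, of \<alpha>]
  obtain LX lX aX LY lY aY where LX: "is_latching C M (nsrc t) \<alpha> LX lX aX"
    and LY: "is_latching C M (ntgt t) \<alpha> LY lY aY"
    using latching_exists[OF C M colim X \<alpha>] latching_exists[OF C M colim Y \<alpha>] by blast
  have cX: "is_colimit (latching_category C \<alpha>) M (latching_diagram C (nsrc t) \<alpha>) LX lX"
    and aX: "aX \<in> Hom M LX (fob (nsrc t) \<alpha>)"
    and aX': "\<And>\<nu>. \<nu> \<in> Ob (latching_category C \<alpha>) \<Longrightarrow> Comp M aX (lX \<nu>) = far (nsrc t) \<nu>"
    using LX by (auto simp: is_latching_def)
  have cY: "is_colimit (latching_category C \<alpha>) M (latching_diagram C (ntgt t) \<alpha>) LY lY"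
    and aY: "aY \<in> Hom M LY (fob (ntgt t) \<alpha>)"
    and aY': "\<And>\<nu>. \<nu> \<in> Ob (latching_category C \<alpha>) \<Longrightarrow> Comp M aY (lY \<nu>) = far (ntgt t) \<nu>"
    using LY by (auto simp: is_latching_def)
  have "is_cocone (latching_category C \<alpha>) M (latching_diagram C (nsrc t) \<alpha>) LY
          (\<lambda>\<nu>. Comp M (lY \<nu>) (ncomp t (Dom C \<nu>)))"
    using nattrans_latching_cocone[OF C M t] cY by (simp add: is_colimit_def)
  from colimit_induced[OF cX this] obtain u where u: "u \<in> Hom M LX LY"
    "\<And>\<nu>. \<nu> \<in> Ob (latching_category C \<alpha>) \<Longrightarrow> Comp M u (lX \<nu>) = Comp M (lY \<nu>) (ncomp t (Dom C \<nu>))"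
    by metis
  obtain i j where po: "is_pushout M aX u i j" using pushout_exists[OF M colim aX u(1)] by blast
  have lX: "lX \<nu> \<in> Hom M (fob (nsrc t) (Dom C \<nu>)) LX" and lY: "lY \<nu> \<in> Hom M (fob (ntgt t) (Dom C \<nu>)) LY"
    if "\<nu> \<in> Ob (latching_category C \<alpha>)" for \<nu>
    using colimit_Hom[OF cX that] colimit_Hom[OF cY that] latching_diagram_fob[OF that] by metis+
  have ta: "ncomp t \<alpha> \<in> Hom M (fob (nsrc t) \<alpha>) (fob (ntgt t) \<alpha>)" by (rule nattrans_Hom[OF t \<alpha>])
  have "Comp M (ncomp t \<alpha>) aX = Comp M aY u"
  proof (rule colimit_map_eqI[OF Lc M latching_diagram_is_functor[OF C X] cX
      comp_in_Hom[OF M aX ta] comp_in_Hom[OF M u(1) aY]])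
    fix \<nu> assume \<nu>: "\<nu> \<in> Ob (latching_category C \<alpha>)"
    have "Comp M (Comp M (ncomp t \<alpha>) aX) (lX \<nu>) = Comp M (far (ntgt t) \<nu>) (ncomp t (Dom C \<nu>))"
      using comp_assoc[OF M lX[OF \<nu>] aX ta] aX'[OF \<nu>] nattrans_natural[OF t latching_Hom[OF C \<nu>]] by simp
    also have "\<dots> = Comp M (Comp M aY (lY \<nu>)) (ncomp t (Dom C \<nu>))" using aY'[OF \<nu>] by simp
    also have "\<dots> = Comp M (Comp M aY u) (lX \<nu>)"
      using comp_assoc[OF M lX[OF \<nu>] u(1) aY] u(2)[OF \<nu>]
        comp_assoc[OF M nattrans_Hom[OF t latching_Dom_Ob[OF C \<nu>]] lY[OF \<nu>] aY] by simp
    finally show "Comp M (Comp M (ncomp t \<alpha>) aX) (lX \<nu>) = Comp M (Comp M aY u) (lX \<nu>)" .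
  qed
  moreover have "Cod M aX = fob (nsrc t) \<alpha>" "Cod M u = LY" using aX u(1) by (auto simp: Hom_def)
  ultimately obtain g where "g \<in> Hom M (Cod M i) (fob (ntgt t) \<alpha>)" "Comp M g i = ncomp t \<alpha>" "Comp M g j = aY"
    using po ta aY unfolding is_pushout_def by metis
  with LX LY u po have "is_relative_latching_map C M t \<alpha> g"
    unfolding is_relative_latching_map_def by blast
  then show ?thesis by blast
qed

text \<open>The lifting problems of the relative latching map of \<open>t : X \<rightarrow> Y\<close> at \<open>\<alpha>\<close> against \<open>p\<close>, spelled out
  without the latching objects and the pushout: a map out of the pushout is a map \<open>f\<close> on \<open>X\<^sub>\<alpha>\<close> together
  with a cocone \<open>k\<close> on the latching diagram of \<open>Y\<close> that agrees with it.\<close>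

definition latching_problems_solvable ::
  "('o, 'a, 'y) reedy_scheme \<Rightarrow> ('p, 'b, 'z) category_scheme \<Rightarrow> ('o, 'a, 'p, 'b) nattrans \<Rightarrow> 'o \<Rightarrow> 'b \<Rightarrow> bool" where
  "latching_problems_solvable C M t \<alpha> p \<longleftrightarrow>
     (\<forall>f k s. is_cocone (latching_category C \<alpha>) M (latching_diagram C (ntgt t) \<alpha>) (Dom M p) k \<longrightarrow>
        f \<in> Hom M (fob (nsrc t) \<alpha>) (Dom M p) \<longrightarrow> s \<in> Hom M (fob (ntgt t) \<alpha>) (Cod M p) \<longrightarrow>
        (\<forall>\<nu>\<in>Ob (latching_category C \<alpha>). Comp M (k \<nu>) (ncomp t (Dom C \<nu>)) = Comp M f (far (nsrc t) \<nu>)) \<longrightarrow>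
        (\<forall>\<nu>\<in>Ob (latching_category C \<alpha>). Comp M p (k \<nu>) = Comp M s (far (ntgt t) \<nu>)) \<longrightarrow>
        Comp M p f = Comp M s (ncomp t \<alpha>) \<longrightarrow>
        (\<exists>h\<in>Hom M (fob (ntgt t) \<alpha>) (Dom M p). Comp M h (ncomp t \<alpha>) = f \<and>
           (\<forall>\<nu>\<in>Ob (latching_category C \<alpha>). Comp M h (far (ntgt t) \<nu>) = k \<nu>) \<and> Comp M p h = s))"

text \<open>In both directions the passage between the two kinds of data uses only the universal properties:
  uniqueness for the latching object of \<open>X\<close> shows that \<open>f\<close> and the map induced by \<open>k\<close> agree on it,
  uniqueness for that of \<open>Y\<close> and for the pushout shows that the two triangles commute.\<close>

lemma relative_latching_lifting_iff:
  assumes C: "reedy_category C" and M: "is_category M" and t: "is_nattrans C M t" and \<alpha>: "\<alpha> \<in> Ob C"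
    and p: "p \<in> Ar M" and g: "is_relative_latching_map C M t \<alpha> g"
  shows "has_lifting M g p \<longleftrightarrow> latching_problems_solvable C M t \<alpha> p"
proof -
  note X = nattrans_functors(1)[OF t] and Y = nattrans_functors(2)[OF t]
  let ?J = "latching_category C \<alpha>"
  note Lc = latching_is_category[OF C, of \<alpha>]
  obtain LX lX aX LY lY aY u i j where LX: "is_latching C M (nsrc t) \<alpha> LX lX aX"
    and LY: "is_latching C M (ntgt t) \<alpha> LY lY aY" and u: "u \<in> Hom M LX LY"
    and u': "\<And>\<nu>. \<nu> \<in> Ob ?J \<Longrightarrow> Comp M u (lX \<nu>) = Comp M (lY \<nu>) (ncomp t (Dom C \<nu>))"
    and po: "is_pushout M aX u i j" and g: "g \<in> Hom M (Cod M i) (fob (ntgt t) \<alpha>)"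
    and gi: "Comp M g i = ncomp t \<alpha>" and gj: "Comp M g j = aY"
    using g unfolding is_relative_latching_map_def by metis
  define P where "P = Cod M i"
  have cX: "is_colimit ?J M (latching_diagram C (nsrc t) \<alpha>) LX lX"
    and aX: "aX \<in> Hom M LX (fob (nsrc t) \<alpha>)"
    and aX': "\<And>\<nu>. \<nu> \<in> Ob ?J \<Longrightarrow> Comp M aX (lX \<nu>) = far (nsrc t) \<nu>"
    using LX by (auto simp: is_latching_def)
  have cY: "is_colimit ?J M (latching_diagram C (ntgt t) \<alpha>) LY lY"
    and aY: "aY \<in> Hom M LY (fob (ntgt t) \<alpha>)"
    and aY': "\<And>\<nu>. \<nu> \<in> Ob ?J \<Longrightarrow> Comp M aY (lY \<nu>) = far (ntgt t) \<nu>"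
    using LY by (auto simp: is_latching_def)
  have lX: "lX \<nu> \<in> Hom M (fob (nsrc t) (Dom C \<nu>)) LX" and lY: "lY \<nu> \<in> Hom M (fob (ntgt t) (Dom C \<nu>)) LY"
    if "\<nu> \<in> Ob ?J" for \<nu>
    using colimit_Hom[OF cX that] colimit_Hom[OF cY that] latching_diagram_fob[OF that] by metis+
  have i: "i \<in> Hom M (fob (nsrc t) \<alpha>) P" and j: "j \<in> Hom M LY P" and g: "g \<in> Hom M P (fob (ntgt t) \<alpha>)"
    and ij: "Comp M i aX = Comp M j u"
    and out: "\<And>d r s. r \<in> Hom M (fob (nsrc t) \<alpha>) d \<Longrightarrow> s \<in> Hom M LY d \<Longrightarrow> Comp M r aX = Comp M s u
         \<Longrightarrow> \<exists>!v. v \<in> Hom M P d \<and> Comp M v i = r \<and> Comp M v j = s"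
    using po g HomD[OF aX] HomD[OF u] by (auto simp: is_pushout_def P_def)
  have eqP: "v = w" if "v \<in> Hom M P d" "w \<in> Hom M P d" "Comp M v i = Comp M w i" "Comp M v j = Comp M w j" for v w d
  proof -
    have "Comp M (Comp M w i) aX = Comp M (Comp M w j) u"
      using comp_assoc[OF M aX i that(2)] comp_assoc[OF M u j that(2)] ij by simp
    from out[OF comp_in_Hom[OF M i that(2)] comp_in_Hom[OF M j that(2)] this] that show ?thesis by blast
  qed
  note eqX = colimit_map_eqI[OF Lc M latching_diagram_is_functor[OF C X] cX]
  note eqY = colimit_map_eqI[OF Lc M latching_diagram_is_functor[OF C Y] cY]
  have ta: "ncomp t \<alpha> \<in> Hom M (fob (nsrc t) \<alpha>) (fob (ntgt t) \<alpha>)" by (rule nattrans_Hom[OF t \<alpha>])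
  have t\<nu>: "ncomp t (Dom C \<nu>) \<in> Hom M (fob (nsrc t) (Dom C \<nu>)) (fob (ntgt t) (Dom C \<nu>))" if "\<nu> \<in> Ob ?J" for \<nu>
    by (rule nattrans_Hom[OF t latching_Dom_Ob[OF C that]])
  have p: "p \<in> Hom M (Dom M p) (Cod M p)" using p by (rule Ar_in_Hom)
  have gDC: "Dom M g = P" "Cod M g = fob (ntgt t) \<alpha>" using HomD[OF g] by auto
  show ?thesis
  proof
    assume lift: "has_lifting M g p"
    show "latching_problems_solvable C M t \<alpha> p"
      unfolding latching_problems_solvable_def
    proof (intro allI impI)
      fix f k s
      assume k: "is_cocone ?J M (latching_diagram C (ntgt t) \<alpha>) (Dom M p) k"
        and f: "f \<in> Hom M (fob (nsrc t) \<alpha>) (Dom M p)" and s: "s \<in> Hom M (fob (ntgt t) \<alpha>) (Cod M p)"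
        and kt: "\<forall>\<nu>\<in>Ob ?J. Comp M (k \<nu>) (ncomp t (Dom C \<nu>)) = Comp M f (far (nsrc t) \<nu>)"
        and pk: "\<forall>\<nu>\<in>Ob ?J. Comp M p (k \<nu>) = Comp M s (far (ntgt t) \<nu>)"
        and pf: "Comp M p f = Comp M s (ncomp t \<alpha>)"
      obtain v where v: "v \<in> Hom M LY (Dom M p)" and v': "\<And>\<nu>. \<nu> \<in> Ob ?J \<Longrightarrow> Comp M v (lY \<nu>) = k \<nu>"
        using colimit_induced[OF cY k] by metis
      have "Comp M f aX = Comp M v u"
      proof (rule eqX[OF comp_in_Hom[OF M aX f] comp_in_Hom[OF M u v]])
        fix \<nu> assume \<nu>: "\<nu> \<in> Ob ?J"
        show "Comp M (Comp M f aX) (lX \<nu>) = Comp M (Comp M v u) (lX \<nu>)"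
          using comp_assoc[OF M lX[OF \<nu>] aX f] aX'[OF \<nu>] kt[rule_format, OF \<nu>] comp_assoc[OF M lX[OF \<nu>] u v]
            comp_assoc[OF M t\<nu>[OF \<nu>] lY[OF \<nu>] v] u'[OF \<nu>] v'[OF \<nu>] by simp
      qed
      from out[OF f v this] obtain w where w: "w \<in> Hom M P (Dom M p)"
        and wi: "Comp M w i = f" and wj: "Comp M w j = v" by blast
      have psY: "Comp M p v = Comp M s aY"
      proof (rule eqY[OF comp_in_Hom[OF M v p] comp_in_Hom[OF M aY s]])
        fix \<nu> assume \<nu>: "\<nu> \<in> Ob ?J"
        show "Comp M (Comp M p v) (lY \<nu>) = Comp M (Comp M s aY) (lY \<nu>)"
          using comp_assoc[OF M lY[OF \<nu>] v p] comp_assoc[OF M lY[OF \<nu>] aY s] v'[OF \<nu>] aY'[OF \<nu>] pk \<nu> by simp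
      qed
      have "Comp M p w = Comp M s g"
        by (rule eqP[OF comp_in_Hom[OF M w p] comp_in_Hom[OF M g s]])
          (use comp_assoc[OF M i w p] comp_assoc[OF M i g s] comp_assoc[OF M j w p] comp_assoc[OF M j g s]
            wi wj gi gj pf psY in simp_all)
      with lift w s obtain h where h: "h \<in> Hom M (fob (ntgt t) \<alpha>) (Dom M p)"
        and hg: "Comp M h g = w" and ph: "Comp M p h = s"
        unfolding has_lifting_def gDC by blast
      have "Comp M h (far (ntgt t) \<nu>) = k \<nu>" if \<nu>: "\<nu> \<in> Ob ?J" for \<nu>
        using comp_assoc[OF M lY[OF \<nu>] aY h] comp_assoc[OF M j g h] aY'[OF \<nu>] gj hg wj v'[OF \<nu>] by simp
      moreover have "Comp M h (ncomp t \<alpha>) = f"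
        using comp_assoc[OF M i g h] gi hg wi by simp
      ultimately show "\<exists>h\<in>Hom M (fob (ntgt t) \<alpha>) (Dom M p). Comp M h (ncomp t \<alpha>) = f \<and>
           (\<forall>\<nu>\<in>Ob ?J. Comp M h (far (ntgt t) \<nu>) = k \<nu>) \<and> Comp M p h = s"
        using h ph by blast
    qed
  next
    assume solv: "latching_problems_solvable C M t \<alpha> p"
    show "has_lifting M g p"
      unfolding has_lifting_def gDC
    proof (intro ballI impI)
      fix r s assume r: "r \<in> Hom M P (Dom M p)" and s: "s \<in> Hom M (fob (ntgt t) \<alpha>) (Cod M p)"
        and prs: "Comp M p r = Comp M s g"
      define k where "k = (\<lambda>\<nu>. Comp M (Comp M r j) (lY \<nu>))"
      have rj: "Comp M r j \<in> Hom M LY (Dom M p)" and ri: "Comp M r i \<in> Hom M (fob (nsrc t) \<alpha>) (Dom M p)"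
        using comp_in_Hom[OF M j r] comp_in_Hom[OF M i r] .
      have k: "is_cocone ?J M (latching_diagram C (ntgt t) \<alpha>) (Dom M p) k"
        unfolding k_def using cY
        by (intro cocone_postcompose[OF Lc M latching_diagram_is_functor[OF C Y] _ rj]) (simp add: is_colimit_def)
      have "Comp M (k \<nu>) (ncomp t (Dom C \<nu>)) = Comp M (Comp M r i) (far (nsrc t) \<nu>)" if \<nu>: "\<nu> \<in> Ob ?J" for \<nu>
      proof -
        have "Comp M (Comp M r j) u = Comp M (Comp M r i) aX"
          using comp_assoc[OF M u j r] comp_assoc[OF M aX i r] ij by simp
        then show ?thesis
          using comp_assoc[OF M t\<nu>[OF \<nu>] lY[OF \<nu>] rj] comp_assoc[OF M lX[OF \<nu>] u rj] u'[OF \<nu>]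
            comp_assoc[OF M lX[OF \<nu>] aX ri] aX'[OF \<nu>] by (simp add: k_def)
      qed
      moreover have "Comp M p (k \<nu>) = Comp M s (far (ntgt t) \<nu>)" if \<nu>: "\<nu> \<in> Ob ?J" for \<nu>
      proof -
        have "Comp M p (k \<nu>) = Comp M (Comp M p (Comp M r j)) (lY \<nu>)"
          unfolding k_def using comp_assoc[OF M lY[OF \<nu>] rj p] by simp
        also have "Comp M p (Comp M r j) = Comp M s aY"
          using comp_assoc[OF M j r p] comp_assoc[OF M j g s] prs gj by simp
        finally show ?thesis
          using comp_assoc[OF M lY[OF \<nu>] aY s] aY'[OF \<nu>] by simp
      qed
      moreover have "Comp M p (Comp M r i) = Comp M s (ncomp t \<alpha>)"
        using comp_assoc[OF M i r p] comp_assoc[OF M i g s] prs gi by simp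
      ultimately obtain h where h: "h \<in> Hom M (fob (ntgt t) \<alpha>) (Dom M p)"
        and ht: "Comp M h (ncomp t \<alpha>) = Comp M r i" and hk: "\<forall>\<nu>\<in>Ob ?J. Comp M h (far (ntgt t) \<nu>) = k \<nu>"
        and ph: "Comp M p h = s"
        using solv k ri s unfolding latching_problems_solvable_def by blast
      have "Comp M h aY = Comp M r j"
        by (rule eqY[OF comp_in_Hom[OF M aY h] rj])
          (use hk comp_assoc[OF M lY aY h] aY' in \<open>simp add: k_def\<close>)
      then have "Comp M h g = r"
        using comp_assoc[OF M i g h] comp_assoc[OF M j g h] gi gj ht
        by (intro eqP[OF comp_in_Hom[OF M g h] r]) simp_all
      with h ph show "\<exists>h\<in>Hom M (fob (ntgt t) \<alpha>) (Dom M p). Comp M h g = r \<and> Comp M p h = s" by blast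
    qed
  qed
qed

lemma model_categoryD:
  assumes "model_category TYPE('s) M"
  shows "is_category M" "has_small_limits TYPE('s) M" "has_small_colimits TYPE('s) M"
    "cof M \<subseteq> Ar M" "fib M \<subseteq> Ar M"
    "f \<in> Ar M \<Longrightarrow> g \<in> Ar M \<Longrightarrow> is_retract M f g \<Longrightarrow> g \<in> cof M \<Longrightarrow> f \<in> cof M"
    "i \<in> cof M \<Longrightarrow> p \<in> fib M \<inter> weq M \<Longrightarrow> has_lifting M i p"
    "f \<in> Ar M \<Longrightarrow> \<exists>i\<in>cof M. \<exists>p\<in>fib M \<inter> weq M. Dom M p = Cod M i \<and> Comp M p i = f"
  using assms by (simp_all add: model_category_def)

text \<open>The retract argument: factor \<open>f = p i\<close> with a trivial fibration \<open>p\<close>; a lift in the square formed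
  by \<open>i\<close>, \<open>f\<close>, \<open>p\<close> and an identity exhibits \<open>f\<close> as a retract of \<open>i\<close>.\<close>

lemma cofibration_iff_lifting:
  assumes MM: "model_category TYPE('s) M" and f: "f \<in> Ar M"
  shows "f \<in> cof M \<longleftrightarrow> (\<forall>p\<in>fib M \<inter> weq M. has_lifting M f p)"
proof
  assume "f \<in> cof M"
  then show "\<forall>p\<in>fib M \<inter> weq M. has_lifting M f p"
    using model_categoryD(7)[OF MM] by blast
next
  assume lift: "\<forall>p\<in>fib M \<inter> weq M. has_lifting M f p"
  have M: "is_category M" and cofAr: "cof M \<subseteq> Ar M" and fibAr: "fib M \<subseteq> Ar M"
    by (fact model_categoryD[OF MM])+
  obtain i p where i: "i \<in> cof M" and p: "p \<in> fib M \<inter> weq M"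
    and pi: "Dom M p = Cod M i" "Comp M p i = f"
    using model_categoryD(8)[OF MM f] by blast
  have i': "i \<in> Hom M (Dom M f) (Dom M p)" and p': "p \<in> Hom M (Dom M p) (Cod M f)"
    and f': "f \<in> Hom M (Dom M f) (Cod M f)"
    using subsetD[OF cofAr i] subsetD[OF fibAr IntD1[OF p]] pi(1) Comp_simps[OF M, of i p, unfolded pi]
    by (simp_all add: Hom_def)
  have o: "Dom M f \<in> Ob M" "Cod M f \<in> Ob M" using Hom_Ob[OF M f'] by auto
  have "Cod M p = Cod M f" using HomD[OF p'] by simp
  moreover have "Comp M p i = Comp M (Idt M (Cod M f)) f" using pi comp_Idt_left[OF M f'] by simp
  ultimately obtain h where h: "h \<in> Hom M (Cod M f) (Dom M p)" "Comp M h f = i" "Comp M p h = Idt M (Cod M f)"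
    using lift p i' Idt_in_Hom[OF M o(2)] unfolding has_lifting_def by metis
  have D: "Dom M i = Dom M f" "Cod M i = Dom M p" using HomD[OF i'] by auto
  have "is_retract M f i"
    unfolding is_retract_def D
  proof (rule bexI[of _ "Idt M (Dom M f)"], rule bexI[of _ "Idt M (Dom M f)"], rule bexI[of _ h],
      rule bexI[of _ p], intro conjI)
    show "Comp M (Idt M (Dom M f)) (Idt M (Dom M f)) = Idt M (Dom M f)"
      by (rule comp_Idt_left[OF M Idt_in_Hom[OF M o(1)]])
    show "Comp M i (Idt M (Dom M f)) = Comp M h f" using comp_Idt_right[OF M i'] h(2) by simp
    show "Comp M f (Idt M (Dom M f)) = Comp M p i" using comp_Idt_right[OF M f'] pi(2) by simp
  qed (use Idt_in_Hom[OF M o(1)] h p' in simp_all)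
  with model_categoryD(6)[OF MM f] i cofAr show "f \<in> cof M" by blast
qed

lemma reedy_model_simps:
  "Ob (reedy_model C M) = {X. is_functor C M X}"
  "Ar (reedy_model C M) = {t. is_nattrans C M t}"
  "Dom (reedy_model C M) = nsrc" "Cod (reedy_model C M) = ntgt"
  "Idt (reedy_model C M) = Idt (functor_category C M)"
  "Comp (reedy_model C M) = Comp (functor_category C M)"
  "weq (reedy_model C M) = {t. is_nattrans C M t \<and> (\<forall>\<alpha>\<in>Ob C. ncomp t \<alpha> \<in> weq M)}"
  "cof (reedy_model C M) =
     {t. is_nattrans C M t \<and> (\<forall>\<alpha>\<in>Ob C. \<forall>g. is_relative_latching_map C M t \<alpha> g \<longrightarrow> g \<in> cof M)}"
  by (simp_all add: reedy_model_def Let_def)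

lemma relative_latching_map_Ar: "is_relative_latching_map C M t \<alpha> g \<Longrightarrow> g \<in> Ar M"
  unfolding is_relative_latching_map_def Hom_def by blast

text \<open>Membership in the class of Reedy cofibrations quantifies over all relative latching maps; since all of
  them have the same lifting problems and at least one exists, the condition does not depend on the choice
  of latching objects and pushouts.\<close>

proposition reedy_cofibration_iff:
  fixes C :: "('s::infinite, 's) reedy"
  assumes C: "reedy_category C" and MM: "model_category TYPE('s) M"
  shows "t \<in> cof (reedy_model C M) \<longleftrightarrow>
    is_nattrans C M t \<and> (\<forall>\<alpha>\<in>Ob C. \<forall>p\<in>fib M \<inter> weq M. latching_problems_solvable C M t \<alpha> p)"
proof -
  have M: "is_category M" "has_small_colimits TYPE('s) M" "fib M \<subseteq> Ar M"
    by (fact model_categoryD[OF MM])+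
  have "(\<forall>g. is_relative_latching_map C M t \<alpha> g \<longrightarrow> g \<in> cof M)
      \<longleftrightarrow> (\<forall>p\<in>fib M \<inter> weq M. latching_problems_solvable C M t \<alpha> p)"
    if t: "is_nattrans C M t" and \<alpha>: "\<alpha> \<in> Ob C" for \<alpha>
  proof -
    have "g \<in> cof M \<longleftrightarrow> (\<forall>p\<in>fib M \<inter> weq M. latching_problems_solvable C M t \<alpha> p)"
      if g: "is_relative_latching_map C M t \<alpha> g" for g
      using cofibration_iff_lifting[OF MM relative_latching_map_Ar[OF g]] M(3)
        relative_latching_lifting_iff[OF C M(1) t \<alpha> _ g] by blast
    then show ?thesis using relative_latching_map_exists[OF C M(1,2) t \<alpha>] by blast
  qed
  then show ?thesis by (auto simp: reedy_model_simps)
qed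

section \<open>Connectedness of nerves\<close>

definition zigzag :: "('o, 'a, 'z) category_scheme \<Rightarrow> ('o \<times> 'o) set" where
  "zigzag E = ({(Dom E f, Cod E f) | f. f \<in> Ar E} \<union> {(Dom E f, Cod E f) | f. f \<in> Ar E}\<inverse>)\<^sup>*"

lemma zigzag_invariant:
  assumes "(x, y) \<in> zigzag E" "\<And>f. f \<in> Ar E \<Longrightarrow> v (Dom E f) = v (Cod E f)"
  shows "v x = v y"
  using assms(1) unfolding zigzag_def
  by (induction rule: rtrancl_induct) (use assms(2) in auto)

lemma zigzag_trans: "(x, y) \<in> zigzag E \<Longrightarrow> (y, z) \<in> zigzag E \<Longrightarrow> (x, z) \<in> zigzag E"
  unfolding zigzag_def by (rule rtrancl_trans)

lemma zigzag_Ar: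
  assumes "f \<in> Ar E"
  shows "(Dom E f, Cod E f) \<in> zigzag E \<and> (Cod E f, Dom E f) \<in> zigzag E"
  using assms unfolding zigzag_def by (intro conjI r_into_rtrancl) auto

definition nerve_vertex :: "('o, 'a, 'z) category_scheme \<Rightarrow> 'o \<Rightarrow> (nat, nat \<times> nat, 'o, 'a) func" where
  "nerve_vertex E a = \<lparr>fob = (\<lambda>i\<in>{0}. a), far = (\<lambda>u\<in>{(0, 0)}. Idt E a)\<rparr>"

lemma nerve_vertex_inject: "nerve_vertex E a = nerve_vertex E b \<longleftrightarrow> a = b"
proof
  assume "nerve_vertex E a = nerve_vertex E b"
  then have "fob (nerve_vertex E a) 0 = fob (nerve_vertex E b) 0" by simp
  then show "a = b" by (simp add: nerve_vertex_def)
qed simp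

lemma nerve_vertices:
  assumes E: "is_category E"
  shows "simplices (nerve E) 0 = nerve_vertex E ` Ob E"
proof -
  have 0: "Ob (ordinal_category 0) = {0}" "Ar (ordinal_category 0) = {(0, 0)}"
    "Idt (ordinal_category 0) = (\<lambda>i. (i, i))" "Dom (ordinal_category 0) = fst" "Cod (ordinal_category 0) = snd"
    "Comp (ordinal_category 0) = (\<lambda>g f. (fst f, snd g))"
    by (auto simp: ordinal_category_def)
  have 1: "is_functor (ordinal_category 0) E (nerve_vertex E a)" if "a \<in> Ob E" for a
    using Idt_simps[OF E that] comp_Idt_left[OF E Idt_in_Hom[OF E that]] that
    by (auto simp: is_functor_def 0 nerve_vertex_def Hom_def)
  have "F \<in> nerve_vertex E ` Ob E" if F: "is_functor (ordinal_category 0) E F" for F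
  proof -
    have a: "fob F 0 \<in> Ob E" using F by (auto simp: is_functor_def 0)
    have "F = nerve_vertex E (fob F 0)"
    proof (rule functor_eqI[OF F 1[OF a]])
      fix f assume "f \<in> Ar (ordinal_category 0)"
      then show "far F f = far (nerve_vertex E (fob F 0)) f"
        using F by (simp add: is_functor_def 0 nerve_vertex_def)
    qed (simp add: 0 nerve_vertex_def)
    then show ?thesis using a by blast
  qed
  with 1 show ?thesis by (auto simp: nerve_def)
qed

lemma nerve_edges:
  assumes E: "is_category E"
  shows "sset_edges (nerve E) = {(nerve_vertex E (Dom E f), nerve_vertex E (Cod E f)) | f. f \<in> Ar E}"
proof -
  have 0: "Ob (ordinal_category 0) = {0}" "Ar (ordinal_category 0) = {(0, 0)}"
    by (auto simp: ordinal_category_def)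
  have 1: "Ob (ordinal_category (Suc 0)) = {0, Suc 0}"
    "Ar (ordinal_category (Suc 0)) = {(0, 0), (0, Suc 0), (Suc 0, Suc 0)}"
    "Idt (ordinal_category (Suc 0)) = (\<lambda>i. (i, i))"
    "Dom (ordinal_category (Suc 0)) = fst" "Cod (ordinal_category (Suc 0)) = snd"
    "Comp (ordinal_category (Suc 0)) = (\<lambda>g f. (fst f, snd g))"
    by (auto simp: ordinal_category_def)
  have face: "act (nerve E) 0 1 (\<lambda>_. i) e = nerve_vertex E (fob e i)"
    if e: "is_functor (ordinal_category 1) E e" and i: "i = 0 \<or> i = 1" for e i
  proof -
    have "i \<in> Ob (ordinal_category 1)" using i by (auto simp: 1)
    from functor_Idt[OF e this] show ?thesis
      by (auto simp: nerve_def func_comp_def nerve_vertex_def 0 1 intro!: restrict_ext)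
  qed
  show ?thesis
  proof (intro equalityI subsetI)
    fix z assume "z \<in> sset_edges (nerve E)"
    then obtain e where e: "is_functor (ordinal_category 1) E e"
      and z: "z = (act (nerve E) 0 1 (\<lambda>_. 0) e, act (nerve E) 0 1 (\<lambda>_. 1) e)"
      by (auto simp: sset_edges_def nerve_def)
    have "far e (0, 1) \<in> Hom E (fob e 0) (fob e 1)"
      using e by (simp add: is_functor_def 1)
    then have "far e (0, 1) \<in> Ar E" "fob e 0 = Dom E (far e (0, 1))" "fob e 1 = Cod E (far e (0, 1))"
      by (simp_all add: Hom_def)
    then show "z \<in> {(nerve_vertex E (Dom E f), nerve_vertex E (Cod E f)) | f. f \<in> Ar E}"
      unfolding z face[OF e disjI1[OF refl]] face[OF e disjI2[OF refl]] mem_Collect_eq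
      by (intro exI[of _ "far e (0, 1)"]) simp
  next
    fix z assume "z \<in> {(nerve_vertex E (Dom E f), nerve_vertex E (Cod E f)) | f. f \<in> Ar E}"
    then obtain f where f: "f \<in> Ar E" and z: "z = (nerve_vertex E (Dom E f), nerve_vertex E (Cod E f))"
      by blast
    define e where "e = \<lparr>fob = (\<lambda>i\<in>{0, 1::nat}. if i = 0 then Dom E f else Cod E f),
      far = (\<lambda>u\<in>{(0, 0), (0, 1), (1, 1::nat)}. if u = (0::nat, 1) then f
               else if u = (0, 0) then Idt E (Dom E f) else Idt E (Cod E f))\<rparr>"
    have o: "Dom E f \<in> Ob E" "Cod E f \<in> Ob E" using Dom_Cod_Ob[OF E f] by auto
    have e: "is_functor (ordinal_category 1) E e"
      using f o Idt_simps[OF E o(1)] Idt_simps[OF E o(2)] comp_Idt_left[OF E Idt_in_Hom[OF E o(1)]]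
        comp_Idt_left[OF E Idt_in_Hom[OF E o(2)]] comp_Idt_left[OF E Ar_in_Hom[OF f]]
        comp_Idt_right[OF E Ar_in_Hom[OF f]]
      by (auto simp: is_functor_def 1 e_def Hom_def)
    have "z = (act (nerve E) 0 1 (\<lambda>_. 0) e, act (nerve E) 0 1 (\<lambda>_. 1) e)"
      unfolding z using face[OF e, of 0] face[OF e, of 1] by (simp add: e_def)
    with e show "z \<in> sset_edges (nerve E)" by (auto simp: sset_edges_def nerve_def)
  qed
qed

text \<open>Vertices of the nerve are objects and edges are maps, so path components of the nerve are the classes
  of objects joined by zigzags.\<close>

lemma nerve_empty_or_connected_iff:
  assumes E: "is_category E"
  shows "sset_empty (nerve E) \<or> sset_connected (nerve E)
    \<longleftrightarrow> (\<forall>x\<in>Ob E. \<forall>y\<in>Ob E. (x, y) \<in> zigzag E)"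
proof -
  let ?S = "(sset_edges (nerve E) \<union> (sset_edges (nerve E))\<inverse>)\<^sup>*"
  have to: "(nerve_vertex E x, nerve_vertex E y) \<in> ?S" if "(x, y) \<in> zigzag E" for x y
    using that unfolding zigzag_def
  proof (induction rule: rtrancl_induct)
    case (step y z)
    have "(nerve_vertex E y, nerve_vertex E z) \<in> sset_edges (nerve E) \<union> (sset_edges (nerve E))\<inverse>"
      using step(2) unfolding nerve_edges[OF E] by blast
    with step(3) show ?case by (rule rtrancl_into_rtrancl)
  qed simp
  have from_step: "\<exists>y. z = nerve_vertex E y \<and> (x, y) \<in> zigzag E" if "(nerve_vertex E x, z) \<in> ?S" for x z
    using that
  proof (induction rule: rtrancl_induct)
    case base
    show ?case by (auto simp: zigzag_def)
  next
    case (step y z)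
    then obtain y' where y': "y = nerve_vertex E y'" "(x, y') \<in> zigzag E" by blast
    from step(2) obtain f where "f \<in> Ar E" and f:
      "y = nerve_vertex E (Dom E f) \<and> z = nerve_vertex E (Cod E f)
       \<or> z = nerve_vertex E (Dom E f) \<and> y = nerve_vertex E (Cod E f)"
      unfolding nerve_edges[OF E] by blast
    then obtain z' where "z = nerve_vertex E z'"
      "(y', z') \<in> {(Dom E f, Cod E f) | f. f \<in> Ar E} \<union> {(Dom E f, Cod E f) | f. f \<in> Ar E}\<inverse>"
      unfolding y'(1) nerve_vertex_inject by blast
    with y'(2) show ?case unfolding zigzag_def by (blast intro: rtrancl_into_rtrancl)
  qed
  have emp: "sset_empty (nerve E) \<longleftrightarrow> Ob E = {}"
  proof
    assume "sset_empty (nerve E)"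
    then show "Ob E = {}" using nerve_vertices[OF E] by (auto simp: sset_empty_def)
  next
    assume "Ob E = {}"
    then show "sset_empty (nerve E)"
      by (auto simp: sset_empty_def nerve_def is_functor_def ordinal_category_def)
  qed
  have iff: "(nerve_vertex E x, nerve_vertex E y) \<in> ?S \<longleftrightarrow> (x, y) \<in> zigzag E" for x y
    using to from_step[of x "nerve_vertex E y"] by (auto simp: nerve_vertex_inject)
  have "sset_connected (nerve E) \<longleftrightarrow> Ob E \<noteq> {} \<and> (\<forall>x\<in>Ob E. \<forall>y\<in>Ob E. (x, y) \<in> zigzag E)"
    unfolding sset_connected_def nerve_vertices[OF E]
    by (simp add: iff)
  with emp show ?thesis by blast
qed

section \<open>Direct factorizations\<close>

lemma reedy_functorD:
  assumes "reedy_functor C D G"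
  shows "is_functor C D G" "f \<in> direct C \<Longrightarrow> far G f \<in> direct D"
    "f \<in> inverse C \<Longrightarrow> far G f \<in> inverse D"
  using assms by (auto simp: reedy_functor_def)

lemma direct_factorizations_simps:
  "(\<nu>, \<mu>) \<in> Ob (direct_factorizations C D G \<alpha> \<sigma>) \<longleftrightarrow>
     \<nu> \<in> Ob (latching_category C \<alpha>) \<and> \<mu> \<in> direct D \<and> \<mu> \<in> Hom D (Dom D \<sigma>) (fob G (Dom C \<nu>)) \<and>
     Comp D (far G \<nu>) \<mu> = \<sigma>"
  "((\<nu>, \<mu>), \<tau>, (\<nu>', \<mu>')) \<in> Ar (direct_factorizations C D G \<alpha> \<sigma>) \<longleftrightarrow>
     (\<nu>, \<mu>) \<in> Ob (direct_factorizations C D G \<alpha> \<sigma>) \<and> (\<nu>', \<mu>') \<in> Ob (direct_factorizations C D G \<alpha> \<sigma>) \<and>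
     \<tau> \<in> direct C \<and> \<tau> \<in> Hom C (Dom C \<nu>) (Dom C \<nu>') \<and> Comp C \<nu>' \<tau> = \<nu> \<and> Comp D (far G \<tau>) \<mu> = \<mu>'"
  "Dom (direct_factorizations C D G \<alpha> \<sigma>) (x, \<tau>, x') = x"
  "Cod (direct_factorizations C D G \<alpha> \<sigma>) (x, \<tau>, x') = x'"
  "Idt (direct_factorizations C D G \<alpha> \<sigma>) (\<nu>, \<mu>) = ((\<nu>, \<mu>), Idt C (Dom C \<nu>), (\<nu>, \<mu>))"
  "Comp (direct_factorizations C D G \<alpha> \<sigma>) (y, \<tau>', z) (x, \<tau>, y') = (x, Comp C \<tau>' \<tau>, z)"
  by (auto simp: direct_factorizations_def Let_def latching_category_simps)

lemma direct_factorizations_is_category: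
  fixes C :: "('o, 'a, 'y) reedy_scheme" and D :: "('p, 'b, 'z) reedy_scheme"
  assumes C: "reedy_category C" and D: "reedy_category D" and G: "is_functor C D G"
  shows "is_category (direct_factorizations C D G \<alpha> \<sigma>)" (is "is_category ?E")
proof -
  note KC = reedy_is_category[OF C] and KD = reedy_is_category[OF D]
  have ArE: "\<exists>\<nu> \<mu> \<tau> \<nu>' \<mu>'. f = ((\<nu>, \<mu>), \<tau>, (\<nu>', \<mu>'))" for f :: "('a \<times> 'b) \<times> 'a \<times> ('a \<times> 'b)"
    by (metis surj_pair)
  have I: "Idt ?E x \<in> Hom ?E x x" if x: "x \<in> Ob ?E" for x
  proof -
    obtain \<nu> \<mu> where [simp]: "x = (\<nu>, \<mu>)" by (cases x)
    have \<nu>: "\<nu> \<in> Ob (latching_category C \<alpha>)" and \<mu>: "\<mu> \<in> Hom D (Dom D \<sigma>) (fob G (Dom C \<nu>))"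
      using x by (auto simp: direct_factorizations_simps)
    have o: "Dom C \<nu> \<in> Ob C" by (rule latching_Dom_Ob[OF C \<nu>])
    show ?thesis
      using x Idt_in_Hom[OF KC o] direct_Idt[OF C o] comp_Idt_right[OF KC latching_Hom[OF C \<nu>]]
        functor_Idt[OF G o] comp_Idt_left[OF KD \<mu>]
      by (simp add: Hom_def[of ?E] direct_factorizations_simps(2-5))
  qed
  have K: "Comp ?E g f \<in> Hom ?E (Dom ?E f) (Cod ?E g)"
    if fg: "f \<in> Ar ?E" "g \<in> Ar ?E" "Dom ?E g = Cod ?E f" for f g
  proof -
    obtain \<nu> \<mu> \<tau> \<nu>' \<mu>' \<tau>' \<nu>'' \<mu>'' where f: "f = ((\<nu>, \<mu>), \<tau>, (\<nu>', \<mu>'))" and g: "g = ((\<nu>', \<mu>'), \<tau>', (\<nu>'', \<mu>''))"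
      using fg(3) ArE[of f] ArE[of g] by (auto simp: direct_factorizations_simps)
    have \<tau>: "\<tau> \<in> direct C" "\<tau> \<in> Hom C (Dom C \<nu>) (Dom C \<nu>')" "Comp C \<nu>' \<tau> = \<nu>" "Comp D (far G \<tau>) \<mu> = \<mu>'"
      and \<tau>': "\<tau>' \<in> direct C" "\<tau>' \<in> Hom C (Dom C \<nu>') (Dom C \<nu>'')" "Comp C \<nu>'' \<tau>' = \<nu>'" "Comp D (far G \<tau>') \<mu>' = \<mu>''"
      and o: "(\<nu>, \<mu>) \<in> Ob ?E" "(\<nu>'', \<mu>'') \<in> Ob ?E"
      using fg(1,2) by (auto simp: f g direct_factorizations_simps(2))
    have \<nu>'': "\<nu>'' \<in> Ob (latching_category C \<alpha>)" and \<mu>: "\<mu> \<in> Hom D (Dom D \<sigma>) (fob G (Dom C \<nu>))"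
      using o by (auto simp: direct_factorizations_simps)
    have "Comp C \<tau>' \<tau> \<in> direct C"
      using direct_Comp[OF C \<tau>(1) \<tau>'(1)] \<tau>(2) \<tau>'(2) by (simp add: Hom_def)
    moreover have "Comp C \<nu>'' (Comp C \<tau>' \<tau>) = \<nu>"
      using comp_assoc[OF KC \<tau>(2) \<tau>'(2) latching_Hom[OF C \<nu>'']] \<tau>(3) \<tau>'(3) by simp
    moreover have "Comp D (far G (Comp C \<tau>' \<tau>)) \<mu> = \<mu>''"
      using functor_Comp[OF G \<tau>(2) \<tau>'(2)] \<tau>(4) \<tau>'(4)
        comp_assoc[OF KD \<mu> functor_Hom[OF G \<tau>(2)] functor_Hom[OF G \<tau>'(2)]] by simp
    ultimately show ?thesis
      using o comp_in_Hom[OF KC \<tau>(2) \<tau>'(2)] by (simp add: f g Hom_def[of ?E] direct_factorizations_simps(2-))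
  qed
  show ?thesis
    unfolding is_category_def
  proof (intro conjI ballI impI)
    fix f assume f: "f \<in> Ar ?E"
    obtain \<nu> \<mu> \<tau> \<nu>' \<mu>' where f': "f = ((\<nu>, \<mu>), \<tau>, (\<nu>', \<mu>'))" using ArE by blast
    have *: "\<tau> \<in> Hom C (Dom C \<nu>) (Dom C \<nu>')" using f by (simp add: f' direct_factorizations_simps(2))
    show "Dom ?E f \<in> Ob ?E" "Cod ?E f \<in> Ob ?E"
      "Comp ?E f (Idt ?E (Dom ?E f)) = f" "Comp ?E (Idt ?E (Cod ?E f)) f = f"
      using f comp_Idt_left[OF KC *] comp_Idt_right[OF KC *]
      by (simp_all add: f' direct_factorizations_simps(2-))
  next
    fix f g h assume fgh: "f \<in> Ar ?E" "g \<in> Ar ?E" "h \<in> Ar ?E" "Dom ?E g = Cod ?E f" "Dom ?E h = Cod ?E g"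
    obtain \<nu> \<mu> \<tau> \<nu>' \<mu>' where f: "f = ((\<nu>, \<mu>), \<tau>, (\<nu>', \<mu>'))" using ArE by blast
    obtain \<nu>2 \<mu>2 \<tau>2 \<nu>2' \<mu>2' where g: "g = ((\<nu>2, \<mu>2), \<tau>2, (\<nu>2', \<mu>2'))" using ArE by blast
    obtain \<nu>3 \<mu>3 \<tau>3 \<nu>3' \<mu>3' where h: "h = ((\<nu>3, \<mu>3), \<tau>3, (\<nu>3', \<mu>3'))" using ArE by blast
    have "\<tau> \<in> Hom C (Dom C \<nu>) (Dom C \<nu>2)" "\<tau>2 \<in> Hom C (Dom C \<nu>2) (Dom C \<nu>3)" "\<tau>3 \<in> Hom C (Dom C \<nu>3) (Dom C \<nu>3')"
      using fgh by (auto simp: f g h direct_factorizations_simps(2-4))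
    from comp_assoc[OF KC this] show "Comp ?E h (Comp ?E g f) = Comp ?E (Comp ?E h g) f"
      by (simp add: f g h direct_factorizations_simps(6))
  qed (use I K in blast)+
qed

lemma cofibering_iff_zigzag:
  assumes C: "reedy_category C" and D: "reedy_category D" and G: "is_functor C D G"
  shows "cofibering C D G \<longleftrightarrow>
    (\<forall>\<alpha>\<in>Ob C. \<forall>\<sigma>\<in>direct D. Cod D \<sigma> = fob G \<alpha> \<longrightarrow>
      (\<forall>x\<in>Ob (direct_factorizations C D G \<alpha> \<sigma>). \<forall>y\<in>Ob (direct_factorizations C D G \<alpha> \<sigma>).
         (x, y) \<in> zigzag (direct_factorizations C D G \<alpha> \<sigma>)))"
proof -
  have "(\<forall>\<beta>\<in>Ob D. \<forall>\<sigma>\<in>direct D. \<sigma> \<in> Hom D \<beta> \<gamma> \<longrightarrow> Q \<sigma>) \<longleftrightarrow> (\<forall>\<sigma>\<in>direct D. Cod D \<sigma> = \<gamma> \<longrightarrow> Q \<sigma>)" for Q \<gamma>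
    using direct_Ar[OF D] Dom_Cod_Ob[OF reedy_is_category[OF D]] by (auto simp: Hom_def)
  then show ?thesis
    unfolding cofibering_def nerve_empty_or_connected_iff[OF direct_factorizations_is_category[OF C D G]]
    by simp
qed

section \<open>Precomposition with a cofibering functor preserves Reedy cofibrations\<close>

lemma precomposition_far:
  "is_nattrans D M t \<Longrightarrow> far (precomposition C D M G) t =
     \<lparr>nsrc = func_comp C (nsrc t) G, ntgt = func_comp C (ntgt t) G, ncomp = (\<lambda>a\<in>Ob C. ncomp t (fob G a))\<rparr>"
  by (simp add: precomposition_def)

lemma precomposition_fob:
  "is_functor D M X \<Longrightarrow> fob (precomposition C D M G) X = func_comp C X G"
  by (simp add: precomposition_def)

lemma precomposition_nattrans:
  assumes C: "is_category C" and G: "is_functor C D G" and t: "is_nattrans D M t"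
  shows "is_nattrans C M (far (precomposition C D M G) t)"
  using functor_comp_functor[OF C G nattrans_functors(1)[OF t]]
    functor_comp_functor[OF C G nattrans_functors(2)[OF t]] Dom_Cod_Ob[OF C]
    nattrans_Hom[OF t functor_Ob[OF G]] nattrans_natural[OF t functor_Hom[OF G Ar_in_Hom]]
  by (simp add: is_nattrans_def precomposition_far[OF t])

lemma precomposition_is_functor:
  assumes C: "is_category C" and D: "is_category D" and M: "is_category M" and G: "is_functor C D G"
  shows "is_functor (functor_category D M) (functor_category C M) (precomposition C D M G)"
proof -
  let ?FC = "functor_category C M" and ?FD = "functor_category D M" and ?P = "precomposition C D M G"
  note FD = functor_category_is_category[OF D M]
  have 1: "is_functor C M (func_comp C X G)" if "is_functor D M X" for X
    by (rule functor_comp_functor[OF C G that])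
  have 2: "is_nattrans D M (Idt ?FD X)" if "is_functor D M X" for X
    using Idt_simps(1)[OF FD] that by simp
  have 3: "is_nattrans D M (Comp ?FD t s)"
    if "is_nattrans D M s" "is_nattrans D M t" "nsrc t = ntgt s" for s t
    using Comp_simps(1)[OF FD, of s t] that by simp
  show ?thesis
    unfolding is_functor_def
  proof (intro conjI ballI impI)
    show "fob ?P \<in> Ob ?FD \<rightarrow>\<^sub>E Ob ?FC"
      using 1 by (auto simp: precomposition_def)
    show "far ?P \<in> Ar ?FD \<rightarrow>\<^sub>E Ar ?FC"
    proof (rule PiE_I)
      fix t assume "t \<in> Ar ?FD"
      then show "far ?P t \<in> Ar ?FC"
        using precomposition_nattrans[OF C G] by simp
    qed (simp add: precomposition_def)
    fix t assume "t \<in> Ar ?FD"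
    then have t: "is_nattrans D M t" by simp
    show "far ?P t \<in> Hom ?FC
        (fob ?P (Dom ?FD t)) (fob ?P (Cod ?FD t))"
      using precomposition_nattrans[OF C G t] nattrans_functors[OF t]
      by (simp add: Hom_def precomposition_fob precomposition_far[OF t])
  next
    fix X assume "X \<in> Ob ?FD"
    then have X: "is_functor D M X" by simp
    show "far ?P (Idt ?FD X)
        = Idt ?FC (fob ?P X)"
      using precomposition_far[OF 2[OF X], of C G] precomposition_fob[OF X, of C G] functor_Ob[OF G]
      by (simp cong: restrict_cong)
  next
    fix s t assume "s \<in> Ar ?FD" "t \<in> Ar ?FD"
      "Dom ?FD t = Cod ?FD s"
    then have s: "is_nattrans D M s" and t: "is_nattrans D M t" and st: "nsrc t = ntgt s" by auto
    show "far ?P (Comp ?FD t s)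
        = Comp ?FC (far ?P t) (far ?P s)"
      using precomposition_far[OF 3[OF s t st], of C G] precomposition_far[OF s, of C G]
        precomposition_far[OF t, of C G] functor_Ob[OF G]
      by (simp cong: restrict_cong)
  qed
qed

text \<open>The extension over the direct maps into \<open>G \<alpha>\<close> by recursion on degree. The invariant \<open>good\<close> says that
  the map chosen at \<open>\<sigma>\<close> restricts to the given data on \<open>X\<close>, lies over the given map to \<open>B\<close>, is compatible
  with the values at all \<open>\<sigma> \<tau>\<close> of lower degree, and is the prescribed one for every factorization of
  \<open>\<sigma>\<close>. The factorizations of \<open>\<sigma>\<close> give factorizations of each \<open>\<sigma> \<tau>\<close>, so prescribed values fit those
  at lower degree.\<close>

proposition cofibering_preserves_cofibrations:
  fixes C D :: "('s::infinite, 's) reedy" and M :: "('o, 'a) model_structure"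
  assumes C: "reedy_category C" and D: "reedy_category D" and G: "reedy_functor C D G"
    and cofib: "cofibering C D G" and MM: "model_category TYPE('s) M"
    and t: "t \<in> cof (reedy_model D M)"
  shows "far (precomposition C D M G) t \<in> cof (reedy_model C M)"
proof -
  note KC = reedy_is_category[OF C] and KD = reedy_is_category[OF D] and M = model_categoryD(1)[OF MM]
  note G' = reedy_functorD[OF G]
  have nt: "is_nattrans D M t"
    and solvable: "\<And>\<beta> p. \<beta> \<in> Ob D \<Longrightarrow> p \<in> fib M \<inter> weq M \<Longrightarrow> latching_problems_solvable D M t \<beta> p"
    using t unfolding reedy_cofibration_iff[OF D MM] by blast+
  define X where "X = nsrc t"
  define Y where "Y = ntgt t"
  have X: "is_functor D M X" and Y: "is_functor D M Y"
    using nattrans_functors[OF nt] by (simp_all add: X_def Y_def)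
  have T: "ncomp t b \<in> Hom M (fob X b) (fob Y b)" if "b \<in> Ob D" for b
    using nattrans_Hom[OF nt that] by (simp add: X_def Y_def)
  have nat: "Comp M (ncomp t b) (far X f) = Comp M (far Y f) (ncomp t a)" if "f \<in> Hom D a b" for f a b
    using nattrans_natural[OF nt that] by (simp add: X_def Y_def)
  obtain deg :: "'s \<Rightarrow> nat"
    where deg: "\<And>f. f \<in> direct D \<Longrightarrow> f \<noteq> Idt D (Cod D f) \<Longrightarrow> deg (Dom D f) < deg (Cod D f)"
    using reedy_degree[OF D] by metis
  have "latching_problems_solvable C M (far (precomposition C D M G) t) \<alpha> p"
    if \<alpha>: "\<alpha> \<in> Ob C" and p: "p \<in> fib M \<inter> weq M" for \<alpha> p
    unfolding latching_problems_solvable_def precomposition_far[OF nt] X_def[symmetric] Y_def[symmetric]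
      nattrans.select_convs func_comp_simps(1)[OF \<alpha>] restrict_apply'[OF \<alpha>]
  proof (intro allI impI)
    define A where "A = Dom M p"
    define B where "B = Cod M p"
    let ?J = "latching_category C \<alpha>"
    let ?E = "direct_factorizations C D G \<alpha>"
    fix f k s
    assume k: "is_cocone ?J M (latching_diagram C (func_comp C Y G) \<alpha>) (Dom M p) k"
      and f: "f \<in> Hom M (fob X (fob G \<alpha>)) (Dom M p)" and s: "s \<in> Hom M (fob Y (fob G \<alpha>)) (Cod M p)"
      and kt: "\<forall>\<nu>\<in>Ob ?J. Comp M (k \<nu>) ((\<lambda>a\<in>Ob C. ncomp t (fob G a)) (Dom C \<nu>)) = Comp M f (far (func_comp C X G) \<nu>)"
      and pk: "\<forall>\<nu>\<in>Ob ?J. Comp M p (k \<nu>) = Comp M s (far (func_comp C Y G) \<nu>)"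
      and pf: "Comp M p f = Comp M s (ncomp t (fob G \<alpha>))"
    show "\<exists>h\<in>Hom M (fob Y (fob G \<alpha>)) (Dom M p). Comp M h (ncomp t (fob G \<alpha>)) = f \<and>
        (\<forall>\<nu>\<in>Ob ?J. Comp M h (far (func_comp C Y G) \<nu>) = k \<nu>) \<and> Comp M p h = s"
    proof -
      have k': "k \<nu> \<in> Hom M (fob Y (fob G (Dom C \<nu>))) A"
        "Comp M (k \<nu>) (ncomp t (fob G (Dom C \<nu>))) = Comp M f (far X (far G \<nu>))"
        "Comp M p (k \<nu>) = Comp M s (far Y (far G \<nu>))" if \<nu>: "\<nu> \<in> Ob ?J" for \<nu>
        using bspec[OF kt \<nu>] bspec[OF pk \<nu>] \<nu> latching_Dom_Ob[OF C \<nu>] HomD[OF latching_Hom[OF C \<nu>]]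
          latching_coconeD(1)[OF C k \<nu>]
        by (simp_all add: A_def)
      have k'': "Comp M (k \<nu>) (far Y (far G \<tau>)) = k (Comp C \<nu> \<tau>)"
        if "\<nu> \<in> Ob ?J" "\<tau> \<in> direct C" "Cod C \<tau> = Dom C \<nu>" for \<nu> \<tau>
        using latching_coconeD(2)[OF C k that]
          that(3) direct_Ar[OF C that(2)] by simp
      have f: "f \<in> Hom M (fob X (fob G \<alpha>)) A" and s: "s \<in> Hom M (fob Y (fob G \<alpha>)) B"
        and p': "p \<in> Hom M A B"
        using f s p model_categoryD(5)[OF MM] by (auto simp: A_def B_def Hom_def)
      have G\<nu>: "far G \<nu> \<in> Hom D (fob G (Dom C \<nu>)) (fob G \<alpha>)" if "\<nu> \<in> Ob ?J" for \<nu>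
        by (rule functor_Hom[OF G'(1) latching_Hom[OF C that]])
      have factD: "\<nu> \<in> Ob ?J" "\<mu> \<in> direct D" "\<mu> \<in> Hom D (Dom D \<sigma>) (fob G (Dom C \<nu>))"
        "Comp D (far G \<nu>) \<mu> = \<sigma>" if "(\<nu>, \<mu>) \<in> Ob (?E \<sigma>)" for \<nu> \<mu> \<sigma>
        using that by (auto simp: direct_factorizations_simps(1))
      \<comment> \<open>The composites \<open>k \<nu> \<circ> Y \<mu>\<close> agree along maps of factorizations, hence, by connectedness, for all
        factorizations of one \<open>\<sigma>\<close>.\<close>
      have indep: "Comp M (k \<nu>) (far Y \<mu>) = Comp M (k \<nu>') (far Y \<mu>')"
        if \<sigma>: "\<sigma> \<in> direct D" "Cod D \<sigma> = fob G \<alpha>"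
          and 1: "(\<nu>, \<mu>) \<in> Ob (?E \<sigma>)" and 2: "(\<nu>', \<mu>') \<in> Ob (?E \<sigma>)" for \<sigma> \<nu> \<mu> \<nu>' \<mu>'
      proof -
        define v where "v x = Comp M (k (fst x)) (far Y (snd x))" for x
        have "((\<nu>, \<mu>), (\<nu>', \<mu>')) \<in> zigzag (?E \<sigma>)"
          using cofib \<alpha> \<sigma> 1 2 unfolding cofibering_iff_zigzag[OF C D G'(1)] by blast
        then have "v (\<nu>, \<mu>) = v (\<nu>', \<mu>')"
        proof (rule zigzag_invariant)
          fix a assume "a \<in> Ar (?E \<sigma>)"
          moreover obtain \<nu> \<mu> \<tau> \<nu>' \<mu>' where a: "a = ((\<nu>, \<mu>), \<tau>, (\<nu>', \<mu>'))"
            by (metis surj_pair)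
          ultimately have o: "(\<nu>, \<mu>) \<in> Ob (?E \<sigma>)" "(\<nu>', \<mu>') \<in> Ob (?E \<sigma>)"
            and \<tau>: "\<tau> \<in> direct C" "\<tau> \<in> Hom C (Dom C \<nu>) (Dom C \<nu>')" "Comp C \<nu>' \<tau> = \<nu>" "Comp D (far G \<tau>) \<mu> = \<mu>'"
            by (auto simp: direct_factorizations_simps(2))
          note o1 = factD[OF o(1)] and o2 = factD[OF o(2)]
          have "Comp M (k \<nu>') (far Y \<mu>') = Comp M (k \<nu>') (Comp M (far Y (far G \<tau>)) (far Y \<mu>))"
            using functor_Comp[OF Y o1(3) functor_Hom[OF G'(1) \<tau>(2)]] \<tau>(4) by simp
          also have "\<dots> = Comp M (Comp M (k \<nu>') (far Y (far G \<tau>))) (far Y \<mu>)"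
            using comp_assoc[OF M functor_Hom[OF Y o1(3)] functor_Hom[OF Y functor_Hom[OF G'(1) \<tau>(2)]] k'(1)[OF o2(1)]]
            by simp
          also have "Comp M (k \<nu>') (far Y (far G \<tau>)) = k \<nu>"
            using k''[OF o2(1) \<tau>(1)] \<tau>(2,3) by (simp add: Hom_def)
          finally show "v (Dom (?E \<sigma>) a) = v (Cod (?E \<sigma>) a)"
            by (simp add: v_def a direct_factorizations_simps(3,4))
        qed
        then show ?thesis by (simp add: v_def)
      qed
      define good where "good h \<sigma> y \<longleftrightarrow>
          y \<in> Hom M (fob Y (Dom D \<sigma>)) A \<and>
          Comp M y (ncomp t (Dom D \<sigma>)) = Comp M f (far X \<sigma>) \<and>
          Comp M p y = Comp M s (far Y \<sigma>) \<and>
          (\<forall>\<tau>\<in>Ob (latching_category D (Dom D \<sigma>)). Comp M y (far Y \<tau>) = h (Comp D \<sigma> \<tau>)) \<and>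
          (\<forall>\<nu> \<mu>. (\<nu>, \<mu>) \<in> Ob (?E \<sigma>) \<longrightarrow> y = Comp M (k \<nu>) (far Y \<mu>))" for h \<sigma> y
      have lower: "Comp D \<sigma> \<tau> \<in> direct D" "Cod D (Comp D \<sigma> \<tau>) = Cod D \<sigma>" "Dom D (Comp D \<sigma> \<tau>) = Dom D \<tau>"
        "deg (Dom D \<tau>) < deg (Dom D \<sigma>)" "\<tau> \<in> Hom D (Dom D \<tau>) (Dom D \<sigma>)"
        if "\<sigma> \<in> direct D" "\<tau> \<in> Ob (latching_category D (Dom D \<sigma>))" for \<sigma> \<tau>
        using direct_Comp[OF D latching_ObD(1)[OF that(2)] that(1)]
          Comp_simps[OF KD direct_Ar[OF D latching_ObD(1)[OF that(2)]] direct_Ar[OF D that(1)]]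
          latching_ObD[OF that(2)] deg[of \<tau>] latching_Hom[OF D that(2)] by simp_all
      have "\<exists>h. \<forall>\<sigma>. \<sigma> \<in> direct D \<and> Cod D \<sigma> = fob G \<alpha> \<longrightarrow> good h \<sigma> (h \<sigma>)"
      proof (rule dependent_wf_choice[of "measure (\<lambda>\<sigma>. deg (Dom D \<sigma>))"])
        fix h h' :: "'s \<Rightarrow> 'a" and \<sigma> y
        assume "\<And>\<sigma>'. (\<sigma>', \<sigma>) \<in> measure (\<lambda>\<sigma>. deg (Dom D \<sigma>)) \<Longrightarrow> h \<sigma>' = h' \<sigma>'"
        then show "(\<sigma> \<in> direct D \<and> Cod D \<sigma> = fob G \<alpha> \<longrightarrow> good h \<sigma> y)
            = (\<sigma> \<in> direct D \<and> Cod D \<sigma> = fob G \<alpha> \<longrightarrow> good h' \<sigma> y)"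
          using lower by (auto simp: good_def)
      next
        fix \<sigma> and h :: "'s \<Rightarrow> 'a"
        assume IH: "\<And>\<sigma>'. (\<sigma>', \<sigma>) \<in> measure (\<lambda>\<sigma>. deg (Dom D \<sigma>)) \<Longrightarrow>
          \<sigma>' \<in> direct D \<and> Cod D \<sigma>' = fob G \<alpha> \<longrightarrow> good h \<sigma>' (h \<sigma>')"
        show "\<exists>y. \<sigma> \<in> direct D \<and> Cod D \<sigma> = fob G \<alpha> \<longrightarrow> good h \<sigma> y"
        proof (cases "\<sigma> \<in> direct D \<and> Cod D \<sigma> = fob G \<alpha>")
          case True
          then have \<sigma>: "\<sigma> \<in> direct D" "Cod D \<sigma> = fob G \<alpha>" "\<sigma> \<in> Hom D (Dom D \<sigma>) (fob G \<alpha>)"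
            using direct_Hom[OF D, of \<sigma>] by simp_all
          have \<beta>: "Dom D \<sigma> \<in> Ob D" using Hom_Ob[OF KD \<sigma>(3)] by simp
          have low: "good h (Comp D \<sigma> \<tau>) (h (Comp D \<sigma> \<tau>))" if "\<tau> \<in> Ob (latching_category D (Dom D \<sigma>))" for \<tau>
            using IH[of "Comp D \<sigma> \<tau>"] lower[OF \<sigma>(1) that] \<sigma>(2) by simp
          show ?thesis
          proof (cases "Ob (?E \<sigma>) = {}")
            case False
            then obtain \<nu> \<mu> where o: "(\<nu>, \<mu>) \<in> Ob (?E \<sigma>)" by (metis all_not_in_conv surj_pair)
            note o' = factD[OF o]
            have Y\<mu>: "far Y \<mu> \<in> Hom M (fob Y (Dom D \<sigma>)) (fob Y (fob G (Dom C \<nu>)))"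
              and X\<mu>: "far X \<mu> \<in> Hom M (fob X (Dom D \<sigma>)) (fob X (fob G (Dom C \<nu>)))"
              by (rule functor_Hom[OF _ o'(3)], fact)+
            note YG = functor_Hom[OF Y G\<nu>[OF o'(1)]] and XG = functor_Hom[OF X G\<nu>[OF o'(1)]]
            have T\<nu>: "ncomp t (fob G (Dom C \<nu>)) \<in> Hom M (fob X (fob G (Dom C \<nu>))) (fob Y (fob G (Dom C \<nu>)))"
              by (rule T[OF functor_Ob[OF G'(1) latching_Dom_Ob[OF C o'(1)]]])
            have "good h \<sigma> (Comp M (k \<nu>) (far Y \<mu>))"
              unfolding good_def
            proof (intro conjI ballI allI impI)
              show "Comp M (k \<nu>) (far Y \<mu>) \<in> Hom M (fob Y (Dom D \<sigma>)) A"
                by (rule comp_in_Hom[OF M Y\<mu> k'(1)[OF o'(1)]])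
              show "Comp M (Comp M (k \<nu>) (far Y \<mu>)) (ncomp t (Dom D \<sigma>)) = Comp M f (far X \<sigma>)"
                using comp_assoc[OF M T[OF \<beta>] Y\<mu> k'(1)[OF o'(1)]] nat[OF o'(3)]
                  comp_assoc[OF M X\<mu> T\<nu> k'(1)[OF o'(1)]] k'(2)[OF o'(1)]
                  comp_assoc[OF M X\<mu> XG f] functor_Comp[OF X o'(3) G\<nu>[OF o'(1)]] o'(4) by simp
              show "Comp M p (Comp M (k \<nu>) (far Y \<mu>)) = Comp M s (far Y \<sigma>)"
                using comp_assoc[OF M Y\<mu> k'(1)[OF o'(1)] p'] k'(3)[OF o'(1)]
                  comp_assoc[OF M Y\<mu> YG s] functor_Comp[OF Y o'(3) G\<nu>[OF o'(1)]] o'(4) by simp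
            next
              fix \<tau> assume \<tau>: "\<tau> \<in> Ob (latching_category D (Dom D \<sigma>))"
              note \<tau>' = lower(5)[OF \<sigma>(1) \<tau>]
              have "Comp D \<mu> \<tau> \<in> direct D"
                using direct_Comp[OF D latching_ObD(1)[OF \<tau>] o'(2)] HomD[OF \<tau>'] HomD[OF o'(3)] by simp
              moreover have "Comp D (far G \<nu>) (Comp D \<mu> \<tau>) = Comp D \<sigma> \<tau>"
                using comp_assoc[OF KD \<tau>' o'(3) G\<nu>[OF o'(1)]] o'(4) by simp
              ultimately have "(\<nu>, Comp D \<mu> \<tau>) \<in> Ob (?E (Comp D \<sigma> \<tau>))"
                using comp_in_Hom[OF KD \<tau>' o'(3)] o'(1) lower(3)[OF \<sigma>(1) \<tau>]
                by (simp add: direct_factorizations_simps(1))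
              then have "h (Comp D \<sigma> \<tau>) = Comp M (k \<nu>) (far Y (Comp D \<mu> \<tau>))"
                using low[OF \<tau>] unfolding good_def by blast
              then show "Comp M (Comp M (k \<nu>) (far Y \<mu>)) (far Y \<tau>) = h (Comp D \<sigma> \<tau>)"
                using functor_Comp[OF Y \<tau>' o'(3)] comp_assoc[OF M functor_Hom[OF Y \<tau>'] Y\<mu> k'(1)[OF o'(1)]] by simp
            qed (rule indep[OF \<sigma>(1,2) o])
            then show ?thesis by blast
          next
            case empty: True
            \<comment> \<open>No factorization prescribes the value at \<open>\<sigma>\<close>: it is found by solving a latching problem of \<open>t\<close>.\<close>
            have X\<sigma>: "far X \<sigma> \<in> Hom M (fob X (Dom D \<sigma>)) (fob X (fob G \<alpha>))"
              and Y\<sigma>: "far Y \<sigma> \<in> Hom M (fob Y (Dom D \<sigma>)) (fob Y (fob G \<alpha>))"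
              by (rule functor_Hom[OF _ \<sigma>(3)], fact)+
            have l1: "h (Comp D \<sigma> \<tau>) \<in> Hom M (fob Y (Dom D \<tau>)) A"
              "Comp M (h (Comp D \<sigma> \<tau>)) (ncomp t (Dom D \<tau>)) = Comp M f (far X (Comp D \<sigma> \<tau>))"
              "Comp M p (h (Comp D \<sigma> \<tau>)) = Comp M s (far Y (Comp D \<sigma> \<tau>))"
              if "\<tau> \<in> Ob (latching_category D (Dom D \<sigma>))" for \<tau>
              using low[OF that] lower(3)[OF \<sigma>(1) that] by (simp_all add: good_def)
            have "is_cocone (latching_category D (Dom D \<sigma>)) M (latching_diagram D Y (Dom D \<sigma>)) A
                    (\<lambda>\<tau>. h (Comp D \<sigma> \<tau>))"
              unfolding latching_cocone_iff[OF D]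
            proof (intro conjI ballI impI)
              show "A \<in> Ob M" using Hom_Ob[OF M f] by simp
            next
              fix \<tau> \<rho> assume \<tau>: "\<tau> \<in> Ob (latching_category D (Dom D \<sigma>))"
                and \<rho>: "\<rho> \<in> direct D" "Cod D \<rho> = Dom D \<tau>"
              note \<tau>' = lower(5)[OF \<sigma>(1) \<tau>]
              have \<rho>': "\<rho> \<in> Hom D (Dom D \<rho>) (Dom D \<tau>)" using direct_Hom[OF D \<rho>(1)] \<rho>(2) by simp
              show "Comp M (h (Comp D \<sigma> \<tau>)) (far Y \<rho>) = h (Comp D \<sigma> (Comp D \<tau> \<rho>))"
              proof (cases "\<rho> = Idt D (Dom D \<tau>)")
                case True
                then show ?thesis
                  using comp_Idt_right[OF KD \<tau>'] functor_Idt[OF Y] Hom_Ob[OF KD \<tau>'] comp_Idt_right[OF M l1(1)[OF \<tau>]]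
                  by simp
              next
                case False
                then have "\<rho> \<in> Ob (latching_category D (Dom D (Comp D \<sigma> \<tau>)))"
                  using \<rho> lower(3)[OF \<sigma>(1) \<tau>] by (simp add: latching_category_simps)
                then have "Comp M (h (Comp D \<sigma> \<tau>)) (far Y \<rho>) = h (Comp D (Comp D \<sigma> \<tau>) \<rho>)"
                  using low[OF \<tau>] unfolding good_def by blast
                then show ?thesis using comp_assoc[OF KD \<rho>' \<tau>' \<sigma>(3)] by simp
              qed
            qed (rule l1)
            moreover have "\<forall>\<tau>\<in>Ob (latching_category D (Dom D \<sigma>)).
                Comp M (h (Comp D \<sigma> \<tau>)) (ncomp t (Dom D \<tau>)) = Comp M (Comp M f (far X \<sigma>)) (far X \<tau>)"
              using l1(2) functor_Comp[OF X lower(5)[OF \<sigma>(1)] \<sigma>(3)]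
                comp_assoc[OF M functor_Hom[OF X lower(5)[OF \<sigma>(1)]] X\<sigma> f] by simp
            moreover have "\<forall>\<tau>\<in>Ob (latching_category D (Dom D \<sigma>)).
                Comp M p (h (Comp D \<sigma> \<tau>)) = Comp M (Comp M s (far Y \<sigma>)) (far Y \<tau>)"
              using l1(3) functor_Comp[OF Y lower(5)[OF \<sigma>(1)] \<sigma>(3)]
                comp_assoc[OF M functor_Hom[OF Y lower(5)[OF \<sigma>(1)]] Y\<sigma> s] by simp
            moreover have "Comp M p (Comp M f (far X \<sigma>)) = Comp M (Comp M s (far Y \<sigma>)) (ncomp t (Dom D \<sigma>))"
            proof -
              have "Comp M p (Comp M f (far X \<sigma>)) = Comp M (Comp M s (ncomp t (fob G \<alpha>))) (far X \<sigma>)"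
                using comp_assoc[OF M X\<sigma> f p'] pf by simp
              also have "\<dots> = Comp M s (Comp M (far Y \<sigma>) (ncomp t (Dom D \<sigma>)))"
                using comp_assoc[OF M X\<sigma> T[OF functor_Ob[OF G'(1) \<alpha>]] s] nat[OF \<sigma>(3)] by simp
              finally show ?thesis using comp_assoc[OF M T[OF \<beta>] Y\<sigma> s] by simp
            qed
            ultimately obtain y where "y \<in> Hom M (fob Y (Dom D \<sigma>)) A"
              "Comp M y (ncomp t (Dom D \<sigma>)) = Comp M f (far X \<sigma>)"
              "\<forall>\<tau>\<in>Ob (latching_category D (Dom D \<sigma>)). Comp M y (far Y \<tau>) = h (Comp D \<sigma> \<tau>)"
              "Comp M p y = Comp M s (far Y \<sigma>)"
              using solvable[OF \<beta> p, unfolded latching_problems_solvable_def, folded X_def Y_def A_def B_def]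
                comp_in_Hom[OF M X\<sigma> f] comp_in_Hom[OF M Y\<sigma> s] by blast
            then have "good h \<sigma> y" using empty by (simp add: good_def)
            then show ?thesis by blast
          qed
        qed blast
      qed simp
      then obtain h where h: "\<And>\<sigma>. \<sigma> \<in> direct D \<Longrightarrow> Cod D \<sigma> = fob G \<alpha> \<Longrightarrow> good h \<sigma> (h \<sigma>)"
        by blast
      \<comment> \<open>The map \<open>G \<nu>\<close> may be an identity although \<open>\<nu>\<close> is not; then the identity itself is factored by
        \<open>\<nu>\<close> and its value is prescribed.\<close>
      let ?e = "Idt D (fob G \<alpha>)"
      note G\<alpha> = functor_Ob[OF G'(1) \<alpha>]
      note e = Idt_simps[OF KD G\<alpha>]
      have ge: "good h ?e (h ?e)" by (rule h[OF direct_Idt[OF D G\<alpha>] e(3)])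
      have he: "h ?e \<in> Hom M (fob Y (fob G \<alpha>)) A" using ge by (simp add: good_def e)
      have "Comp M (h ?e) (far Y (far G \<nu>)) = k \<nu>" if \<nu>: "\<nu> \<in> Ob ?J" for \<nu>
      proof -
        have d: "far G \<nu> \<in> direct D" by (rule G'(2)[OF latching_ObD(1)[OF \<nu>]])
        have o: "fob G (Dom C \<nu>) \<in> Ob D" by (rule functor_Ob[OF G'(1) latching_Dom_Ob[OF C \<nu>]])
        have "(\<nu>, Idt D (fob G (Dom C \<nu>))) \<in> Ob (?E (far G \<nu>))"
          using \<nu> direct_Idt[OF D o] Idt_in_Hom[OF KD o] comp_Idt_right[OF KD G\<nu>[OF \<nu>]] HomD[OF G\<nu>[OF \<nu>]]
          by (simp add: direct_factorizations_simps(1))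
        moreover have "good h (far G \<nu>) (h (far G \<nu>))" using h[OF d] HomD[OF G\<nu>[OF \<nu>]] by simp
        ultimately have hG: "h (far G \<nu>) = k \<nu>"
          using functor_Idt[OF Y o] comp_Idt_right[OF M k'(1)[OF \<nu>]] by (simp add: good_def)
        show ?thesis
        proof (cases "far G \<nu> = ?e")
          case True
          then show ?thesis using hG functor_Idt[OF Y G\<alpha>] comp_Idt_right[OF M he] by simp
        next
          case False
          then have "far G \<nu> \<in> Ob (latching_category D (Dom D ?e))"
            using d HomD[OF G\<nu>[OF \<nu>]] by (simp add: latching_category_simps e)
          then have "Comp M (h ?e) (far Y (far G \<nu>)) = h (Comp D ?e (far G \<nu>))"
            using ge unfolding good_def by blast
          then show ?thesis using hG comp_Idt_left[OF KD G\<nu>[OF \<nu>]] by simp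
        qed
      qed
      moreover have "Comp M (h ?e) (ncomp t (fob G \<alpha>)) = f" "Comp M p (h ?e) = s"
        using ge comp_Idt_right[OF M f] comp_Idt_right[OF M s] functor_Idt[OF X G\<alpha>] functor_Idt[OF Y G\<alpha>]
        by (simp_all add: good_def e)
      ultimately show ?thesis
        using he HomD[OF latching_Hom[OF C]] by (auto simp: A_def)
    qed
  qed
  then show ?thesis
    unfolding reedy_cofibration_iff[OF C MM] using precomposition_nattrans[OF KC G'(1) nt] by blast
qed

section \<open>Right Kan extension as a right adjoint of precomposition\<close>

text \<open>The action of the right adjoint on maps, its functoriality and the naturality of the bijection on
  hom-sets all follow from uniqueness of factorization through the universal arrows \<open>e\<^sub>b : F (r b) \<rightarrow> b\<close>.\<close>

lemma universal_arrows_give_adjunction: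
  assumes A: "is_category A" and B: "is_category B" and F: "is_functor A B F"
    and universal: "\<And>b. b \<in> Ob B \<Longrightarrow> \<exists>r e. r \<in> Ob A \<and> e \<in> Hom B (fob F r) b \<and>
      (\<forall>a\<in>Ob A. \<forall>h\<in>Hom B (fob F a) b. \<exists>!k. k \<in> Hom A a r \<and> Comp B e (far F k) = h)"
  shows "\<exists>R. is_adjunction A B F R"
proof -
  obtain r e where r: "\<And>b. b \<in> Ob B \<Longrightarrow> r b \<in> Ob A" and e: "\<And>b. b \<in> Ob B \<Longrightarrow> e b \<in> Hom B (fob F (r b)) b"
    and u: "\<And>a b h. b \<in> Ob B \<Longrightarrow> a \<in> Ob A \<Longrightarrow> h \<in> Hom B (fob F a) b \<Longrightarrow>
       \<exists>!k. k \<in> Hom A a (r b) \<and> Comp B (e b) (far F k) = h"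
    using universal by metis
  define \<Phi> where "\<Phi> a b h = (THE k. k \<in> Hom A a (r b) \<and> Comp B (e b) (far F k) = h)" for a b h
  have \<Phi>: "\<Phi> a b h \<in> Hom A a (r b)" "Comp B (e b) (far F (\<Phi> a b h)) = h"
    if "b \<in> Ob B" "a \<in> Ob A" "h \<in> Hom B (fob F a) b" for a b h
    using theI'[OF u[OF that]] by (simp_all add: \<Phi>_def)
  have eF: "Comp B (e b) (far F k) \<in> Hom B (fob F a) b" if "b \<in> Ob B" "k \<in> Hom A a (r b)" for a b k
    using comp_in_Hom[OF B functor_Hom[OF F that(2)] e[OF that(1)]] .
  have uniq: "k = k'" if "b \<in> Ob B" "k \<in> Hom A a (r b)" "k' \<in> Hom A a (r b)"
    "Comp B (e b) (far F k) = Comp B (e b) (far F k')" for a b k k'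
    using u[OF that(1) _ eF[OF that(1,3)]] Hom_Ob[OF A that(2)] that by blast
  define \<rho> where "\<rho> g = \<Phi> (r (Dom B g)) (Cod B g) (Comp B g (e (Dom B g)))" for g
  have \<rho>: "\<rho> g \<in> Hom A (r b) (r c)" "Comp B (e c) (far F (\<rho> g)) = Comp B g (e b)" if "g \<in> Hom B b c" for g b c
    using \<Phi>[of c "r b" "Comp B g (e b)"] Hom_Ob[OF B that] r comp_in_Hom[OF B e that] HomD[OF that]
    by (simp_all add: \<rho>_def)
  define R where "R = \<lparr>fob = restrict r (Ob B), far = restrict \<rho> (Ar B)\<rparr>"
  have R: "is_functor B A R"
    unfolding is_functor_def
  proof (intro conjI ballI impI)
    fix f assume f: "f \<in> Ar B"
    show "far R f \<in> Hom A (fob R (Dom B f)) (fob R (Cod B f))"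
      using \<rho>(1)[OF Ar_in_Hom[OF f]] f Dom_Cod_Ob[OF B f] by (simp add: R_def)
  next
    fix b assume b: "b \<in> Ob B"
    have "\<rho> (Idt B b) = Idt A (r b)"
      using \<rho>[OF Idt_in_Hom[OF B b]] Idt_in_Hom[OF A r[OF b]] functor_Idt[OF F r[OF b]]
        comp_Idt_right[OF B e[OF b]] comp_Idt_left[OF B e[OF b]]
      by (intro uniq[OF b]) simp_all
    then show "far R (Idt B b) = Idt A (fob R b)" using b Idt_simps(1)[OF B b] by (simp add: R_def)
  next
    fix f g assume fg: "f \<in> Ar B" "g \<in> Ar B" "Dom B g = Cod B f"
    define a b c where "a = Dom B f" and "b = Cod B f" and "c = Cod B g"
    have f: "f \<in> Hom B a b" and g: "g \<in> Hom B b c" using fg by (auto simp: Hom_def a_def b_def c_def)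
    have c: "c \<in> Ob B" and ao: "a \<in> Ob B" and bo: "b \<in> Ob B" using Hom_Ob[OF B f] Hom_Ob[OF B g] by auto
    note gf = comp_in_Hom[OF B f g]
    have "Comp B (e c) (far F (Comp A (\<rho> g) (\<rho> f))) = Comp B (Comp B (e c) (far F (\<rho> g))) (far F (\<rho> f))"
      using functor_Comp[OF F \<rho>(1)[OF f] \<rho>(1)[OF g]]
        comp_assoc[OF B functor_Hom[OF F \<rho>(1)[OF f]] functor_Hom[OF F \<rho>(1)[OF g]] e[OF c]] by simp
    also have "\<dots> = Comp B g (Comp B f (e a))"
      using \<rho>(2)[OF g] \<rho>(2)[OF f] comp_assoc[OF B functor_Hom[OF F \<rho>(1)[OF f]] e[OF bo] g] by simp
    also have "\<dots> = Comp B (e c) (far F (\<rho> (Comp B g f)))"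
      using \<rho>(2)[OF gf] comp_assoc[OF B e[OF ao] f g] by simp
    finally have "\<rho> (Comp B g f) = Comp A (\<rho> g) (\<rho> f)"
      by (intro uniq[OF c \<rho>(1)[OF gf] comp_in_Hom[OF A \<rho>(1)[OF f] \<rho>(1)[OF g]]]) simp
    then show "far R (Comp B g f) = Comp A (far R g) (far R f)"
      using fg gf by (simp add: R_def Hom_def)
  next
    show "fob R \<in> Ob B \<rightarrow>\<^sub>E Ob A" using r by (auto simp: R_def)
    show "far R \<in> Ar B \<rightarrow>\<^sub>E Ar A"
    proof (rule PiE_I)
      fix g assume "g \<in> Ar B"
      then show "far R g \<in> Ar A" using \<rho>(1)[OF Ar_in_Hom] by (simp add: R_def Hom_def)
    qed (simp add: R_def)
  qed
  have "bij_betw (\<Phi> a b) (Hom B (fob F a) b) (Hom A a (fob R b))" if a: "a \<in> Ob A" and b: "b \<in> Ob B" for a b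
  proof (rule bij_betw_byWitness[of _ "\<lambda>k. Comp B (e b) (far F k)"])
    have Rb: "fob R b = r b" using b by (simp add: R_def)
    show "\<forall>h\<in>Hom B (fob F a) b. Comp B (e b) (far F (\<Phi> a b h)) = h" using \<Phi>(2)[OF b a] by blast
    show "\<forall>k\<in>Hom A a (fob R b). \<Phi> a b (Comp B (e b) (far F k)) = k"
      unfolding Rb using \<Phi>[OF b a eF[OF b]] uniq[OF b] by blast
    show "\<Phi> a b ` Hom B (fob F a) b \<subseteq> Hom A a (fob R b)" unfolding Rb using \<Phi>(1)[OF b a] by blast
    show "(\<lambda>k. Comp B (e b) (far F k)) ` Hom A a (fob R b) \<subseteq> Hom B (fob F a) b"
      unfolding Rb using eF[OF b] by blast
  qed
  moreover have "\<Phi> (Dom A f) (Cod B g) (Comp B g (Comp B h (far F f)))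
      = Comp A (far R g) (Comp A (\<Phi> (Cod A f) (Dom B g) h) f)"
    if f: "f \<in> Ar A" and g: "g \<in> Ar B" and h: "h \<in> Hom B (fob F (Cod A f)) (Dom B g)" for f g h
  proof -
    define a a' b b' where "a = Dom A f" and "a' = Cod A f" and "b = Dom B g" and "b' = Cod B g"
    have f': "f \<in> Hom A a a'" and g': "g \<in> Hom B b b'" and h': "h \<in> Hom B (fob F a') b"
      using f g h by (auto simp: Hom_def a_def a'_def b_def b'_def)
    have o: "a \<in> Ob A" "a' \<in> Ob A" "b \<in> Ob B" "b' \<in> Ob B" using Hom_Ob[OF A f'] Hom_Ob[OF B g'] by auto
    note \<Phi>h = \<Phi>[OF o(3,2) h']
    note Ff = functor_Hom[OF F f']
    note \<Phi>hf = comp_in_Hom[OF A f' \<Phi>h(1)]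
    note all = comp_in_Hom[OF B comp_in_Hom[OF B Ff h'] g']
    have "Comp B (e b') (far F (Comp A (\<rho> g) (Comp A (\<Phi> a' b h) f)))
        = Comp B (Comp B (e b') (far F (\<rho> g))) (far F (Comp A (\<Phi> a' b h) f))"
      using functor_Comp[OF F \<Phi>hf \<rho>(1)[OF g']]
        comp_assoc[OF B functor_Hom[OF F \<Phi>hf] functor_Hom[OF F \<rho>(1)[OF g']] e[OF o(4)]] by simp
    also have "\<dots> = Comp B g (Comp B (e b) (far F (Comp A (\<Phi> a' b h) f)))"
      using \<rho>(2)[OF g'] comp_assoc[OF B functor_Hom[OF F \<Phi>hf] e[OF o(3)] g'] by simp
    also have "Comp B (e b) (far F (Comp A (\<Phi> a' b h) f)) = Comp B h (far F f)"
      using functor_Comp[OF F f' \<Phi>h(1)] comp_assoc[OF B Ff functor_Hom[OF F \<Phi>h(1)] e[OF o(3)]] \<Phi>h(2) by simp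
    finally have "\<Phi> a b' (Comp B g (Comp B h (far F f))) = Comp A (\<rho> g) (Comp A (\<Phi> a' b h) f)"
      using \<Phi>[OF o(4,1) all] by (intro uniq[OF o(4) _ comp_in_Hom[OF A \<Phi>hf \<rho>(1)[OF g']]]) simp_all
    then show ?thesis using g by (simp add: R_def a_def a'_def b_def b'_def)
  qed
  ultimately have "is_adjunction A B F R"
    unfolding is_adjunction_def using F R by blast
  then show ?thesis by blast
qed

text \<open>The category of maps \<open>\<sigma> : \<beta> \<rightarrow> G \<alpha>\<close>; the pair \<open>(\<sigma>, f)\<close> is the map from \<open>\<sigma>\<close> to \<open>G f \<circ> \<sigma>\<close> given by \<open>f\<close>.\<close>

definition comma_category ::
  "('o, 'a, 'y) category_scheme \<Rightarrow> ('p, 'b, 'z) category_scheme \<Rightarrow> ('o, 'a, 'p, 'b) func \<Rightarrow> 'p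
     \<Rightarrow> ('o \<times> 'b, 'b \<times> 'a) category" where
  "comma_category C D G \<beta> =
     \<lparr>Ob = {(\<alpha>, \<sigma>). \<alpha> \<in> Ob C \<and> \<sigma> \<in> Hom D \<beta> (fob G \<alpha>)},
      Ar = {(\<sigma>, f). f \<in> Ar C \<and> \<sigma> \<in> Hom D \<beta> (fob G (Dom C f))},
      Dom = (\<lambda>(\<sigma>, f). (Dom C f, \<sigma>)), Cod = (\<lambda>(\<sigma>, f). (Cod C f, Comp D (far G f) \<sigma>)),
      Idt = (\<lambda>(\<alpha>, \<sigma>). (\<sigma>, Idt C \<alpha>)), Comp = (\<lambda>(\<sigma>', f') (\<sigma>, f). (\<sigma>, Comp C f' f))\<rparr>"

abbreviation "comma_diagram C D G X \<beta> \<equiv> func_comp (comma_category C D G \<beta>) X \<lparr>fob = fst, far = snd\<rparr>"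

lemma comma_category_simps:
  "(\<alpha>, \<sigma>) \<in> Ob (comma_category C D G \<beta>) \<longleftrightarrow> \<alpha> \<in> Ob C \<and> \<sigma> \<in> Hom D \<beta> (fob G \<alpha>)"
  "(\<sigma>, f) \<in> Ar (comma_category C D G \<beta>) \<longleftrightarrow> f \<in> Ar C \<and> \<sigma> \<in> Hom D \<beta> (fob G (Dom C f))"
  "Dom (comma_category C D G \<beta>) (\<sigma>, f) = (Dom C f, \<sigma>)"
  "Cod (comma_category C D G \<beta>) (\<sigma>, f) = (Cod C f, Comp D (far G f) \<sigma>)"
  "Idt (comma_category C D G \<beta>) (\<alpha>, \<sigma>) = (\<sigma>, Idt C \<alpha>)"
  "Comp (comma_category C D G \<beta>) (\<sigma>', f') (\<sigma>, f) = (\<sigma>, Comp C f' f)"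
  by (simp_all add: comma_category_def)

context
  fixes C :: "('o, 'a, 'x) category_scheme" and D :: "('p, 'b, 'y) category_scheme"
    and M :: "('q, 'c, 'z) category_scheme" and G :: "('o, 'a, 'p, 'b) func"
  assumes C: "is_category C" and D: "is_category D" and M: "is_category M" and G: "is_functor C D G"
begin

lemma comma_is_category: "is_category (comma_category C D G \<beta>)" (is "is_category ?K")
proof -
  have G1: "Comp D (far G (Idt C \<alpha>)) \<sigma> = \<sigma>" if "\<alpha> \<in> Ob C" "\<sigma> \<in> Hom D \<beta> (fob G \<alpha>)" for \<alpha> \<sigma>
    using functor_Idt[OF G that(1)] comp_Idt_left[OF D that(2)] by simp
  have Gf: "Comp D (far G f) \<sigma> \<in> Hom D \<beta> (fob G (Cod C f))" if "f \<in> Ar C" "\<sigma> \<in> Hom D \<beta> (fob G (Dom C f))" for f \<sigma>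
    by (rule comp_in_Hom[OF D that(2) functor_Hom[OF G Ar_in_Hom[OF that(1)]]])
  have Gfg: "Comp D (far G g) (Comp D (far G f) \<sigma>) = Comp D (far G (Comp C g f)) \<sigma>"
    if f: "f \<in> Ar C" and g: "g \<in> Ar C" "Dom C g = Cod C f" and \<sigma>: "\<sigma> \<in> Hom D \<beta> (fob G (Dom C f))" for f g \<sigma>
  proof -
    have g': "g \<in> Hom C (Cod C f) (Cod C g)" using g by (simp add: Hom_def)
    show ?thesis
      using comp_assoc[OF D \<sigma> functor_Hom[OF G Ar_in_Hom[OF f]] functor_Hom[OF G g']]
        functor_Comp[OF G Ar_in_Hom[OF f] g'] by simp
  qed
  show ?thesis
    unfolding is_category_def
  proof (intro conjI ballI impI)
    fix u assume u: "u \<in> Ar ?K"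
    obtain \<sigma> f where [simp]: "u = (\<sigma>, f)" by (cases u)
    have f: "f \<in> Ar C" and \<sigma>: "\<sigma> \<in> Hom D \<beta> (fob G (Dom C f))" using u by (simp_all add: comma_category_simps)
    show "Dom ?K u \<in> Ob ?K" "Cod ?K u \<in> Ob ?K" "Comp ?K u (Idt ?K (Dom ?K u)) = u"
      "Comp ?K (Idt ?K (Cod ?K u)) u = u"
      using Dom_Cod_Ob[OF C f] Gf[OF f \<sigma>] f \<sigma> comp_Idt_left[OF C Ar_in_Hom[OF f]] comp_Idt_right[OF C Ar_in_Hom[OF f]]
      by (simp_all add: comma_category_simps)
  next
    fix x assume x: "x \<in> Ob ?K"
    obtain \<alpha> \<sigma> where [simp]: "x = (\<alpha>, \<sigma>)" by (cases x)
    show "Idt ?K x \<in> Hom ?K x x"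
      using x Idt_simps[OF C] G1 by (simp add: Hom_def[of ?K] comma_category_simps)
  next
    fix u v assume uv: "u \<in> Ar ?K" "v \<in> Ar ?K" "Dom ?K v = Cod ?K u"
    obtain \<sigma> f \<sigma>' g where [simp]: "u = (\<sigma>, f)" "v = (\<sigma>', g)" by (cases u, cases v)
    show "Comp ?K v u \<in> Hom ?K (Dom ?K u) (Cod ?K v)"
      using uv Comp_simps[OF C, of f g] Gfg[of f g \<sigma>] by (simp add: Hom_def[of ?K] comma_category_simps)
  next
    fix u v w assume *: "u \<in> Ar ?K" "v \<in> Ar ?K" "w \<in> Ar ?K" "Dom ?K v = Cod ?K u" "Dom ?K w = Cod ?K v"
    obtain \<sigma> f \<sigma>' g \<sigma>'' h where [simp]: "u = (\<sigma>, f)" "v = (\<sigma>', g)" "w = (\<sigma>'', h)" by (cases u, cases v, cases w)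
    have "f \<in> Ar C" "g \<in> Ar C" "h \<in> Ar C" "Dom C g = Cod C f" "Dom C h = Cod C g"
      using * by (auto simp: comma_category_simps)
    then show "Comp ?K w (Comp ?K v u) = Comp ?K (Comp ?K w v) u"
      using comp_assoc[OF C, of f _ _ g _ h] by (simp add: comma_category_simps Hom_def)
  qed
qed

lemma comma_diagram_is_functor:
  "is_functor C M X \<Longrightarrow> is_functor (comma_category C D G \<beta>) M (comma_diagram C D G X \<beta>)"
  by (rule func_comp_is_functor[OF comma_is_category])
    (auto simp: comma_category_def intro: Ar_in_Hom)

lemma comma_cone_iff:
  "is_cone (comma_category C D G \<beta>) M (comma_diagram C D G X \<beta>) c l \<longleftrightarrow>
     c \<in> Ob M \<and> (\<forall>\<alpha>\<in>Ob C. \<forall>\<sigma>\<in>Hom D \<beta> (fob G \<alpha>). l (\<alpha>, \<sigma>) \<in> Hom M c (fob X \<alpha>)) \<and>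
     (\<forall>f\<in>Ar C. \<forall>\<sigma>\<in>Hom D \<beta> (fob G (Dom C f)).
        Comp M (far X f) (l (Dom C f, \<sigma>)) = l (Cod C f, Comp D (far G f) \<sigma>))"
  by (auto simp: is_cone_def comma_category_def func_comp_def)

text \<open>The value at \<open>\<beta>\<close> is the limit of \<open>X \<alpha>\<close> over all maps \<open>\<sigma> : \<beta> \<rightarrow> G \<alpha>\<close>, and the counit at \<open>\<alpha>\<close> is the
  projection to the component of the identity of \<open>G \<alpha>\<close>. A transformation \<open>h : G\<^sup>* Y \<rightarrow> X\<close> gives the
  cone \<open>h\<^sub>\<alpha> \<circ> Y \<sigma>\<close> on this diagram with vertex \<open>Y \<beta>\<close>; since the component at \<open>\<sigma>\<close> is the action of \<open>\<sigma>\<close>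
  followed by the counit, every transposed map has to be the one induced by this cone.\<close>

lemma right_Kan_extension:
  assumes X: "is_functor C M X"
    and lim: "\<And>\<beta>. \<beta> \<in> Ob D \<Longrightarrow> \<exists>c l. is_limit (comma_category C D G \<beta>) M (comma_diagram C D G X \<beta>) c l"
  shows "\<exists>R e. R \<in> Ob (functor_category D M) \<and>
    e \<in> Hom (functor_category C M) (fob (precomposition C D M G) R) X \<and>
    (\<forall>Y\<in>Ob (functor_category D M). \<forall>h\<in>Hom (functor_category C M) (fob (precomposition C D M G) Y) X.
       \<exists>!k. k \<in> Hom (functor_category D M) Y R \<and>
         Comp (functor_category C M) e (far (precomposition C D M G) k) = h)"
proof -
  let ?K = "comma_category C D G"
  obtain L l where lim: "\<And>\<beta>. \<beta> \<in> Ob D \<Longrightarrow> is_limit (?K \<beta>) M (comma_diagram C D G X \<beta>) (L \<beta>) (l \<beta>)"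
    using lim by metis
  have cone: "L \<beta> \<in> Ob M"
    "\<And>\<alpha> \<sigma>. \<alpha> \<in> Ob C \<Longrightarrow> \<sigma> \<in> Hom D \<beta> (fob G \<alpha>) \<Longrightarrow> l \<beta> (\<alpha>, \<sigma>) \<in> Hom M (L \<beta>) (fob X \<alpha>)"
    "\<And>f \<alpha> \<alpha>' \<sigma>. f \<in> Hom C \<alpha> \<alpha>' \<Longrightarrow> \<sigma> \<in> Hom D \<beta> (fob G \<alpha>) \<Longrightarrow>
       Comp M (far X f) (l \<beta> (\<alpha>, \<sigma>)) = l \<beta> (\<alpha>', Comp D (far G f) \<sigma>)"
    if "\<beta> \<in> Ob D" for \<beta>
    using lim[OF that, unfolded is_limit_def comma_cone_iff] by (auto simp: Hom_def[of C])
  have eqI: "u = v" if "\<beta> \<in> Ob D" "u \<in> Hom M c (L \<beta>)" "v \<in> Hom M c (L \<beta>)"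
    "\<And>\<alpha> \<sigma>. \<alpha> \<in> Ob C \<Longrightarrow> \<sigma> \<in> Hom D \<beta> (fob G \<alpha>) \<Longrightarrow> Comp M (l \<beta> (\<alpha>, \<sigma>)) u = Comp M (l \<beta> (\<alpha>, \<sigma>)) v" for \<beta> c u v
    by (rule limit_map_eqI[OF comma_is_category M comma_diagram_is_functor[OF X] lim[OF that(1)] that(2,3)])
      (use that(4) in \<open>auto simp: comma_category_def\<close>)
  have induced: "\<exists>u. u \<in> Hom M (L \<beta>) (L \<beta>') \<and>
      (\<forall>\<alpha>\<in>Ob C. \<forall>\<sigma>\<in>Hom D \<beta>' (fob G \<alpha>). Comp M (l \<beta>' (\<alpha>, \<sigma>)) u = l \<beta> (\<alpha>, Comp D \<sigma> g))"
    if g: "g \<in> Hom D \<beta> \<beta>'" for g \<beta> \<beta>'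
  proof -
    have o: "\<beta> \<in> Ob D" "\<beta>' \<in> Ob D" using Hom_Ob[OF D g] by auto
    have "is_cone (?K \<beta>') M (comma_diagram C D G X \<beta>') (L \<beta>) (\<lambda>(\<alpha>, \<sigma>). l \<beta> (\<alpha>, Comp D \<sigma> g))"
      unfolding comma_cone_iff
    proof (intro conjI ballI)
      fix f \<sigma> assume f: "f \<in> Ar C" and \<sigma>: "\<sigma> \<in> Hom D \<beta>' (fob G (Dom C f))"
      show "Comp M (far X f) (case (Dom C f, \<sigma>) of (\<alpha>, \<sigma>) \<Rightarrow> l \<beta> (\<alpha>, Comp D \<sigma> g))
          = (case (Cod C f, Comp D (far G f) \<sigma>) of (\<alpha>, \<sigma>) \<Rightarrow> l \<beta> (\<alpha>, Comp D \<sigma> g))"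
        using cone(3)[OF o(1) Ar_in_Hom[OF f] comp_in_Hom[OF D g \<sigma>]]
          comp_assoc[OF D g \<sigma> functor_Hom[OF G Ar_in_Hom[OF f]]] by simp
    qed (use cone(1,2)[OF o(1)] comp_in_Hom[OF D g] in simp_all)
    from limit_induced[OF lim[OF o(2)] this] obtain u where u: "u \<in> Hom M (L \<beta>) (L \<beta>')"
      "\<And>j. j \<in> Ob (?K \<beta>') \<Longrightarrow> Comp M (l \<beta>' j) u = (\<lambda>(\<alpha>, \<sigma>). l \<beta> (\<alpha>, Comp D \<sigma> g)) j" by metis
    have "Comp M (l \<beta>' (\<alpha>, \<sigma>)) u = l \<beta> (\<alpha>, Comp D \<sigma> g)" if "\<alpha> \<in> Ob C" "\<sigma> \<in> Hom D \<beta>' (fob G \<alpha>)" for \<alpha> \<sigma>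
      using u(2)[of "(\<alpha>, \<sigma>)"] that by (simp add: comma_category_simps)
    with u(1) show ?thesis by blast
  qed
  have "\<forall>g\<in>Ar D. \<exists>u. u \<in> Hom M (L (Dom D g)) (L (Cod D g)) \<and>
     (\<forall>\<alpha>\<in>Ob C. \<forall>\<sigma>\<in>Hom D (Cod D g) (fob G \<alpha>). Comp M (l (Cod D g) (\<alpha>, \<sigma>)) u = l (Dom D g) (\<alpha>, Comp D \<sigma> g))"
    by (intro ballI induced Ar_in_Hom)
  from bchoice[OF this] obtain \<rho> where \<rho>0: "\<forall>g\<in>Ar D. \<rho> g \<in> Hom M (L (Dom D g)) (L (Cod D g)) \<and>
     (\<forall>\<alpha>\<in>Ob C. \<forall>\<sigma>\<in>Hom D (Cod D g) (fob G \<alpha>). Comp M (l (Cod D g) (\<alpha>, \<sigma>)) (\<rho> g) = l (Dom D g) (\<alpha>, Comp D \<sigma> g))"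
    by blast
  have \<rho>: "\<rho> g \<in> Hom M (L \<beta>) (L \<beta>')"
    "\<And>\<alpha> \<sigma>. \<alpha> \<in> Ob C \<Longrightarrow> \<sigma> \<in> Hom D \<beta>' (fob G \<alpha>) \<Longrightarrow> Comp M (l \<beta>' (\<alpha>, \<sigma>)) (\<rho> g) = l \<beta> (\<alpha>, Comp D \<sigma> g)"
    if "g \<in> Hom D \<beta> \<beta>'" for g \<beta> \<beta>'
    using \<rho>0[rule_format, of g] HomD[OF that] by auto
  define R where "R = \<lparr>fob = restrict L (Ob D), far = restrict \<rho> (Ar D)\<rparr>"
  have Rob: "fob R \<beta> = L \<beta>" if "\<beta> \<in> Ob D" for \<beta> using that by (simp add: R_def)
  have Rar: "far R g = \<rho> g" if "g \<in> Hom D \<beta> \<beta>'" for g \<beta> \<beta>' using HomD[OF that] by (simp add: R_def)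
  have R: "is_functor D M R"
    unfolding is_functor_def
  proof (intro conjI ballI impI)
    show "fob R \<in> Ob D \<rightarrow>\<^sub>E Ob M" using cone(1) by (auto simp: R_def)
    show "far R \<in> Ar D \<rightarrow>\<^sub>E Ar M"
    proof (rule PiE_I)
      fix g assume "g \<in> Ar D"
      then show "far R g \<in> Ar M" using \<rho>(1)[OF Ar_in_Hom] by (simp add: R_def Hom_def)
    qed (simp add: R_def)
    fix g assume g: "g \<in> Ar D"
    show "far R g \<in> Hom M (fob R (Dom D g)) (fob R (Cod D g))"
      using \<rho>(1)[OF Ar_in_Hom[OF g]] g Dom_Cod_Ob[OF D g] by (simp add: R_def)
  next
    fix \<beta> assume \<beta>: "\<beta> \<in> Ob D"
    have "\<rho> (Idt D \<beta>) = Idt M (L \<beta>)"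
    proof (rule eqI[OF \<beta> \<rho>(1)[OF Idt_in_Hom[OF D \<beta>]] Idt_in_Hom[OF M cone(1)[OF \<beta>]]])
      fix \<alpha> \<sigma> assume *: "\<alpha> \<in> Ob C" "\<sigma> \<in> Hom D \<beta> (fob G \<alpha>)"
      show "Comp M (l \<beta> (\<alpha>, \<sigma>)) (\<rho> (Idt D \<beta>)) = Comp M (l \<beta> (\<alpha>, \<sigma>)) (Idt M (L \<beta>))"
        using \<rho>(2)[OF Idt_in_Hom[OF D \<beta>] *] comp_Idt_right[OF D *(2)] comp_Idt_right[OF M cone(2)[OF \<beta> *]] by simp
    qed
    then show "far R (Idt D \<beta>) = Idt M (fob R \<beta>)" using \<beta> Idt_simps(1)[OF D \<beta>] by (simp add: R_def)
  next
    fix f g assume fg: "f \<in> Ar D" "g \<in> Ar D" "Dom D g = Cod D f"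
    define a b c where "a = Dom D f" and "b = Cod D f" and "c = Cod D g"
    have f: "f \<in> Hom D a b" and g: "g \<in> Hom D b c" using fg by (auto simp: Hom_def a_def b_def c_def)
    note gf = comp_in_Hom[OF D f g]
    have c: "c \<in> Ob D" using Hom_Ob[OF D g] by simp
    have b: "b \<in> Ob D" using Hom_Ob[OF D g] by simp
    have "\<rho> (Comp D g f) = Comp M (\<rho> g) (\<rho> f)"
    proof (rule eqI[OF c \<rho>(1)[OF gf] comp_in_Hom[OF M \<rho>(1)[OF f] \<rho>(1)[OF g]]])
      fix \<alpha> \<sigma> assume *: "\<alpha> \<in> Ob C" "\<sigma> \<in> Hom D c (fob G \<alpha>)"
      show "Comp M (l c (\<alpha>, \<sigma>)) (\<rho> (Comp D g f)) = Comp M (l c (\<alpha>, \<sigma>)) (Comp M (\<rho> g) (\<rho> f))"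
        using \<rho>(2)[OF gf *] \<rho>(2)[OF g *] \<rho>(2)[OF f *(1) comp_in_Hom[OF D g *(2)]] comp_assoc[OF D f g *(2)]
          comp_assoc[OF M \<rho>(1)[OF f] \<rho>(1)[OF g] cone(2)[OF c *]] by simp
    qed
    then show "far R (Comp D g f) = Comp M (far R g) (far R f)"
      using Rar[OF f] Rar[OF g] Rar[OF gf] by simp
  qed
  define e where "e = \<lparr>nsrc = func_comp C R G, ntgt = X,
    ncomp = (\<lambda>\<alpha>\<in>Ob C. l (fob G \<alpha>) (\<alpha>, Idt D (fob G \<alpha>)))\<rparr>"
  have G\<alpha>: "fob G \<alpha> \<in> Ob D" if "\<alpha> \<in> Ob C" for \<alpha> by (rule functor_Ob[OF G that])
  have e\<alpha>: "l (fob G \<alpha>) (\<alpha>, Idt D (fob G \<alpha>)) \<in> Hom M (L (fob G \<alpha>)) (fob X \<alpha>)" if "\<alpha> \<in> Ob C" for \<alpha>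
    by (rule cone(2)[OF G\<alpha>[OF that] that Idt_in_Hom[OF D G\<alpha>[OF that]]])
  have e\<rho>: "Comp M (l (fob G \<alpha>) (\<alpha>, Idt D (fob G \<alpha>))) (\<rho> \<sigma>) = l \<beta> (\<alpha>, \<sigma>)"
    if "\<alpha> \<in> Ob C" "\<sigma> \<in> Hom D \<beta> (fob G \<alpha>)" for \<alpha> \<sigma> \<beta>
    using \<rho>(2)[OF that(2,1) Idt_in_Hom[OF D G\<alpha>[OF that(1)]]] comp_Idt_left[OF D that(2)] by simp
  have e: "is_nattrans C M e"
    unfolding is_nattrans_def
  proof (intro conjI ballI)
    fix f assume f: "f \<in> Ar C"
    have o: "Dom C f \<in> Ob C" "Cod C f \<in> Ob C" using Dom_Cod_Ob[OF C f] by auto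
    have Gf: "far G f \<in> Hom D (fob G (Dom C f)) (fob G (Cod C f))" by (rule functor_Hom[OF G Ar_in_Hom[OF f]])
    show "Comp M (ncomp e (Cod C f)) (far (nsrc e) f) = Comp M (far (ntgt e) f) (ncomp e (Dom C f))"
      using o f Rar[OF Gf] e\<rho>[OF o(2) Gf] comp_Idt_right[OF D Gf]
        cone(3)[OF G\<alpha>[OF o(1)] Ar_in_Hom[OF f] Idt_in_Hom[OF D G\<alpha>[OF o(1)]]] by (simp add: e_def)
  qed (use functor_comp_functor[OF C G R] X e\<alpha> Rob[OF G\<alpha>] in \<open>simp_all add: e_def\<close>)
  have "\<exists>!k. k \<in> Hom (functor_category D M) Y R \<and> Comp (functor_category C M) e (far (precomposition C D M G) k) = h"
    if Y: "is_functor D M Y" and h: "h \<in> Hom (functor_category C M) (fob (precomposition C D M G) Y) X" for Y h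
  proof -
    have hn: "is_nattrans C M h" and hs: "nsrc h = func_comp C Y G" and ht: "ntgt h = X"
      using h by (auto simp: Hom_def precomposition_fob[OF Y])
    have h\<alpha>: "ncomp h \<alpha> \<in> Hom M (fob Y (fob G \<alpha>)) (fob X \<alpha>)" if "\<alpha> \<in> Ob C" for \<alpha>
      using nattrans_Hom[OF hn that] that by (simp add: hs ht)
    have Y\<sigma>: "far Y \<sigma> \<in> Hom M (fob Y \<beta>) (fob Y \<gamma>)" if "\<sigma> \<in> Hom D \<beta> \<gamma>" for \<sigma> \<beta> \<gamma>
      by (rule functor_Hom[OF Y that])
    have "\<exists>u. u \<in> Hom M (fob Y \<beta>) (L \<beta>) \<and>
        (\<forall>\<alpha>\<in>Ob C. \<forall>\<sigma>\<in>Hom D \<beta> (fob G \<alpha>). Comp M (l \<beta> (\<alpha>, \<sigma>)) u = Comp M (ncomp h \<alpha>) (far Y \<sigma>))"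
      if \<beta>: "\<beta> \<in> Ob D" for \<beta>
    proof -
      have "is_cone (?K \<beta>) M (comma_diagram C D G X \<beta>) (fob Y \<beta>) (\<lambda>(\<alpha>, \<sigma>). Comp M (ncomp h \<alpha>) (far Y \<sigma>))"
        unfolding comma_cone_iff
      proof (intro conjI ballI)
        fix f \<sigma> assume f: "f \<in> Ar C" and \<sigma>: "\<sigma> \<in> Hom D \<beta> (fob G (Dom C f))"
        have o: "Dom C f \<in> Ob C" "Cod C f \<in> Ob C" using Dom_Cod_Ob[OF C f] by auto
        have Gf: "far G f \<in> Hom D (fob G (Dom C f)) (fob G (Cod C f))" by (rule functor_Hom[OF G Ar_in_Hom[OF f]])
        have "Comp M (far X f) (Comp M (ncomp h (Dom C f)) (far Y \<sigma>))
            = Comp M (Comp M (ncomp h (Cod C f)) (far Y (far G f))) (far Y \<sigma>)"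
          using comp_assoc[OF M Y\<sigma>[OF \<sigma>] h\<alpha>[OF o(1)] functor_Hom[OF X Ar_in_Hom[OF f]]]
            nattrans_natural[OF hn Ar_in_Hom[OF f]] f by (simp add: hs ht)
        also have "\<dots> = Comp M (ncomp h (Cod C f)) (far Y (Comp D (far G f) \<sigma>))"
          using comp_assoc[OF M Y\<sigma>[OF \<sigma>] Y\<sigma>[OF Gf] h\<alpha>[OF o(2)]] functor_Comp[OF Y \<sigma> Gf] by simp
        finally show "Comp M (far X f) (case (Dom C f, \<sigma>) of (\<alpha>, \<sigma>) \<Rightarrow> Comp M (ncomp h \<alpha>) (far Y \<sigma>))
            = (case (Cod C f, Comp D (far G f) \<sigma>) of (\<alpha>, \<sigma>) \<Rightarrow> Comp M (ncomp h \<alpha>) (far Y \<sigma>))" by simp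
      qed (use functor_Ob[OF Y \<beta>] comp_in_Hom[OF M Y\<sigma> h\<alpha>] in simp_all)
      from limit_induced[OF lim[OF \<beta>] this] obtain u where u: "u \<in> Hom M (fob Y \<beta>) (L \<beta>)"
        "\<And>j. j \<in> Ob (?K \<beta>) \<Longrightarrow> Comp M (l \<beta> j) u = (\<lambda>(\<alpha>, \<sigma>). Comp M (ncomp h \<alpha>) (far Y \<sigma>)) j" by metis
      have "Comp M (l \<beta> (\<alpha>, \<sigma>)) u = Comp M (ncomp h \<alpha>) (far Y \<sigma>)" if "\<alpha> \<in> Ob C" "\<sigma> \<in> Hom D \<beta> (fob G \<alpha>)" for \<alpha> \<sigma>
        using u(2)[of "(\<alpha>, \<sigma>)"] that by (simp add: comma_category_simps)
      with u(1) show ?thesis by blast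
    qed
    then obtain \<kappa> where \<kappa>: "\<And>\<beta>. \<beta> \<in> Ob D \<Longrightarrow> \<kappa> \<beta> \<in> Hom M (fob Y \<beta>) (L \<beta>)"
      and l\<kappa>: "\<And>\<beta> \<alpha> \<sigma>. \<beta> \<in> Ob D \<Longrightarrow> \<alpha> \<in> Ob C \<Longrightarrow> \<sigma> \<in> Hom D \<beta> (fob G \<alpha>) \<Longrightarrow>
         Comp M (l \<beta> (\<alpha>, \<sigma>)) (\<kappa> \<beta>) = Comp M (ncomp h \<alpha>) (far Y \<sigma>)"
      by metis
    define k where "k = \<lparr>nsrc = Y, ntgt = R, ncomp = restrict \<kappa> (Ob D)\<rparr>"
    have k: "is_nattrans D M k"
      unfolding is_nattrans_def
    proof (intro conjI ballI)
      fix g assume "g \<in> Ar D"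
      define b c where "b = Dom D g" and "c = Cod D g"
      have g: "g \<in> Hom D b c" using \<open>g \<in> Ar D\<close> by (simp add: b_def c_def Hom_def)
      have o: "b \<in> Ob D" "c \<in> Ob D" using Hom_Ob[OF D g] by auto
      have "Comp M (\<kappa> c) (far Y g) = Comp M (\<rho> g) (\<kappa> b)"
      proof (rule eqI[OF o(2) comp_in_Hom[OF M Y\<sigma>[OF g] \<kappa>[OF o(2)]] comp_in_Hom[OF M \<kappa>[OF o(1)] \<rho>(1)[OF g]]])
        fix \<alpha> \<sigma> assume *: "\<alpha> \<in> Ob C" "\<sigma> \<in> Hom D c (fob G \<alpha>)"
        show "Comp M (l c (\<alpha>, \<sigma>)) (Comp M (\<kappa> c) (far Y g)) = Comp M (l c (\<alpha>, \<sigma>)) (Comp M (\<rho> g) (\<kappa> b))"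
          using comp_assoc[OF M Y\<sigma>[OF g] \<kappa>[OF o(2)] cone(2)[OF o(2) *]] l\<kappa>[OF o(2) *]
            comp_assoc[OF M Y\<sigma>[OF g] Y\<sigma>[OF *(2)] h\<alpha>[OF *(1)]] functor_Comp[OF Y g *(2)]
            comp_assoc[OF M \<kappa>[OF o(1)] \<rho>(1)[OF g] cone(2)[OF o(2) *]] \<rho>(2)[OF g *]
            l\<kappa>[OF o(1) *(1) comp_in_Hom[OF D g *(2)]] by simp
      qed
      then show "Comp M (ncomp k (Cod D g)) (far (nsrc k) g) = Comp M (far (ntgt k) g) (ncomp k (Dom D g))"
        using o Rar[OF g] by (simp add: k_def b_def c_def)
    qed (use Y R \<kappa> Rob in \<open>simp_all add: k_def\<close>)
    have composite: "Comp (functor_category C M) e (far (precomposition C D M G) k') = h \<longleftrightarrow>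
        (\<forall>\<alpha>\<in>Ob C. Comp M (l (fob G \<alpha>) (\<alpha>, Idt D (fob G \<alpha>))) (ncomp k' (fob G \<alpha>)) = ncomp h \<alpha>)"
      if k': "is_nattrans D M k'" "nsrc k' = Y" "ntgt k' = R" for k'
    proof -
      have "is_nattrans C M (Comp (functor_category C M) e (far (precomposition C D M G) k'))"
        using Comp_simps(1)[OF functor_category_is_category[OF C M], of "far (precomposition C D M G) k'" e]
          precomposition_nattrans[OF C G k'(1)] e precomposition_far[OF k'(1), of C G] k'(3)
        by (simp add: e_def)
      then have "Comp (functor_category C M) e (far (precomposition C D M G) k') = h \<longleftrightarrow>
        (\<forall>\<alpha>\<in>Ob C. ncomp (Comp (functor_category C M) e (far (precomposition C D M G) k')) \<alpha> = ncomp h \<alpha>)"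
      proof (rule nattrans_eq_iff[OF _ hn])
        show "nsrc (Comp (functor_category C M) e (far (precomposition C D M G) k')) = nsrc h"
          "ntgt (Comp (functor_category C M) e (far (precomposition C D M G) k')) = ntgt h"
          using hs ht precomposition_far[OF k'(1), of C G] k'(2) by (simp_all add: e_def)
      qed
      then show ?thesis using precomposition_far[OF k'(1), of C G] by (simp add: e_def)
    qed
    show ?thesis
    proof (rule ex1I[of _ k])
      have "Comp M (l (fob G \<alpha>) (\<alpha>, Idt D (fob G \<alpha>))) (ncomp k (fob G \<alpha>)) = ncomp h \<alpha>" if \<alpha>: "\<alpha> \<in> Ob C" for \<alpha>
        using l\<kappa>[OF G\<alpha>[OF \<alpha>] \<alpha> Idt_in_Hom[OF D G\<alpha>[OF \<alpha>]]] functor_Idt[OF Y G\<alpha>[OF \<alpha>]]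
          comp_Idt_right[OF M h\<alpha>[OF \<alpha>]] G\<alpha>[OF \<alpha>] by (simp add: k_def)
      then show "k \<in> Hom (functor_category D M) Y R \<and>
          Comp (functor_category C M) e (far (precomposition C D M G) k) = h"
        using composite[OF k] k by (simp add: k_def Hom_def)
    next
      fix k' assume k': "k' \<in> Hom (functor_category D M) Y R \<and>
        Comp (functor_category C M) e (far (precomposition C D M G) k') = h"
      then have n: "is_nattrans D M k'" "nsrc k' = Y" "ntgt k' = R" by (auto simp: Hom_def)
      then have ek': "\<And>\<alpha>. \<alpha> \<in> Ob C \<Longrightarrow> Comp M (l (fob G \<alpha>) (\<alpha>, Idt D (fob G \<alpha>))) (ncomp k' (fob G \<alpha>)) = ncomp h \<alpha>"
        using composite[OF n] k' by blast
      have k'\<beta>: "ncomp k' \<beta> \<in> Hom M (fob Y \<beta>) (L \<beta>)" if "\<beta> \<in> Ob D" for \<beta>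
        using nattrans_Hom[OF n(1) that] Rob[OF that] by (simp add: n)
      show "k' = k"
      proof (rule nattrans_eqI[OF n(1) k])
        fix \<beta> assume \<beta>: "\<beta> \<in> Ob D"
        have "ncomp k' \<beta> = \<kappa> \<beta>"
        proof (rule eqI[OF \<beta> k'\<beta>[OF \<beta>] \<kappa>[OF \<beta>]])
          fix \<alpha> \<sigma> assume *: "\<alpha> \<in> Ob C" "\<sigma> \<in> Hom D \<beta> (fob G \<alpha>)"
          have "Comp M (l \<beta> (\<alpha>, \<sigma>)) (ncomp k' \<beta>)
              = Comp M (l (fob G \<alpha>) (\<alpha>, Idt D (fob G \<alpha>))) (Comp M (\<rho> \<sigma>) (ncomp k' \<beta>))"
            using e\<rho>[OF *] comp_assoc[OF M k'\<beta>[OF \<beta>] \<rho>(1)[OF *(2)] e\<alpha>[OF *(1)]] by simp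
          also have "\<dots> = Comp M (l (fob G \<alpha>) (\<alpha>, Idt D (fob G \<alpha>))) (Comp M (ncomp k' (fob G \<alpha>)) (far Y \<sigma>))"
            using nattrans_natural[OF n(1) *(2)] Rar[OF *(2)] by (simp add: n)
          also have "\<dots> = Comp M (l \<beta> (\<alpha>, \<sigma>)) (\<kappa> \<beta>)"
            using comp_assoc[OF M Y\<sigma>[OF *(2)] k'\<beta>[OF G\<alpha>[OF *(1)]] e\<alpha>[OF *(1)]] ek'[OF *(1)] l\<kappa>[OF \<beta> *] by simp
          finally show "Comp M (l \<beta> (\<alpha>, \<sigma>)) (ncomp k' \<beta>) = Comp M (l \<beta> (\<alpha>, \<sigma>)) (\<kappa> \<beta>)" .
        qed
        then show "ncomp k' \<beta> = ncomp k \<beta>" using \<beta> by (simp add: k_def)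
      qed (use n in \<open>simp_all add: k_def\<close>)
    qed
  qed
  moreover have "e \<in> Hom (functor_category C M) (fob (precomposition C D M G) R) X"
    using e precomposition_fob[OF R, of C G] by (simp add: Hom_def e_def)
  ultimately show ?thesis using R by (intro exI[of _ R] exI[of _ e]) simp
qed

end

proposition precomposition_has_right_adjoint:
  fixes C D :: "('s::infinite, 's, 'x) category_scheme" and M :: "('o, 'a, 'z) category_scheme"
  assumes C: "is_category C" and D: "is_category D" and M: "is_category M" and G: "is_functor C D G"
    and lim: "has_small_limits TYPE('s) M"
  shows "\<exists>R. is_adjunction (functor_category D M) (functor_category C M) (precomposition C D M G) R"
proof (rule universal_arrows_give_adjunction[OF functor_category_is_category[OF D M]
      functor_category_is_category[OF C M] precomposition_is_functor[OF C D M G]])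
  fix X assume "X \<in> Ob (functor_category C M)"
  then have X: "is_functor C M X" by simp
  obtain e :: "'s \<times> 's \<Rightarrow> 's" where e: "inj e" using inj_pair_exists by blast
  show "\<exists>R e. R \<in> Ob (functor_category D M) \<and>
    e \<in> Hom (functor_category C M) (fob (precomposition C D M G) R) X \<and>
    (\<forall>Y\<in>Ob (functor_category D M). \<forall>h\<in>Hom (functor_category C M) (fob (precomposition C D M G) Y) X.
       \<exists>!k. k \<in> Hom (functor_category D M) Y R \<and>
         Comp (functor_category C M) e (far (precomposition C D M G) k) = h)"
    by (rule right_Kan_extension[OF C D M G X])
      (rule small_limit_exists[OF lim comma_is_category[OF C D M G] comma_diagram_is_functor[OF C D M G X] e e])
qed

lemma adjunction_reedy_model:
  "is_adjunction (reedy_model D M) (reedy_model C M) F R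
     \<longleftrightarrow> is_adjunction (functor_category D M) (functor_category C M) F R"
  "is_functor (reedy_model D M) (reedy_model C M) F
     \<longleftrightarrow> is_functor (functor_category D M) (functor_category C M) F"
  by (simp_all add: is_adjunction_def is_functor_def Hom_def reedy_model_def Let_def)

proposition cofibering_imp_left_quillen:
  fixes C D :: "('s::infinite, 's) reedy" and M :: "('o, 'a) model_structure"
  assumes C: "reedy_category C" and D: "reedy_category D" and G: "reedy_functor C D G"
    and cofib: "cofibering C D G" and MM: "model_category TYPE('s) M"
  shows "left_quillen (reedy_model D M) (reedy_model C M) (precomposition C D M G)"
proof -
  note KC = reedy_is_category[OF C] and KD = reedy_is_category[OF D] and M = model_categoryD[OF MM]
  have F: "is_functor C D G" by (rule reedy_functorD(1)[OF G])
  have "far (precomposition C D M G) t \<in> weq (reedy_model C M)" if "t \<in> weq (reedy_model D M)" for t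
  proof -
    have t: "is_nattrans D M t" "\<forall>\<beta>\<in>Ob D. ncomp t \<beta> \<in> weq M" using that by (auto simp: reedy_model_simps)
    then show ?thesis
      using precomposition_nattrans[OF KC F t(1)] functor_Ob[OF F]
      by (simp add: reedy_model_simps precomposition_far[OF t(1)])
  qed
  then show ?thesis
    unfolding left_quillen_def adjunction_reedy_model
    using precomposition_is_functor[OF KC KD M(1) F] precomposition_has_right_adjoint[OF KC KD M(1) F M(2)]
      cofibering_preserves_cofibrations[OF C D G cofib MM] by blast
qed

section \<open>The model category of sets with injections and surjections\<close>

abbreviation fn :: "'u set \<times> 'u set \<times> ('u \<Rightarrow> 'u) \<Rightarrow> 'u \<Rightarrow> 'u" where
  "fn f \<equiv> snd (snd f)"

definition setmap :: "'u set \<Rightarrow> 'u set \<Rightarrow> ('u \<Rightarrow> 'u) \<Rightarrow> 'u set \<times> 'u set \<times> ('u \<Rightarrow> 'u)" where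
  "setmap A B \<phi> = (A, B, restrict \<phi> A)"

text \<open>If all maps are weak equivalences, a model structure is just a weak factorization system. Here it
  consists of injections and surjections; the lifting property rests on the axiom of choice.\<close>

definition set_model :: "('u set, 'u set \<times> 'u set \<times> ('u \<Rightarrow> 'u)) model_structure" where
  "set_model =
     \<lparr>Ob = UNIV, Ar = {(A, B, f). f \<in> A \<rightarrow>\<^sub>E B}, Dom = fst, Cod = (\<lambda>f. fst (snd f)),
      Idt = (\<lambda>A. setmap A A (\<lambda>x. x)),
      Comp = (\<lambda>g f. setmap (fst f) (fst (snd g)) (\<lambda>x. fn g (fn f x))),
      weq = {(A, B, f). f \<in> A \<rightarrow>\<^sub>E B},
      cof = {(A, B, f). f \<in> A \<rightarrow>\<^sub>E B \<and> inj_on f A},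
      fib = {(A, B, f). f \<in> A \<rightarrow>\<^sub>E B \<and> f ` A = B}\<rparr>"

lemma setmap_simps [simp]:
  "fst (setmap A B \<phi>) = A" "fst (snd (setmap A B \<phi>)) = B" "x \<in> A \<Longrightarrow> fn (setmap A B \<phi>) x = \<phi> x"
  by (simp_all add: setmap_def)

lemma set_model_Hom: "f \<in> Hom set_model A B \<longleftrightarrow> fst f = A \<and> fst (snd f) = B \<and> fn f \<in> A \<rightarrow>\<^sub>E B"
  by (cases f) (auto simp: Hom_def set_model_def)

lemma set_model_simps:
  "Ob set_model = UNIV" "Dom set_model = fst" "Cod set_model f = fst (snd f)"
  "Idt set_model A = setmap A A (\<lambda>x. x)"
  "Comp set_model g f = setmap (fst f) (fst (snd g)) (\<lambda>x. fn g (fn f x))"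
  "f \<in> Ar set_model \<longleftrightarrow> fn f \<in> fst f \<rightarrow>\<^sub>E fst (snd f)"
  "weq set_model = Ar set_model"
  "f \<in> cof set_model \<longleftrightarrow> fn f \<in> fst f \<rightarrow>\<^sub>E fst (snd f) \<and> inj_on (fn f) (fst f)"
  "f \<in> fib set_model \<longleftrightarrow> fn f \<in> fst f \<rightarrow>\<^sub>E fst (snd f) \<and> fn f ` fst f = fst (snd f)"
  by (cases f; simp add: set_model_def)+

lemma setmap_Hom: "setmap A B \<phi> \<in> Hom set_model A B \<longleftrightarrow> (\<forall>x\<in>A. \<phi> x \<in> B)"
  by (auto simp: set_model_Hom setmap_def)

lemma set_model_HomD:
  assumes "f \<in> Hom set_model A B"
  shows "fst f = A" "fst (snd f) = B" "x \<in> A \<Longrightarrow> fn f x \<in> B"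
  using assms by (auto simp: set_model_Hom)

lemma set_model_eqI:
  assumes "f \<in> Hom set_model A B" "g \<in> Hom set_model A B" "\<And>x. x \<in> A \<Longrightarrow> fn f x = fn g x"
  shows "f = g"
proof -
  have "fn f = fn g"
    using assms by (intro PiE_ext[of _ A "\<lambda>_. B"]) (auto simp: set_model_Hom)
  with assms(1,2) show ?thesis by (auto simp: set_model_Hom prod_eq_iff)
qed

lemma set_model_comp_fn:
  "f \<in> Hom set_model A B \<Longrightarrow> x \<in> A \<Longrightarrow> fn (Comp set_model g f) x = fn g (fn f x)"
  by (simp add: set_model_simps set_model_Hom)

lemma set_model_is_category: "is_category set_model"
proof -
  have 1: "Comp set_model g f \<in> Hom set_model A C" if "f \<in> Hom set_model A B" "g \<in> Hom set_model B C" for f g A B C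
    using that set_model_HomD[OF that(1)] set_model_HomD[OF that(2)]
    by (simp add: set_model_simps(5) setmap_Hom)
  have 2: "Idt set_model A \<in> Hom set_model A A" for A by (simp add: set_model_simps setmap_Hom)
  have 3: "Comp set_model f (Idt set_model A) = f \<and> Comp set_model (Idt set_model B) f = f"
    if f: "f \<in> Hom set_model A B" for f A B
  proof
    show "Comp set_model f (Idt set_model A) = f"
      by (rule set_model_eqI[OF 1[OF 2 f] f]) (simp add: set_model_comp_fn[OF 2], simp add: set_model_simps)
    show "Comp set_model (Idt set_model B) f = f"
      by (rule set_model_eqI[OF 1[OF f 2] f])
        (use set_model_HomD[OF f] in \<open>simp add: set_model_comp_fn[OF f], simp add: set_model_simps\<close>)
  qed
  have 4: "Comp set_model h (Comp set_model g f) = Comp set_model (Comp set_model h g) f"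
    if f: "f \<in> Hom set_model A B" and g: "g \<in> Hom set_model B C" and h: "h \<in> Hom set_model C D" for f g h A B C D
    by (rule set_model_eqI[OF 1[OF 1[OF f g] h] 1[OF f 1[OF g h]]])
      (use set_model_HomD[OF f] in \<open>simp add: set_model_comp_fn[OF 1[OF f g]]
        set_model_comp_fn[OF f] set_model_comp_fn[OF g]\<close>)
  show ?thesis
    unfolding is_category_def
  proof (intro conjI ballI impI)
    fix f g h assume "f \<in> Ar set_model" "g \<in> Ar set_model" "h \<in> Ar set_model"
      "Dom set_model g = Cod set_model f" "Dom set_model h = Cod set_model g"
    then show "Comp set_model h (Comp set_model g f) = Comp set_model (Comp set_model h g) f"
      using 4[of f _ _ g _ h] by (simp add: Hom_def)
  next
    fix f g assume "f \<in> Ar set_model" "g \<in> Ar set_model" "Dom set_model g = Cod set_model f"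
    then show "Comp set_model g f \<in> Hom set_model (Dom set_model f) (Cod set_model g)"
      using 1[of f _ _ g] by (simp add: Hom_def)
  next
    fix f assume f: "f \<in> Ar set_model"
    show "Comp set_model f (Idt set_model (Dom set_model f)) = f"
      "Comp set_model (Idt set_model (Cod set_model f)) f = f"
      using 3[OF Ar_in_Hom[OF f]] by blast+
  qed (use 2 in \<open>simp_all add: set_model_simps(1)\<close>)
qed

text \<open>A limit is the set of compatible families, coded as elements of \<open>'u\<close>.\<close>

lemma set_model_has_limits:
  fixes E :: "('s \<Rightarrow> 'u) \<Rightarrow> 'u"
  assumes E: "inj E"
  shows "has_small_limits TYPE('s) (set_model :: ('u set, _) model_structure)"
  unfolding has_small_limits_def
proof (intro allI impI)
  fix J :: "('s, 's) category" and X
  assume J: "is_category J" and X: "is_functor J (set_model :: ('u set, _) model_structure) X"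
  note DC = Dom_Cod_Ob[OF J]
  have Xf: "far X f \<in> Hom set_model (fob X (Dom J f)) (fob X (Cod J f))" if "f \<in> Ar J" for f
    by (rule functor_Hom[OF X Ar_in_Hom[OF that]])
  define T where "T = {x \<in> extensional (Ob J). (\<forall>j\<in>Ob J. x j \<in> fob X j) \<and>
    (\<forall>f\<in>Ar J. fn (far X f) (x (Dom J f)) = x (Cod J f))}"
  define l where "l j = setmap (E ` T) (fob X j) (\<lambda>y. inv E y j)" for j
  have l: "l j \<in> Hom set_model (E ` T) (fob X j)" if "j \<in> Ob J" for j
    using that E by (auto simp: l_def setmap_Hom T_def)
  have lE: "fn (l j) (E x) = x j" if "x \<in> T" for x j using that E by (simp add: l_def)
  have "is_cone J set_model X (E ` T) l"
    unfolding is_cone_def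
  proof (intro conjI ballI)
    fix f assume f: "f \<in> Ar J"
    have lD: "l (Dom J f) \<in> Hom set_model (E ` T) (fob X (Dom J f))" using l DC[OF f] by blast
    show "Comp set_model (far X f) (l (Dom J f)) = l (Cod J f)"
    proof (rule set_model_eqI[OF comp_in_Hom[OF set_model_is_category lD Xf[OF f]]])
      show "l (Cod J f) \<in> Hom set_model (E ` T) (fob X (Cod J f))" using l DC[OF f] by blast
    next
      fix y assume "y \<in> E ` T"
      then show "fn (Comp set_model (far X f) (l (Dom J f))) y = fn (l (Cod J f)) y"
        using f by (auto simp: set_model_comp_fn[OF lD] lE T_def)
    qed
  qed (simp_all add: l set_model_simps(1))
  moreover have "\<exists>!u. u \<in> Hom set_model d (E ` T) \<and> (\<forall>j\<in>Ob J. Comp set_model (l j) u = m j)"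
    if m: "is_cone J set_model X d m" for d m
  proof
    have mj: "m j \<in> Hom set_model d (fob X j)" if "j \<in> Ob J" for j using cone_Hom[OF m that] .
    define u where "u = setmap d (E ` T) (\<lambda>z. E (\<lambda>j\<in>Ob J. fn (m j) z))"
    have inT: "(\<lambda>j\<in>Ob J. fn (m j) z) \<in> T" if z: "z \<in> d" for z
    proof -
      have "fn (far X f) (fn (m (Dom J f)) z) = fn (m (Cod J f)) z" if f: "f \<in> Ar J" for f
      proof -
        have "m (Dom J f) \<in> Hom set_model d (fob X (Dom J f))" using mj DC[OF f] by blast
        from set_model_comp_fn[OF this z, of "far X f"] show ?thesis
          using m f by (simp add: is_cone_def)
      qed
      then show ?thesis using set_model_HomD(3)[OF mj z] DC by (simp add: T_def)
    qed
    have u: "u \<in> Hom set_model d (E ` T)" using inT by (simp add: u_def setmap_Hom)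
    show "u \<in> Hom set_model d (E ` T) \<and> (\<forall>j\<in>Ob J. Comp set_model (l j) u = m j)"
    proof (intro conjI ballI u)
      fix j assume j: "j \<in> Ob J"
      show "Comp set_model (l j) u = m j"
      proof (rule set_model_eqI[OF comp_in_Hom[OF set_model_is_category u l[OF j]] mj[OF j]])
        fix z assume z: "z \<in> d"
        show "fn (Comp set_model (l j) u) z = fn (m j) z"
          unfolding set_model_comp_fn[OF u z] using z by (simp add: u_def lE inT j)
      qed
    qed
    fix v assume v: "v \<in> Hom set_model d (E ` T) \<and> (\<forall>j\<in>Ob J. Comp set_model (l j) v = m j)"
    show "v = u"
    proof (rule set_model_eqI[OF conjunct1[OF v] u])
      fix z assume z: "z \<in> d"
      obtain x where x: "x \<in> T" "fn v z = E x" using set_model_HomD(3)[OF conjunct1[OF v] z] by blast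
      have "x j = fn (m j) z" if j: "j \<in> Ob J" for j
        using set_model_comp_fn[OF conjunct1[OF v] z, of "l j"] v j lE[OF x(1)] x(2) by simp
      then have "x = (\<lambda>j\<in>Ob J. fn (m j) z)"
        using x(1) by (intro extensionalityI[of _ "Ob J"]) (auto simp: T_def)
      then show "fn v z = fn u z" using x z by (simp add: u_def)
    qed
  qed
  ultimately show "\<exists>c l. is_limit J set_model X c l" unfolding is_limit_def by blast
qed

text \<open>A colimit is a quotient of the disjoint union, coded by representatives. Two elements are
  identified if every cocone identifies them, which makes the universal property immediate and avoids
  the equivalence relation generated by the diagram.\<close>

lemma set_model_has_colimits:
  fixes E :: "'s \<times> 'u \<Rightarrow> 'u"
  assumes E: "inj E"
  shows "has_small_colimits TYPE('s) (set_model :: ('u set, _) model_structure)"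
  unfolding has_small_colimits_def
proof (intro allI impI)
  fix J :: "('s, 's) category" and X
  assume J: "is_category J" and X: "is_functor J (set_model :: ('u set, _) model_structure) X"
  note DC = Dom_Cod_Ob[OF J]
  have Xf: "far X f \<in> Hom set_model (fob X (Dom J f)) (fob X (Cod J f))" if "f \<in> Ar J" for f
    by (rule functor_Hom[OF X Ar_in_Hom[OF that]])
  define S where "S = Sigma (Ob J) (fob X)"
  define eqv where "eqv p q \<longleftrightarrow> q \<in> S \<and> (\<forall>d m. is_cocone J set_model X d m \<longrightarrow>
    fn (m (fst p)) (snd p) = fn (m (fst q)) (snd q))" for p q
  define rep where "rep p = (SOME q. eqv p q)" for p
  have refl: "eqv p p" if "p \<in> S" for p using that by (simp add: eqv_def)
  have rep: "eqv p (rep p)" if "p \<in> S" for p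
    unfolding rep_def by (rule someI[of _ p]) (rule refl[OF that])
  have rep_eq: "rep p = rep q" if "eqv p q" for p q
  proof -
    have "eqv p = eqv q" using that by (auto simp: eqv_def fun_eq_iff)
    then show ?thesis by (simp add: rep_def)
  qed
  define c where "c = E ` rep ` S"
  define l where "l j = setmap (fob X j) c (\<lambda>x. E (rep (j, x)))" for j
  have l: "l j \<in> Hom set_model (fob X j) c" if "j \<in> Ob J" for j
    using that by (auto simp: l_def setmap_Hom c_def S_def)
  have "is_cocone J set_model X c l"
    unfolding is_cocone_def
  proof (intro conjI ballI)
    fix f assume f: "f \<in> Ar J"
    have lC: "l (Cod J f) \<in> Hom set_model (fob X (Cod J f)) c" and lD: "l (Dom J f) \<in> Hom set_model (fob X (Dom J f)) c"
      using l DC[OF f] by blast+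
    show "Comp set_model (l (Cod J f)) (far X f) = l (Dom J f)"
    proof (rule set_model_eqI[OF comp_in_Hom[OF set_model_is_category Xf[OF f] lC] lD])
      fix x assume x: "x \<in> fob X (Dom J f)"
      have y: "fn (far X f) x \<in> fob X (Cod J f)" by (rule set_model_HomD(3)[OF Xf[OF f] x])
      have "fn (m (Dom J f)) x = fn (m (Cod J f)) (fn (far X f) x)" if m: "is_cocone J set_model X d m" for d m
        using set_model_comp_fn[OF Xf[OF f] x, of "m (Cod J f)"] m f by (simp add: is_cocone_def)
      then have "eqv (Dom J f, x) (Cod J f, fn (far X f) x)" using y DC[OF f] by (simp add: eqv_def S_def)
      then show "fn (Comp set_model (l (Cod J f)) (far X f)) x = fn (l (Dom J f)) x"
        using rep_eq x y by (simp add: set_model_comp_fn[OF Xf[OF f] x] l_def)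
    qed
  qed (simp_all add: l set_model_simps(1))
  moreover have "\<exists>!u. u \<in> Hom set_model c d \<and> (\<forall>j\<in>Ob J. Comp set_model u (l j) = m j)"
    if m: "is_cocone J set_model X d m" for d m
  proof
    have mj: "m j \<in> Hom set_model (fob X j) d" if "j \<in> Ob J" for j using cocone_Hom[OF m that] .
    define u where "u = setmap c d (\<lambda>y. fn (m (fst (inv E y))) (snd (inv E y)))"
    have urep: "fn u (E (rep p)) = fn (m (fst p)) (snd p)" if "p \<in> S" for p
      using rep[OF that] m that E by (simp add: u_def c_def eqv_def)
    have u: "u \<in> Hom set_model c d"
      unfolding u_def setmap_Hom
    proof
      fix y assume "y \<in> c"
      then obtain p where p: "p \<in> S" "y = E (rep p)" by (auto simp: c_def)
      then have "inv E y = rep p" "rep p \<in> S" using E rep[OF p(1)] by (simp_all add: eqv_def)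
      then show "fn (m (fst (inv E y))) (snd (inv E y)) \<in> d"
        using set_model_HomD(3)[OF mj] by (auto simp: S_def)
    qed
    show "u \<in> Hom set_model c d \<and> (\<forall>j\<in>Ob J. Comp set_model u (l j) = m j)"
    proof (intro conjI ballI u)
      fix j assume j: "j \<in> Ob J"
      show "Comp set_model u (l j) = m j"
      proof (rule set_model_eqI[OF comp_in_Hom[OF set_model_is_category l[OF j] u] mj[OF j]])
        fix x assume x: "x \<in> fob X j"
        show "fn (Comp set_model u (l j)) x = fn (m j) x"
          unfolding set_model_comp_fn[OF l[OF j] x] using urep[of "(j, x)"] x j by (simp add: l_def S_def)
      qed
    qed
    fix v assume v: "v \<in> Hom set_model c d \<and> (\<forall>j\<in>Ob J. Comp set_model v (l j) = m j)"
    show "v = u"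
    proof (rule set_model_eqI[OF conjunct1[OF v] u])
      fix y assume "y \<in> c"
      then obtain j x where jx: "(j, x) \<in> S" "y = E (rep (j, x))" by (auto simp: c_def)
      then have j: "j \<in> Ob J" and x: "x \<in> fob X j" by (auto simp: S_def)
      have "fn v y = fn (Comp set_model v (l j)) x"
        using set_model_comp_fn[OF l[OF j] x, of v] x jx(2) by (simp add: l_def)
      then show "fn v y = fn u y" using v j urep[OF jx(1)] jx(2) by simp
    qed
  qed
  ultimately show "\<exists>c l. is_colimit J set_model X c l" unfolding is_colimit_def by blast
qed

lemma set_model_lifting:
  assumes i: "i \<in> cof set_model" and p: "p \<in> fib set_model"
  shows "has_lifting set_model i p"
  unfolding has_lifting_def
proof (intro ballI impI)
  fix f g
  assume f: "f \<in> Hom set_model (Dom set_model i) (Dom set_model p)"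
    and g: "g \<in> Hom set_model (Cod set_model i) (Cod set_model p)"
    and eq: "Comp set_model p f = Comp set_model g i"
  define A B where "A = fst i" and "B = fst (snd i)"
  define Q R where "Q = fst p" and "R = fst (snd p)"
  have i': "i \<in> Hom set_model A B" and inj: "inj_on (fn i) A" and p': "p \<in> Hom set_model Q R"
    and surj: "fn p ` Q = R"
    using i p by (auto simp: set_model_simps set_model_Hom A_def B_def Q_def R_def)
  have f: "f \<in> Hom set_model A Q" and g: "g \<in> Hom set_model B R"
    using f g by (simp_all add: set_model_simps A_def B_def Q_def R_def)
  define h where "h = setmap B Q (\<lambda>b. if b \<in> fn i ` A then fn f (inv_into A (fn i) b)
    else inv_into Q (fn p) (fn g b))"
  have in_Q: "inv_into Q (fn p) (fn g b) \<in> Q" "fn p (inv_into Q (fn p) (fn g b)) = fn g b" if "b \<in> B" for b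
    using surj set_model_HomD(3)[OF g that] by (auto intro: inv_into_into f_inv_into_f)
  have h: "h \<in> Hom set_model B Q"
    using set_model_HomD(3)[OF f] inj in_Q(1) by (auto simp: h_def setmap_Hom inv_into_into)
  have hi: "fn h (fn i a) = fn f a" if "a \<in> A" for a
    using that set_model_HomD(3)[OF i' that] inj by (simp add: h_def)
  have pf: "fn p (fn f a) = fn g (fn i a)" if "a \<in> A" for a
    using set_model_comp_fn[OF f that, of p] set_model_comp_fn[OF i' that, of g] eq by simp
  have "Comp set_model h i = f"
    by (rule set_model_eqI[OF comp_in_Hom[OF set_model_is_category i' h] f])
      (simp add: set_model_comp_fn[OF i'] hi)
  moreover have "Comp set_model p h = g"
  proof (rule set_model_eqI[OF comp_in_Hom[OF set_model_is_category h p'] g])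
    fix b assume b: "b \<in> B"
    show "fn (Comp set_model p h) b = fn g b"
    proof (cases "b \<in> fn i ` A")
      case True
      then show ?thesis using hi pf by (auto simp: set_model_comp_fn[OF h b])
    next
      case False
      then show ?thesis using b in_Q(2)[OF b] unfolding set_model_comp_fn[OF h b] by (simp add: h_def)
    qed
  qed
  ultimately show "\<exists>h\<in>Hom set_model (Cod set_model i) (Dom set_model p).
      Comp set_model h i = f \<and> Comp set_model p h = g"
    using h by (auto simp: set_model_simps(2,3) A_def B_def Q_def R_def)
qed

lemma set_model_retract:
  assumes "is_retract set_model f g" and f: "f \<in> Ar set_model" and g: "g \<in> Ar set_model"
  shows "g \<in> cof set_model \<Longrightarrow> f \<in> cof set_model" "g \<in> fib set_model \<Longrightarrow> f \<in> fib set_model"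
proof -
  define A B where "A = fst f" and "B = fst (snd f)"
  define A' B' where "A' = fst g" and "B' = fst (snd g)"
  have f: "f \<in> Hom set_model A B" and g: "g \<in> Hom set_model A' B'"
    using f g by (auto simp: set_model_simps set_model_Hom A_def B_def A'_def B'_def)
  obtain i r j s where i: "i \<in> Hom set_model A A'" and r: "r \<in> Hom set_model A' A"
    and j: "j \<in> Hom set_model B B'" and s: "s \<in> Hom set_model B' B"
    and eq: "Comp set_model r i = Idt set_model A" "Comp set_model s j = Idt set_model B"
      "Comp set_model g i = Comp set_model j f" "Comp set_model f r = Comp set_model s g"
    using assms(1)[unfolded is_retract_def set_model_simps(2,3), folded A_def B_def A'_def B'_def]
    by (elim bexE conjE) (rule that)
  have ri: "fn r (fn i a) = a" if "a \<in> A" for a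
    using set_model_comp_fn[OF i that, of r] eq(1) that by (simp add: set_model_simps(4))
  have sj: "fn s (fn j b) = b" if "b \<in> B" for b
    using set_model_comp_fn[OF j that, of s] eq(2) that by (simp add: set_model_simps(4))
  have gi: "fn g (fn i a) = fn j (fn f a)" if "a \<in> A" for a
    using set_model_comp_fn[OF i that, of g] set_model_comp_fn[OF f that, of j] eq(3) by simp
  have fr: "fn f (fn r a) = fn s (fn g a)" if "a \<in> A'" for a
    using set_model_comp_fn[OF r that, of f] set_model_comp_fn[OF g that, of s] eq(4) by simp
  show "f \<in> cof set_model" if "g \<in> cof set_model"
  proof -
    have inj: "inj_on (fn g) A'" using that by (simp add: set_model_simps A'_def)
    have "inj_on (fn f) A"
    proof (rule inj_onI)
      fix x y assume xy: "x \<in> A" "y \<in> A" "fn f x = fn f y"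
      then have "fn g (fn i x) = fn g (fn i y)" using gi[OF xy(1)] gi[OF xy(2)] by (simp only:)
      then have "fn i x = fn i y"
        by (rule inj_onD[OF inj _ set_model_HomD(3)[OF i xy(1)] set_model_HomD(3)[OF i xy(2)]])
      then have "fn r (fn i x) = fn r (fn i y)" by (rule arg_cong)
      then show "x = y" unfolding ri[OF xy(1)] ri[OF xy(2)] .
    qed
    then show ?thesis using f by (simp add: set_model_simps set_model_Hom)
  qed
  show "f \<in> fib set_model" if "g \<in> fib set_model"
  proof -
    have surj: "fn g ` A' = B'" using that by (simp add: set_model_simps A'_def B'_def)
    have "b \<in> fn f ` A" if b: "b \<in> B" for b
    proof -
      obtain a where a: "a \<in> A'" "fn j b = fn g a" using surj set_model_HomD(3)[OF j b] by blast
      then have "fn f (fn r a) = b" using fr[OF a(1)] sj[OF b] by simp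
      then show ?thesis using set_model_HomD(3)[OF r a(1)] by blast
    qed
    then have "fn f ` A = B" using set_model_HomD(3)[OF f] by blast
    then show ?thesis using f by (simp add: set_model_simps set_model_Hom)
  qed
qed

text \<open>\<open>f : A \<rightarrow> B\<close> factors through the disjoint union of \<open>A\<close> and \<open>B\<close>, of which \<open>a\<close> and \<open>b\<close> tag the two
  summands.\<close>

lemma set_model_factorization:
  fixes E :: "'s \<times> 'u \<Rightarrow> 'u"
  assumes E: "inj E" and ab: "(a :: 's) \<noteq> b" and f: "f \<in> Ar (set_model :: ('u set, _) model_structure)"
  shows "\<exists>i\<in>cof set_model. \<exists>p\<in>fib set_model. Dom set_model p = Cod set_model i \<and> Comp set_model p i = f"
proof -
  define A B where "A = fst f" and "B = fst (snd f)"
  have f: "f \<in> Hom set_model A B" using f by (auto simp: set_model_simps set_model_Hom A_def B_def)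
  define S where "S = E ` ({a} \<times> A \<union> {b} \<times> B)"
  define i where "i = setmap A S (\<lambda>x. E (a, x))"
  define p where "p = setmap S B (\<lambda>y. if fst (inv E y) = a then fn f (snd (inv E y)) else snd (inv E y))"
  have i: "i \<in> Hom set_model A S" by (auto simp: i_def setmap_Hom S_def)
  have p: "p \<in> Hom set_model S B"
    using E ab set_model_HomD(3)[OF f] by (auto simp: p_def setmap_Hom S_def)
  have pE: "fn p (E (a, x)) = fn f x" if "x \<in> A" for x using that E by (simp add: p_def S_def)
  have pE': "fn p (E (b, y)) = y" if "y \<in> B" for y using that E ab by (simp add: p_def S_def)
  have "inj_on (fn i) A" using E by (auto simp: i_def inj_on_def)
  then have "i \<in> cof set_model" using i by (simp add: set_model_simps set_model_Hom)
  moreover have "fn p ` S = B"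
  proof
    show "B \<subseteq> fn p ` S"
    proof
      fix y assume y: "y \<in> B"
      then have "E (b, y) \<in> S" by (auto simp: S_def)
      then show "y \<in> fn p ` S" using pE'[OF y] by (metis imageI)
    qed
  qed (use set_model_HomD(3)[OF p] in blast)
  then have "p \<in> fib set_model" using p by (simp add: set_model_simps set_model_Hom)
  moreover have "Comp set_model p i = f"
    by (rule set_model_eqI[OF comp_in_Hom[OF set_model_is_category i p] f])
      (simp add: set_model_comp_fn[OF i] pE, simp add: i_def pE)
  moreover have "Dom set_model p = Cod set_model i" by (simp add: set_model_simps p_def i_def)
  ultimately show ?thesis by blast
qed

text \<open>A family of subsets is coded by its graph.\<close>

lemma inj_function_exists: "\<exists>E :: ('s::infinite \<Rightarrow> 's set) \<Rightarrow> 's set. inj E"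
proof -
  obtain e :: "'s \<times> 's \<Rightarrow> 's" where e: "inj e" using inj_pair_exists by blast
  have "inj (\<lambda>f. e ` (SIGMA j:UNIV. f j))"
  proof (rule injI)
    fix f g :: "'s \<Rightarrow> 's set" assume "e ` (SIGMA j:UNIV. f j) = e ` (SIGMA j:UNIV. g j)"
    then have "(SIGMA j:UNIV. f j) = (SIGMA j:UNIV. g j)" by (simp add: inj_image_eq_iff[OF e])
    then show "f = g" by (auto simp: fun_eq_iff)
  qed
  then show ?thesis by blast
qed

lemma set_model_is_model_category:
  fixes E :: "('s::infinite \<Rightarrow> 'u) \<Rightarrow> 'u"
  assumes E: "inj E" and uv: "(u :: 'u) \<noteq> v"
  shows "model_category TYPE('s) (set_model :: ('u set, _) model_structure)"
proof -
  obtain c d :: 's where cd: "c \<noteq> d"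
    using arb_element[of "{undefined :: 's}"] by blast
  \<comment> \<open>Pairs are coded by functions: the value at \<open>c\<close> determines the second component, the value at any
    other index, a coded indicator function, the first.\<close>
  define F where "F p = (\<lambda>i. E (\<lambda>k. if i = c then snd p else if k = fst p then u else v))" for p :: "'s \<times> 'u"
  define P where "P p = E (F p)" for p
  have P: "inj P"
  proof (rule injI)
    fix p q :: "'s \<times> 'u" assume "P p = P q"
    then have "F p = F q" using injD[OF E] by (simp add: P_def)
    then have "F p i = F q i" for i by simp
    then have *: "(\<lambda>k. if i = c then snd p else if k = fst p then u else v)
        = (\<lambda>k. if i = c then snd q else if k = fst q then u else v)" for i
      unfolding F_def by (rule injD[OF E])
    show "p = q"
      using fun_cong[OF *[of c], of c] fun_cong[OF *[of d], of "fst p"] cd uv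
      by (auto simp: prod_eq_iff split: if_splits)
  qed
  have comp: "Comp set_model g f \<in> Ar set_model"
    if "f \<in> Ar set_model" "g \<in> Ar set_model" "Dom set_model g = Cod set_model f"
    for f g :: "'u set \<times> 'u set \<times> ('u \<Rightarrow> 'u)"
    by (rule Comp_simps(1)[OF set_model_is_category that])
  have cof: "cof set_model \<subseteq> Ar (set_model :: ('u set, _) model_structure)"
    and fib: "fib set_model \<subseteq> Ar (set_model :: ('u set, _) model_structure)"
    by (auto simp: set_model_simps)
  have fact: "\<exists>i\<in>cof set_model. \<exists>p\<in>fib set_model. Dom set_model p = Cod set_model i \<and> Comp set_model p i = f"
    if "f \<in> Ar set_model" for f :: "'u set \<times> 'u set \<times> ('u \<Rightarrow> 'u)"
    by (rule set_model_factorization[OF P cd that])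
  have weq: "cof set_model \<inter> weq set_model = cof (set_model :: ('u set, _) model_structure)"
    "fib set_model \<inter> weq set_model = fib (set_model :: ('u set, _) model_structure)"
    using cof fib by (auto simp: set_model_simps(7))
  show ?thesis
    unfolding model_category_def weq
    by (simp add: set_model_simps(7) set_model_is_category cof fib set_model_has_limits[OF E]
        set_model_has_colimits[OF P] comp set_model_retract set_model_lifting fact)
qed

section \<open>Cancellation of direct maps\<close>

lemma reedy_factorization:
  assumes "reedy_category C" "g \<in> Ar C"
  shows "\<exists>d i. d \<in> direct C \<and> i \<in> inverse C \<and> Dom C d = Cod C i \<and> Comp C d i = g"
  using assms unfolding reedy_category_def by fast

lemma reedy_factorization_unique:
  assumes "reedy_category C" "d \<in> direct C" "i \<in> inverse C" "Dom C d = Cod C i"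
    "d' \<in> direct C" "i' \<in> inverse C" "Dom C d' = Cod C i'" "Comp C d i = Comp C d' i'"
  shows "d = d' \<and> i = i'"
proof -
  have "Comp C d i \<in> Ar C"
    using assms Comp_simps(1)[OF reedy_is_category] direct_Ar inverse_Ar by metis
  then have "\<exists>!(d', i'). d' \<in> direct C \<and> i' \<in> inverse C \<and> Dom C d' = Cod C i' \<and> Comp C d' i' = Comp C d i"
    using assms(1) unfolding reedy_category_def by blast
  then have "(d, i) = (d', i')" using assms(2-8) by (auto simp: case_prod_beta)
  then show ?thesis by simp
qed

definition direct_part :: "('o, 'a, 'z) reedy_scheme \<Rightarrow> 'a \<Rightarrow> 'a" where
  "direct_part C g = (SOME d. d \<in> direct C \<and> (\<exists>i\<in>inverse C. Dom C d = Cod C i \<and> Comp C d i = g))"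

definition inverse_part :: "('o, 'a, 'z) reedy_scheme \<Rightarrow> 'a \<Rightarrow> 'a" where
  "inverse_part C g = (SOME i. i \<in> inverse C \<and> Dom C (direct_part C g) = Cod C i \<and> Comp C (direct_part C g) i = g)"

lemma reedy_parts:
  assumes C: "reedy_category C" and g: "g \<in> Hom C a b"
  shows "direct_part C g \<in> direct C" "inverse_part C g \<in> inverse C"
    "Comp C (direct_part C g) (inverse_part C g) = g"
    "inverse_part C g \<in> Hom C a (Dom C (direct_part C g))"
    "direct_part C g \<in> Hom C (Dom C (direct_part C g)) b"
proof -
  let ?P = "\<lambda>d. d \<in> direct C \<and> (\<exists>i\<in>inverse C. Dom C d = Cod C i \<and> Comp C d i = g)"
  let ?Q = "\<lambda>i. i \<in> inverse C \<and> Dom C (direct_part C g) = Cod C i \<and> Comp C (direct_part C g) i = g"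
  have "\<exists>d. ?P d" using reedy_factorization[OF C HomD[OF g, THEN conjunct1]] by blast
  then have P: "?P (direct_part C g)" unfolding direct_part_def by (rule someI_ex)
  then have "\<exists>i. ?Q i" by blast
  then have Q: "?Q (inverse_part C g)" unfolding inverse_part_def by (rule someI_ex)
  note * = direct_Ar[OF C conjunct1[OF P]] inverse_Ar[OF C conjunct1[OF Q]]
  show "direct_part C g \<in> direct C" "inverse_part C g \<in> inverse C"
    "Comp C (direct_part C g) (inverse_part C g) = g" using P Q by blast+
  show "inverse_part C g \<in> Hom C a (Dom C (direct_part C g))"
    "direct_part C g \<in> Hom C (Dom C (direct_part C g)) b"
    using Comp_simps(2,3)[OF reedy_is_category[OF C] *(2,1)] * Q HomD[OF g] by (simp_all add: Hom_def)
qed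

lemma reedy_parts_unique:
  assumes C: "reedy_category C" and i: "i \<in> inverse C" "i \<in> Hom C a b" and d: "d \<in> direct C" "d \<in> Hom C b c"
  shows "direct_part C (Comp C d i) = d" "inverse_part C (Comp C d i) = i"
proof -
  note g = reedy_parts[OF C comp_in_Hom[OF reedy_is_category[OF C] i(2) d(2)]]
  have "Dom C (direct_part C (Comp C d i)) = Cod C (inverse_part C (Comp C d i))" using HomD[OF g(4)] by simp
  moreover have "Dom C d = Cod C i" using HomD[OF i(2)] HomD[OF d(2)] by simp
  ultimately show "direct_part C (Comp C d i) = d" "inverse_part C (Comp C d i) = i"
    using reedy_factorization_unique[OF C g(1,2) _ d(1) i(1) _ g(3)] by blast+
qed

text \<open>Composing \<open>d\<close> with the factorization of \<open>x\<close> gives a factorization of \<open>d x\<close>, hence the only one.\<close>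

lemma reedy_parts_Comp:
  assumes C: "reedy_category C" and d: "d \<in> direct C" "d \<in> Hom C b c" and x: "x \<in> Hom C a b"
  shows "direct_part C (Comp C d x) = Comp C d (direct_part C x)" "inverse_part C (Comp C d x) = inverse_part C x"
proof -
  note K = reedy_is_category[OF C] and p = reedy_parts[OF C x]
  have "Comp C d x = Comp C (Comp C d (direct_part C x)) (inverse_part C x)"
    using comp_assoc[OF K p(4,5) d(2)] p(3) by simp
  moreover have "Comp C d (direct_part C x) \<in> direct C"
    using direct_Comp[OF C p(1) d(1)] HomD[OF p(5)] HomD[OF d(2)] by simp
  ultimately show "direct_part C (Comp C d x) = Comp C d (direct_part C x)"
    "inverse_part C (Comp C d x) = inverse_part C x"
    using reedy_parts_unique[OF C p(2,4) _ comp_in_Hom[OF K p(5) d(2)]] by simp_all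
qed

text \<open>If \<open>d x\<close> is direct, its inverse part is an identity; but this is also the inverse part of \<open>x\<close>.\<close>

lemma direct_cancel:
  assumes C: "reedy_category C" and d: "d \<in> direct C" "d \<in> Hom C b c" and x: "x \<in> Hom C a b"
  shows "Comp C d x \<in> direct C \<longleftrightarrow> x \<in> direct C"
proof
  note K = reedy_is_category[OF C] and p = reedy_parts[OF C x]
  assume dx: "Comp C d x \<in> direct C"
  have a: "a \<in> Ob C" using Hom_Ob[OF K x] by simp
  have H: "Comp C d x \<in> Hom C a c" by (rule comp_in_Hom[OF K x d(2)])
  have "inverse_part C (Comp C d x) = Idt C a"
    using reedy_parts_unique(2)[OF C inverse_Idt[OF C a] Idt_in_Hom[OF K a] dx H] comp_Idt_right[OF K H] by simp
  then have i: "inverse_part C x = Idt C a" using reedy_parts_Comp(2)[OF C d x] by simp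
  then have "Dom C (direct_part C x) = a" using HomD[OF p(4)] Idt_simps[OF K a] by simp
  then have "direct_part C x = x" using p(3) comp_Idt_right[OF K, of "direct_part C x" a b] p(5) i by simp
  then show "x \<in> direct C" using p(1) by simp
next
  assume "x \<in> direct C"
  then show "Comp C d x \<in> direct C" using direct_Comp[OF C _ d(1)] HomD[OF x] HomD[OF d(2)] by simp
qed

section \<open>Represented functors are Reedy cofibrant\<close>

text \<open>The injection \<open>\<iota>\<close> codes the maps of the indexing category as elements of the type on which the sets
  live.\<close>

definition represented_functor ::
  "('o, 'a, 'z) category_scheme \<Rightarrow> ('a \<Rightarrow> 'u) \<Rightarrow> 'o \<Rightarrow> ('o, 'a, 'u set, 'u set \<times> 'u set \<times> ('u \<Rightarrow> 'u)) func" where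
  "represented_functor D \<iota> \<beta> =
     \<lparr>fob = (\<lambda>\<gamma>\<in>Ob D. \<iota> ` Hom D \<beta> \<gamma>),
      far = (\<lambda>g\<in>Ar D. setmap (\<iota> ` Hom D \<beta> (Dom D g)) (\<iota> ` Hom D \<beta> (Cod D g)) (\<lambda>y. \<iota> (Comp D g (inv \<iota> y))))\<rparr>"

definition empty_functor ::
  "('o, 'a, 'z) category_scheme \<Rightarrow> ('o, 'a, 'u set, 'u set \<times> 'u set \<times> ('u \<Rightarrow> 'u)) func" where
  "empty_functor D = \<lparr>fob = (\<lambda>\<gamma>\<in>Ob D. {}), far = (\<lambda>g\<in>Ar D. setmap {} {} (\<lambda>y. y))\<rparr>"

definition empty_to_represented ::
  "('o, 'a, 'z) category_scheme \<Rightarrow> ('a \<Rightarrow> 'u) \<Rightarrow> 'o \<Rightarrow> ('o, 'a, 'u set, 'u set \<times> 'u set \<times> ('u \<Rightarrow> 'u)) nattrans" where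
  "empty_to_represented D \<iota> \<beta> =
     \<lparr>nsrc = empty_functor D, ntgt = represented_functor D \<iota> \<beta>,
      ncomp = (\<lambda>\<gamma>\<in>Ob D. setmap {} (\<iota> ` Hom D \<beta> \<gamma>) (\<lambda>y. y))\<rparr>"

lemma from_empty_set_eq:
  assumes "f \<in> Hom set_model {} B" "g \<in> Hom set_model {} B"
  shows "f = g"
  by (rule set_model_eqI[OF assms]) simp

lemma from_empty_set_Hom: "setmap {} B (\<lambda>y. y) \<in> Hom set_model {} B"
  by (simp add: setmap_Hom)

lemma to_singleton_eq:
  assumes "f \<in> Hom set_model A {u}" "g \<in> Hom set_model A {u}"
  shows "f = g"
  by (rule set_model_eqI[OF assms]) (use set_model_HomD(3)[OF assms(1)] set_model_HomD(3)[OF assms(2)] in blast)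

lemma empty_functor_Hom: "g \<in> Ar D \<Longrightarrow> far (empty_functor D) g \<in> Hom set_model {} {}"
  by (simp add: empty_functor_def from_empty_set_Hom)

lemma empty_functor_is_functor:
  assumes D: "is_category D"
  shows "is_functor D set_model (empty_functor D)"
  unfolding is_functor_def
proof (intro conjI ballI impI)
  show "far (empty_functor D) \<in> Ar D \<rightarrow>\<^sub>E Ar set_model"
  proof (rule PiE_I)
    fix g assume "g \<in> Ar D"
    from HomD[OF empty_functor_Hom[OF this]] show "far (empty_functor D) g \<in> Ar set_model" ..
  qed (simp add: empty_functor_def)
  fix g assume g: "g \<in> Ar D"
  show "far (empty_functor D) g \<in> Hom set_model (fob (empty_functor D) (Dom D g)) (fob (empty_functor D) (Cod D g))"
    using Dom_Cod_Ob[OF D g] g by (simp add: empty_functor_def from_empty_set_Hom)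
next
  fix \<gamma> assume "\<gamma> \<in> Ob D"
  then show "far (empty_functor D) (Idt D \<gamma>) = Idt set_model (fob (empty_functor D) \<gamma>)"
    using Idt_simps(1)[OF D] by (simp add: empty_functor_def set_model_simps(4))
next
  fix f g assume *: "f \<in> Ar D" "g \<in> Ar D" "Dom D g = Cod D f"
  show "far (empty_functor D) (Comp D g f) = Comp set_model (far (empty_functor D) g) (far (empty_functor D) f)"
    by (rule from_empty_set_eq[OF empty_functor_Hom[OF Comp_simps(1)[OF D *]]
        comp_in_Hom[OF set_model_is_category empty_functor_Hom[OF *(1)] empty_functor_Hom[OF *(2)]]])
qed (simp add: empty_functor_def set_model_simps(1))

context
  fixes D :: "('o, 'a, 'z) category_scheme" and \<iota> :: "'a \<Rightarrow> 'u" and \<beta> :: 'o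
  assumes D: "is_category D" and \<iota>: "inj \<iota>"
begin

lemma represented_fob: "\<gamma> \<in> Ob D \<Longrightarrow> fob (represented_functor D \<iota> \<beta>) \<gamma> = \<iota> ` Hom D \<beta> \<gamma>"
  by (simp add: represented_functor_def)

lemma represented_far_Hom:
  assumes "g \<in> Hom D \<gamma> \<gamma>'"
  shows "far (represented_functor D \<iota> \<beta>) g \<in> Hom set_model (\<iota> ` Hom D \<beta> \<gamma>) (\<iota> ` Hom D \<beta> \<gamma>')"
  using HomD[OF assms] comp_in_Hom[OF D _ assms] \<iota> by (auto simp: represented_functor_def setmap_Hom)

lemma represented_far_fn:
  assumes "g \<in> Hom D \<gamma> \<gamma>'" "y \<in> Hom D \<beta> \<gamma>"
  shows "fn (far (represented_functor D \<iota> \<beta>) g) (\<iota> y) = \<iota> (Comp D g y)"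
  using HomD[OF assms(1)] assms(2) \<iota> by (simp add: represented_functor_def)

lemma represented_is_functor: "is_functor D set_model (represented_functor D \<iota> \<beta>)" (is "is_functor D _ ?Y")
  unfolding is_functor_def
proof (intro conjI ballI impI)
  show "far ?Y \<in> Ar D \<rightarrow>\<^sub>E Ar set_model"
  proof (rule PiE_I)
    fix g assume "g \<in> Ar D"
    from HomD[OF represented_far_Hom[OF Ar_in_Hom[OF this]]] show "far ?Y g \<in> Ar set_model" ..
  qed (simp add: represented_functor_def)
  fix g assume g: "g \<in> Ar D"
  show "far ?Y g \<in> Hom set_model (fob ?Y (Dom D g)) (fob ?Y (Cod D g))"
    using represented_far_Hom[OF Ar_in_Hom[OF g]] Dom_Cod_Ob[OF D g] by (simp add: represented_fob)
next
  fix \<gamma> assume \<gamma>: "\<gamma> \<in> Ob D"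
  show "far ?Y (Idt D \<gamma>) = Idt set_model (fob ?Y \<gamma>)"
    unfolding represented_fob[OF \<gamma>]
  proof (rule set_model_eqI[OF represented_far_Hom[OF Idt_in_Hom[OF D \<gamma>]] Idt_in_Hom[OF set_model_is_category]])
    fix z assume "z \<in> \<iota> ` Hom D \<beta> \<gamma>"
    then show "fn (far ?Y (Idt D \<gamma>)) z = fn (Idt set_model (\<iota> ` Hom D \<beta> \<gamma>)) z"
      using represented_far_fn[OF Idt_in_Hom[OF D \<gamma>]] comp_Idt_left[OF D] by (auto simp: set_model_simps(4))
  qed (simp add: set_model_simps(1))
next
  fix f g assume "f \<in> Ar D" "g \<in> Ar D" "Dom D g = Cod D f"
  then have f: "f \<in> Hom D (Dom D f) (Cod D f)" and g: "g \<in> Hom D (Cod D f) (Cod D g)"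
    by (auto simp: Hom_def)
  note Yf = represented_far_Hom[OF f] and Yg = represented_far_Hom[OF g]
  show "far ?Y (Comp D g f) = Comp set_model (far ?Y g) (far ?Y f)"
  proof (rule set_model_eqI[OF represented_far_Hom[OF comp_in_Hom[OF D f g]]
        comp_in_Hom[OF set_model_is_category Yf Yg]])
    fix z assume z: "z \<in> \<iota> ` Hom D \<beta> (Dom D f)"
    then obtain y where y: "y \<in> Hom D \<beta> (Dom D f)" "z = \<iota> y" by auto
    show "fn (far ?Y (Comp D g f)) z = fn (Comp set_model (far ?Y g) (far ?Y f)) z"
      using set_model_comp_fn[OF Yf z] represented_far_fn[OF comp_in_Hom[OF D f g] y(1)] represented_far_fn[OF f y(1)]
        represented_far_fn[OF g comp_in_Hom[OF D y(1) f]] comp_assoc[OF D y(1) f g] by (simp add: y(2))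
  qed
qed (simp add: represented_functor_def set_model_simps(1))

lemma empty_to_represented_Hom:
  "\<gamma> \<in> Ob D \<Longrightarrow> ncomp (empty_to_represented D \<iota> \<beta>) \<gamma> \<in> Hom set_model {} (\<iota> ` Hom D \<beta> \<gamma>)"
  by (simp add: empty_to_represented_def from_empty_set_Hom)

lemma empty_to_represented_is_nattrans: "is_nattrans D set_model (empty_to_represented D \<iota> \<beta>)" (is "is_nattrans D _ ?t")
  unfolding is_nattrans_def
proof (intro conjI ballI)
  fix g assume g: "g \<in> Ar D"
  note M = set_model_is_category
  have o: "Dom D g \<in> Ob D" "Cod D g \<in> Ob D" using Dom_Cod_Ob[OF D g] by auto
  from from_empty_set_eq[OF comp_in_Hom[OF M empty_functor_Hom[OF g] empty_to_represented_Hom[OF o(2)]]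
      comp_in_Hom[OF M empty_to_represented_Hom[OF o(1)] represented_far_Hom[OF Ar_in_Hom[OF g]]]]
  show "Comp set_model (ncomp ?t (Cod D g)) (far (nsrc ?t) g) = Comp set_model (far (ntgt ?t) g) (ncomp ?t (Dom D g))"
    by (simp add: empty_to_represented_def)
next
  fix \<gamma> assume \<gamma>: "\<gamma> \<in> Ob D"
  show "ncomp ?t \<gamma> \<in> Hom set_model (fob (nsrc ?t) \<gamma>) (fob (ntgt ?t) \<gamma>)"
    using empty_to_represented_Hom[OF \<gamma>] \<gamma> represented_fob[OF \<gamma>]
    by (simp add: empty_to_represented_def empty_functor_def)
qed (use empty_functor_is_functor[OF D] represented_is_functor in \<open>simp_all add: empty_to_represented_def\<close>)

end

text \<open>The latching map of the represented functor at \<open>\<gamma>\<close> is the inclusion of those \<open>x : \<beta> \<rightarrow> \<gamma>\<close> whose direct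
  part is not an identity: by unique factorization, such an \<open>x\<close> comes from the inverse part of \<open>x\<close>, placed at
  the object of the latching category that is the direct part of \<open>x\<close>. So a solution of a latching problem
  is given by the cocone on these elements and by arbitrary preimages under \<open>p\<close> on the others.\<close>

proposition represented_functor_cofibrant:
  fixes D :: "('s::infinite, 's) reedy" and \<iota> :: "'s \<Rightarrow> 'u"
  assumes D: "reedy_category D" and \<iota>: "inj \<iota>"
    and MM: "model_category TYPE('s) (set_model :: ('u set, _) model_structure)"
  shows "empty_to_represented D \<iota> \<beta> \<in> cof (reedy_model D set_model)"
proof -
  note KD = reedy_is_category[OF D] and M = set_model_is_category
  note Yar = represented_far_Hom[OF KD \<iota>, where \<beta> = \<beta>] and Yfn = represented_far_fn[OF KD \<iota>, where \<beta> = \<beta>]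
    and T = empty_to_represented_Hom[OF KD \<iota>, where \<beta> = \<beta>] and parts = reedy_parts[OF D]
  let ?M = "set_model :: ('u set, 'u set \<times> 'u set \<times> ('u \<Rightarrow> 'u)) model_structure"
  let ?X = "empty_functor D" and ?Y = "represented_functor D \<iota> \<beta>" and ?t = "empty_to_represented D \<iota> \<beta>"
  have t_simps: "nsrc ?t = ?X" "ntgt ?t = ?Y" by (simp_all add: empty_to_represented_def)
  have "latching_problems_solvable D ?M ?t \<gamma> p" if \<gamma>: "\<gamma> \<in> Ob D" and p: "p \<in> fib ?M" for \<gamma> p
    unfolding latching_problems_solvable_def t_simps
  proof (intro allI impI)
    let ?J = "latching_category D \<gamma>"
    fix f k s
    assume k: "is_cocone ?J ?M (latching_diagram D ?Y \<gamma>) (Dom ?M p) k"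
      and f: "f \<in> Hom ?M (fob ?X \<gamma>) (Dom ?M p)" and s: "s \<in> Hom ?M (fob ?Y \<gamma>) (Cod ?M p)"
      and pk: "\<forall>\<nu>\<in>Ob ?J. Comp ?M p (k \<nu>) = Comp ?M s (far ?Y \<nu>)"
    define A B where "A = Dom ?M p" and "B = Cod ?M p"
    have p': "p \<in> Hom ?M A B" and surj: "fn p ` A = B"
      using p by (auto simp: A_def B_def set_model_simps set_model_Hom)
    have s: "s \<in> Hom ?M (\<iota> ` Hom D \<beta> \<gamma>) B" and f: "f \<in> Hom ?M {} A"
      using s f represented_fob[OF KD \<iota> \<gamma>] \<gamma> by (simp_all add: A_def B_def empty_functor_def)
    have k\<nu>: "k \<nu> \<in> Hom ?M (\<iota> ` Hom D \<beta> (Dom D \<nu>)) A" if "\<nu> \<in> Ob ?J" for \<nu>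
      using cocone_Hom[OF k that] latching_diagram_fob[OF that, of ?Y]
        represented_fob[OF KD \<iota> latching_Dom_Ob[OF D that]]
      by (simp add: A_def)
    have k\<tau>: "Comp ?M (k \<nu>) (far ?Y \<tau>) = k (Comp D \<nu> \<tau>)"
      if "\<nu> \<in> Ob ?J" "\<tau> \<in> direct D" "Cod D \<tau> = Dom D \<nu>" for \<nu> \<tau>
      using latching_coconeD(2)[OF D k that]
        that(3) by simp
    define h where "h = setmap (\<iota> ` Hom D \<beta> \<gamma>) A (\<lambda>z. let x = inv \<iota> z in
      if direct_part D x \<in> Ob ?J then fn (k (direct_part D x)) (\<iota> (inverse_part D x)) else inv_into A (fn p) (fn s z))"
    have kp: "fn (k (direct_part D x)) (\<iota> (inverse_part D x)) \<in> A"
      "fn p (fn (k (direct_part D x)) (\<iota> (inverse_part D x))) = fn s (\<iota> x)"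
      if x: "x \<in> Hom D \<beta> \<gamma>" and d: "direct_part D x \<in> Ob ?J" for x
    proof -
      note H = parts(4,5)[OF x]
      have \<epsilon>: "\<iota> (inverse_part D x) \<in> \<iota> ` Hom D \<beta> (Dom D (direct_part D x))" using H(1) by simp
      show "fn (k (direct_part D x)) (\<iota> (inverse_part D x)) \<in> A" by (rule set_model_HomD(3)[OF k\<nu>[OF d] \<epsilon>])
      have "fn (Comp ?M p (k (direct_part D x))) (\<iota> (inverse_part D x))
          = fn (Comp ?M s (far ?Y (direct_part D x))) (\<iota> (inverse_part D x))"
        using pk d by simp
      then show "fn p (fn (k (direct_part D x)) (\<iota> (inverse_part D x))) = fn s (\<iota> x)"
        using set_model_comp_fn[OF k\<nu>[OF d] \<epsilon>] set_model_comp_fn[OF Yar[OF H(2)] \<epsilon>] Yfn[OF H(2,1)]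
          parts(3)[OF x] by simp
    qed
    have ps: "inv_into A (fn p) (fn s z) \<in> A" "fn p (inv_into A (fn p) (fn s z)) = fn s z" if "z \<in> \<iota> ` Hom D \<beta> \<gamma>" for z
      using surj set_model_HomD(3)[OF s that] by (auto intro: inv_into_into f_inv_into_f)
    have h: "h \<in> Hom ?M (\<iota> ` Hom D \<beta> \<gamma>) A"
      unfolding h_def setmap_Hom using kp(1) ps(1) \<iota> by (auto simp: Let_def)
    have "Comp ?M h (far ?Y \<nu>) = k \<nu>" if \<nu>: "\<nu> \<in> Ob ?J" for \<nu>
    proof (rule set_model_eqI[OF comp_in_Hom[OF M Yar[OF latching_Hom[OF D \<nu>]] h] k\<nu>[OF \<nu>]])
      fix z assume z: "z \<in> \<iota> ` Hom D \<beta> (Dom D \<nu>)"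
      then obtain x where x: "x \<in> Hom D \<beta> (Dom D \<nu>)" "z = \<iota> x" by auto
      note \<nu>' = latching_ObD(1)[OF \<nu>] latching_Hom[OF D \<nu>]
      note parts_\<nu> = reedy_parts_Comp[OF D \<nu>' x(1)] and Hx = parts(4,5)[OF x(1)]
      have Cx: "Cod D (direct_part D x) = Dom D \<nu>" using HomD[OF Hx(2)] by simp
      have "Comp D \<nu> (direct_part D x) \<in> Ob ?J"
        using direct_Comp[OF D parts(1)[OF x(1)] \<nu>'(1)] direct_Comp_not_Idt[OF D parts(1)[OF x(1)] \<nu>'(1)]
          Cx latching_ObD[OF \<nu>]
          HomD[OF comp_in_Hom[OF KD Hx(2) \<nu>'(2)]] by (simp add: latching_category_simps(1))
      moreover have "\<iota> (Comp D \<nu> x) \<in> \<iota> ` Hom D \<beta> \<gamma>" using comp_in_Hom[OF KD x(1) \<nu>'(2)] by simp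
      ultimately have "fn h (\<iota> (Comp D \<nu> x)) = fn (k (Comp D \<nu> (direct_part D x))) (\<iota> (inverse_part D x))"
        using parts_\<nu> \<iota> by (simp add: h_def)
      also have "\<dots> = fn (k \<nu>) (fn (far ?Y (direct_part D x)) (\<iota> (inverse_part D x)))"
        using k\<tau>[OF \<nu> parts(1)[OF x(1)] Cx]
          set_model_comp_fn[OF Yar[OF Hx(2)], of "\<iota> (inverse_part D x)" "k \<nu>"] Hx(1) by simp
      also have "\<dots> = fn (k \<nu>) z" using Yfn[OF Hx(2,1)] parts(3)[OF x(1)] x(2) by simp
      finally show "fn (Comp ?M h (far ?Y \<nu>)) z = fn (k \<nu>) z"
        using set_model_comp_fn[OF Yar[OF \<nu>'(2)] z, of h] Yfn[OF \<nu>'(2) x(1)] x(2) by simp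
    qed
    moreover have "Comp ?M p h = s"
    proof (rule set_model_eqI[OF comp_in_Hom[OF M h p'] s])
      fix z assume z: "z \<in> \<iota> ` Hom D \<beta> \<gamma>"
      then obtain x where x: "x \<in> Hom D \<beta> \<gamma>" "z = \<iota> x" by auto
      then show "fn (Comp ?M p h) z = fn s z"
        using set_model_comp_fn[OF h z, of p] kp(2)[OF x(1)] ps(2)[OF z] z \<iota> by (simp add: h_def)
    qed
    moreover have "Comp ?M h (ncomp ?t \<gamma>) = f"
      by (rule from_empty_set_eq[OF comp_in_Hom[OF M T[OF \<gamma>] h] f])
    ultimately show "\<exists>h\<in>Hom ?M (fob ?Y \<gamma>) (Dom ?M p). Comp ?M h (ncomp ?t \<gamma>) = f \<and>
        (\<forall>\<nu>\<in>Ob ?J. Comp ?M h (far ?Y \<nu>) = k \<nu>) \<and> Comp ?M p h = s"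
      using h represented_fob[OF KD \<iota> \<gamma>] by (auto simp: A_def)
  qed
  then show ?thesis
    unfolding reedy_cofibration_iff[OF D MM] using empty_to_represented_is_nattrans[OF KD \<iota>] by blast
qed

section \<open>Detecting cofibering functors\<close>

text \<open>Given two factorizations \<open>x0\<close> and \<open>x1\<close> of \<open>\<sigma>\<close>, consider the latching problem for \<open>G\<^sup>*\<close> of the
  represented functor against the map from a two-element set to a point, with the indicator function of the
  component of \<open>x0\<close> as cocone. A solution takes at \<open>\<sigma>\<close> the value that the indicator function has at any
  factorization of \<open>\<sigma>\<close>, so \<open>x1\<close> lies in the component of \<open>x0\<close>.\<close>

proposition cofibering_if_left_quillen_set_model:
  fixes C D :: "('s::infinite, 's) reedy" and \<iota> :: "'s \<Rightarrow> 'u"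
  assumes C: "reedy_category C" and D: "reedy_category D" and G: "reedy_functor C D G"
    and \<iota>: "inj \<iota>" and MM: "model_category TYPE('s) (set_model :: ('u set, _) model_structure)"
    and LQ: "left_quillen (reedy_model D set_model) (reedy_model C set_model)
               (precomposition C D (set_model :: ('u set, _) model_structure) G)"
  shows "cofibering C D G"
  unfolding cofibering_iff_zigzag[OF C D reedy_functorD(1)[OF G]]
proof (intro ballI impI)
  note KC = reedy_is_category[OF C] and KD = reedy_is_category[OF D] and G' = reedy_functorD[OF G]
  let ?M = "set_model :: ('u set, 'u set \<times> 'u set \<times> ('u \<Rightarrow> 'u)) model_structure"
  note M = set_model_is_category
  fix \<alpha> \<sigma> x0 x1
  assume \<alpha>: "\<alpha> \<in> Ob C" and \<sigma>: "\<sigma> \<in> direct D" "Cod D \<sigma> = fob G \<alpha>"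
  let ?E = "direct_factorizations C D G \<alpha> \<sigma>"
  assume x0: "x0 \<in> Ob ?E" and x1: "x1 \<in> Ob ?E"
  define \<beta> where "\<beta> = Dom D \<sigma>"
  note Yar = represented_far_Hom[OF KD \<iota>, where \<beta> = \<beta>] and Yfn = represented_far_fn[OF KD \<iota>, where \<beta> = \<beta>]
    and T = empty_to_represented_Hom[OF KD \<iota>, where \<beta> = \<beta>]
    and t = empty_to_represented_is_nattrans[OF KD \<iota>, where \<beta> = \<beta>]
  let ?X = "empty_functor D" and ?Y = "represented_functor D \<iota> \<beta>" and ?t = "empty_to_represented D \<iota> \<beta>"
  have t_simps: "nsrc ?t = ?X" "ntgt ?t = ?Y" by (simp_all add: empty_to_represented_def)
  have "far (precomposition C D ?M G) ?t \<in> cof (reedy_model C ?M)"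
    using LQ represented_functor_cofibrant[OF D \<iota> MM] unfolding left_quillen_def by blast
  then have solvable: "latching_problems_solvable C ?M (far (precomposition C D ?M G) ?t) \<alpha> p"
    if "p \<in> fib ?M" "p \<in> weq ?M" for p
    using \<alpha> that unfolding reedy_cofibration_iff[OF C MM] by blast

  obtain c d :: 's where "c \<noteq> d"
    using arb_element[of "{undefined :: 's}"] by blast
  then obtain u v :: 'u where uv: "u \<noteq> v" using injD[OF \<iota>] by blast
  let ?J = "latching_category C \<alpha>"
  have E: "is_category ?E" by (rule direct_factorizations_is_category[OF C D G'(1)])
  define Q where "Q \<nu> x \<longleftrightarrow> (\<nu>, x) \<in> Ob ?E \<and> (x0, (\<nu>, x)) \<in> zigzag ?E" for \<nu> x
  define k where "k \<nu> = setmap (\<iota> ` Hom D \<beta> (fob G (Dom C \<nu>))) {u, v} (\<lambda>z. if Q \<nu> (inv \<iota> z) then u else v)" for \<nu>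
  define p where "p = setmap {u, v} {u} (\<lambda>_. u)"
  define s where "s = setmap (\<iota> ` Hom D \<beta> (fob G \<alpha>)) {u} (\<lambda>_. u)"
  define f where "f = setmap {} {u, v} (\<lambda>y. y)"
  have p: "p \<in> fib ?M" "p \<in> weq ?M" "p \<in> Hom ?M {u, v} {u}" "Dom ?M p = {u, v}" "Cod ?M p = {u}"
    by (auto simp: p_def setmap_def set_model_simps set_model_Hom)
  have G\<alpha>: "fob G \<alpha> \<in> Ob D" by (rule functor_Ob[OF G'(1) \<alpha>])
  have k\<nu>: "k \<nu> \<in> Hom ?M (\<iota> ` Hom D \<beta> (fob G (Dom C \<nu>))) {u, v}" for \<nu> by (simp add: k_def setmap_Hom)
  have kfn: "fn (k \<nu>) (\<iota> x) = (if Q \<nu> x then u else v)" if "x \<in> Hom D \<beta> (fob G (Dom C \<nu>))" for \<nu> x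
    using that \<iota> by (simp add: k_def)
  have s: "s \<in> Hom ?M (\<iota> ` Hom D \<beta> (fob G \<alpha>)) {u}" and f: "f \<in> Hom ?M {} {u, v}"
    by (simp_all add: s_def f_def setmap_Hom)
  have G\<nu>: "far G \<nu> \<in> Hom D (fob G a) (fob G b)" if "\<nu> \<in> Hom C a b" for \<nu> a b by (rule functor_Hom[OF G'(1) that])
  \<comment> \<open>The cocone condition for the indicator function: by cancellation \<open>x\<close> is direct if and only if
    \<open>G \<tau> \<circ> x\<close> is, and then \<open>\<tau>\<close> is a map between the factorizations that they belong to.\<close>
  have Q_shift: "Q \<nu> (Comp D (far G \<tau>) x) \<longleftrightarrow> Q (Comp C \<nu> \<tau>) x"
    if \<nu>: "\<nu> \<in> Ob ?J" and \<tau>: "\<tau> \<in> direct C" "\<tau> \<in> Hom C (Dom C \<tau>) (Dom C \<nu>)"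
      and x: "x \<in> Hom D \<beta> (fob G (Dom C \<tau>))" for \<nu> \<tau> x
  proof -
    note \<nu>' = latching_ObD[OF \<nu>] latching_Hom[OF C \<nu>]
    have G\<tau>: "far G \<tau> \<in> direct D" by (rule G'(2)[OF \<tau>(1)])
    have C\<tau>: "Cod C \<tau> = Dom C \<nu>" using HomD[OF \<tau>(2)] by simp
    have D\<nu>\<tau>: "Dom C (Comp C \<nu> \<tau>) = Dom C \<tau>" using HomD[OF comp_in_Hom[OF KC \<tau>(2) \<nu>'(4)]] by simp
    have \<nu>\<tau>: "Comp C \<nu> \<tau> \<in> Ob ?J"
      using direct_Comp[OF C \<tau>(1) \<nu>'(1)] direct_Comp_not_Idt[OF C \<tau>(1) \<nu>'(1)] \<nu>'(2,3) C\<tau>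
        HomD[OF comp_in_Hom[OF KC \<tau>(2) \<nu>'(4)]] by (simp add: latching_category_simps(1))
    have dir: "Comp D (far G \<tau>) x \<in> direct D \<longleftrightarrow> x \<in> direct D"
      by (rule direct_cancel[OF D G\<tau> G\<nu>[OF \<tau>(2)] x])
    have "Comp D (far G \<nu>) (Comp D (far G \<tau>) x) = Comp D (far G (Comp C \<nu> \<tau>)) x"
      using comp_assoc[OF KD x G\<nu>[OF \<tau>(2)] G\<nu>[OF \<nu>'(4)]] functor_Comp[OF G'(1) \<tau>(2) \<nu>'(4)] by simp
    then have Ob_iff: "(\<nu>, Comp D (far G \<tau>) x) \<in> Ob ?E \<longleftrightarrow> (Comp C \<nu> \<tau>, x) \<in> Ob ?E"
      using dir \<nu> \<nu>\<tau> x comp_in_Hom[OF KD x G\<nu>[OF \<tau>(2)]] D\<nu>\<tau>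
      by (simp add: direct_factorizations_simps(1) \<beta>_def)
    have "(x0, (\<nu>, Comp D (far G \<tau>) x)) \<in> zigzag ?E \<longleftrightarrow> (x0, (Comp C \<nu> \<tau>, x)) \<in> zigzag ?E"
      if o: "(\<nu>, Comp D (far G \<tau>) x) \<in> Ob ?E"
    proof -
      have "((Comp C \<nu> \<tau>, x), \<tau>, (\<nu>, Comp D (far G \<tau>) x)) \<in> Ar ?E"
        using o Ob_iff \<tau> D\<nu>\<tau> by (simp add: direct_factorizations_simps(2))
      from zigzag_Ar[OF this] show ?thesis
        unfolding direct_factorizations_simps(3,4) by (blast intro: zigzag_trans)
    qed
    with Ob_iff show ?thesis by (auto simp: Q_def)
  qed
  have k: "is_cocone ?J ?M (latching_diagram C (func_comp C ?Y G) \<alpha>) {u, v} k"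
    unfolding latching_cocone_iff[OF C]
  proof (intro conjI ballI impI)
    fix \<nu> assume \<nu>: "\<nu> \<in> Ob ?J"
    have o: "Dom C \<nu> \<in> Ob C" by (rule latching_Dom_Ob[OF C \<nu>])
    show "k \<nu> \<in> Hom ?M (fob (func_comp C ?Y G) (Dom C \<nu>)) {u, v}"
      using k\<nu> o represented_fob[OF KD \<iota> functor_Ob[OF G'(1) o]] by simp
    fix \<tau> assume \<tau>: "\<tau> \<in> direct C" "Cod C \<tau> = Dom C \<nu>"
    have \<tau>': "\<tau> \<in> Hom C (Dom C \<tau>) (Dom C \<nu>)" using direct_Hom[OF C \<tau>(1)] \<tau>(2) by simp
    have D\<nu>\<tau>: "Dom C (Comp C \<nu> \<tau>) = Dom C \<tau>" using HomD[OF comp_in_Hom[OF KC \<tau>' latching_Hom[OF C \<nu>]]] by simp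
    have "Comp ?M (k \<nu>) (far ?Y (far G \<tau>)) = k (Comp C \<nu> \<tau>)"
    proof (rule set_model_eqI[OF comp_in_Hom[OF M Yar[OF G\<nu>[OF \<tau>']] k\<nu>]])
      show "k (Comp C \<nu> \<tau>) \<in> Hom ?M (\<iota> ` Hom D \<beta> (fob G (Dom C \<tau>))) {u, v}" using k\<nu>[of "Comp C \<nu> \<tau>"] D\<nu>\<tau> by simp
      fix z assume z: "z \<in> \<iota> ` Hom D \<beta> (fob G (Dom C \<tau>))"
      then obtain x where x: "x \<in> Hom D \<beta> (fob G (Dom C \<tau>))" "z = \<iota> x" by auto
      show "fn (Comp ?M (k \<nu>) (far ?Y (far G \<tau>))) z = fn (k (Comp C \<nu> \<tau>)) z"
        using set_model_comp_fn[OF Yar[OF G\<nu>[OF \<tau>']] z, of "k \<nu>"] Yfn[OF G\<nu>[OF \<tau>'] x(1)]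
          kfn[OF comp_in_Hom[OF KD x(1) G\<nu>[OF \<tau>']]] kfn[of x "Comp C \<nu> \<tau>"] D\<nu>\<tau> x Q_shift[OF \<nu> \<tau>(1) \<tau>' x(1)]
        by simp
    qed
    then show "Comp ?M (k \<nu>) (far (func_comp C ?Y G) \<tau>) = k (Comp C \<nu> \<tau>)"
      using direct_Ar[OF C \<tau>(1)] by simp
  qed (simp add: set_model_simps(1))
  have "\<exists>h\<in>Hom ?M (fob ?Y (fob G \<alpha>)) {u, v}. \<forall>\<nu>\<in>Ob ?J. Comp ?M h (far ?Y (far G \<nu>)) = k \<nu>"
  proof -
    have \<nu>: "Comp ?M (k \<nu>) (ncomp ?t (fob G (Dom C \<nu>))) = Comp ?M f (far ?X (far G \<nu>))"
      "Comp ?M p (k \<nu>) = Comp ?M s (far ?Y (far G \<nu>))" "\<nu> \<in> Ar C" "Dom C \<nu> \<in> Ob C" if \<nu>: "\<nu> \<in> Ob ?J" for \<nu>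
    proof -
      note \<nu>' = latching_Hom[OF C \<nu>]
      show o: "Dom C \<nu> \<in> Ob C" and "\<nu> \<in> Ar C" using latching_Dom_Ob[OF C \<nu>] HomD[OF \<nu>'] by auto
      from from_empty_set_eq[OF comp_in_Hom[OF M T[OF functor_Ob[OF G'(1) o]] k\<nu>]
          comp_in_Hom[OF M empty_functor_Hom[OF HomD[OF G\<nu>[OF \<nu>'], THEN conjunct1]] f]]
      show "Comp ?M (k \<nu>) (ncomp ?t (fob G (Dom C \<nu>))) = Comp ?M f (far ?X (far G \<nu>))" .
      from to_singleton_eq[OF comp_in_Hom[OF M k\<nu> p(3)] comp_in_Hom[OF M Yar[OF G\<nu>[OF \<nu>']] s]]
      show "Comp ?M p (k \<nu>) = Comp ?M s (far ?Y (far G \<nu>))" .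
    qed
    have pf: "Comp ?M p f = Comp ?M s (ncomp ?t (fob G \<alpha>))"
      by (rule to_singleton_eq[OF comp_in_Hom[OF M f p(3)] comp_in_Hom[OF M T[OF G\<alpha>] s]])
    note sol = solvable[OF p(1,2), unfolded latching_problems_solvable_def precomposition_far[OF t] t_simps p(4,5)
        nattrans.select_convs restrict_apply'[OF \<alpha>], rule_format, of k f s]
    have "\<exists>h\<in>Hom ?M (fob (func_comp C ?Y G) \<alpha>) {u, v}. Comp ?M h (ncomp ?t (fob G \<alpha>)) = f \<and>
        (\<forall>\<nu>\<in>Ob ?J. Comp ?M h (far (func_comp C ?Y G) \<nu>) = k \<nu>) \<and> Comp ?M p h = s"
      using sol k f s \<nu> pf \<alpha> G\<alpha> represented_fob[OF KD \<iota> G\<alpha>] by (simp add: empty_functor_def)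
    then show ?thesis using \<alpha> \<nu>(3) by auto
  qed
  then obtain h where h: "h \<in> Hom ?M (\<iota> ` Hom D \<beta> (fob G \<alpha>)) {u, v}"
    and hk: "\<And>\<nu>. \<nu> \<in> Ob ?J \<Longrightarrow> Comp ?M h (far ?Y (far G \<nu>)) = k \<nu>"
    unfolding represented_fob[OF KD \<iota> G\<alpha>] by blast
  have h_\<sigma>: "fn h (\<iota> \<sigma>) = (if Q \<nu> \<mu> then u else v)" if o: "(\<nu>, \<mu>) \<in> Ob ?E" for \<nu> \<mu>
  proof -
    have \<nu>: "\<nu> \<in> Ob ?J" and \<mu>: "\<mu> \<in> Hom D \<beta> (fob G (Dom C \<nu>))" "Comp D (far G \<nu>) \<mu> = \<sigma>"
      using o by (auto simp: direct_factorizations_simps(1) \<beta>_def)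
    note GH = G\<nu>[OF latching_Hom[OF C \<nu>]]
    have "fn (Comp ?M h (far ?Y (far G \<nu>))) (\<iota> \<mu>) = fn h (\<iota> \<sigma>)"
      using set_model_comp_fn[OF Yar[OF GH], of "\<iota> \<mu>" h] Yfn[OF GH \<mu>(1)] \<mu> by simp
    then show ?thesis using hk[OF \<nu>] kfn[OF \<mu>(1)] by simp
  qed
  obtain \<nu>0 \<mu>0 \<nu>1 \<mu>1 where x01: "x0 = (\<nu>0, \<mu>0)" "x1 = (\<nu>1, \<mu>1)" by (cases x0, cases x1)
  have "Q \<nu>0 \<mu>0" using x0 by (simp add: Q_def x01 zigzag_def)
  then have "Q \<nu>1 \<mu>1"
    using h_\<sigma>[of \<nu>0 \<mu>0] h_\<sigma>[of \<nu>1 \<mu>1] x0 x1 uv by (auto simp: x01 split: if_splits)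
  then show "(x0, x1) \<in> zigzag ?E" by (simp add: Q_def x01)
qed

theorem theorem1p2:
  fixes C D :: "('s::infinite, 's) reedy"
    and G :: "('s, 's, 's, 's) func"
  assumes "reedy_category C" and "reedy_category D" and "reedy_functor C D G"
  shows "((\<forall>M :: ('s large_ob, 's large_ar) model_structure.
             model_category TYPE('s) M \<longrightarrow>
             left_quillen (reedy_model D M) (reedy_model C M) (precomposition C D M G))
          \<longleftrightarrow> cofibering C D G)
       \<and> (cofibering C D G \<longrightarrow>
            (\<forall>M :: ('o, 'a) model_structure.
               model_category TYPE('s) M \<longrightarrow>
               left_quillen (reedy_model D M) (reedy_model C M) (precomposition C D M G)))"
proof (intro conjI iffI impI allI)
  assume LQ: "\<forall>M :: ('s large_ob, 's large_ar) model_structure. model_category TYPE('s) M \<longrightarrow>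
      left_quillen (reedy_model D M) (reedy_model C M) (precomposition C D M G)"
  obtain E :: "('s \<Rightarrow> 's set) \<Rightarrow> 's set" where "inj E" using inj_function_exists by blast
  then have "model_category TYPE('s) (set_model :: ('s large_ob, 's large_ar) model_structure)"
    by (rule set_model_is_model_category[of E "{}" UNIV]) simp
  then show "cofibering C D G"
    using LQ by (intro cofibering_if_left_quillen_set_model[OF assms, of "\<lambda>x. {x}"]) simp_all
qed (use cofibering_imp_left_quillen[OF assms] in blast)+

end
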